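(* Let $p$ be a prime, $k$ a finite field with $q$ elements ($q$ a power of $p$). Fix a ramification data $R$ of length $r$ and a splitting behavior $S$, and fix one weighted branch divisor $W_\circ$ of type $R,S$. Then $$\sum_{[(C,\iota)]\text{ of type } R,S}\frac{1}{|\mathrm{Cent}_{\mathrm{Aut}_k(C)}\langle\iota\rangle|}=p^{-1}\,|N_{W_\circ}|\cdot T,$$ where the sum ranges over $k$-isomorphism classes of Artin--Schreier curves with automorphism whose cover has type $R,S$.
   Context: Let $\mathrm{AS}(k(x))=\{z^p-z:z\in k(x)\}$. An Artin--Schreier curve with automorphism over $k$ is a pair $(C,\iota)$ with $C$ the smooth projective geometrically irreducible curve with affine equation $y^p-y=u(x)$, $u\in k(x)\setminus\mathrm{AS}(k(x))$, and $\iota:(x,y)\mapsto(x,y+1)$; pairs $(C_1,\iota_1),(C_2,\iota_2)$ are $k$-isomorphic if there is a $k$-isomorphism $\varphi$ with $\iota_2\circ\varphi=\varphi\circ\iota_1$, equivalently $u_2(x)\equiv u_1(\gamma(x))\bmod\mathrm{AS}(k(x))$ for some $\gamma\in\mathrm{PGL}_2(k)$ acting by fractional linear transformations. $\mathrm{Cent}_{\mathrm{Aut}_k(C)}\langle\iota\rangle$ is the centralizer of $\langle\iota\rangle$ in $\mathrm{Aut}_k(C)$. One may take $u$ with all poles of order prime to $p$; then its weighted branch divisor is $W=\mathrm{div}_\infty(u)=\sum e_Q Q$ (a Frobenius-stable effective divisor on $\mathbb P^1(\bar k)$ with multiplicities prime to $p$). Its ramification data is the multiset $R=\{e_Q+1\}$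 (of length $r$ = number of poles) and its splitting behavior $S$ is the data of the decomposition of the support into Frobenius orbits (closed points of $\mathbb P^1_k$) of degrees $m_1,\dots,m_s$ with $\sum m_i=r$, together with the pole order attached to each orbit; "type $R,S$" refers to these data. $N_{W_\circ}$ is the set of $u\in k(x)$ with $\mathrm{div}_\infty(u)=W_\circ$, taken modulo $\mathrm{AS}(k(x))$. For a weighted branch divisor $W$, $\Gamma_W=\{\gamma\in\mathrm{PGL}_2(k):\gamma(W)=W\}$. $T=\sum_{\mathcal O}1/|\Gamma_W|$, the sum over the $\mathrm{PGL}_2(k)$-orbits $\mathcal O$ of weighted branch divisors of type $R,S$, with $W$ any representative of $\mathcal O$ (the paper writes this as $\sum_H|\theta_H|/|H|$, grouping orbits according to the conjugacy class $H$ of the stabilizer). *)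

theory Defs
  imports
    "HOL-Analysis.Determinants"
    "HOL-Algebra.Bij"
    "HOL-Algebra.RingHom"
    "HOL-Algebra.QuotRing"
    "HOL-Algebra.Generated_Groups"
    "HOL-Algebra.Algebraic_Closure_Type"
begin

text \<open>
  A finite field \<open>k\<close> is a type \<open>'k :: {field, finite}\<close>, its algebraic closure is
  \<open>'k alg_closure\<close>, and \<open>k(x)\<close> is \<open>'k poly fract\<close>. The characteristic \<open>p\<close> is an
  explicit argument.
\<close>

section \<open>Rational functions and divisors on the projective line\<close>

definition artin_schreier :: "nat \<Rightarrow> 'a::ring_1 set" where
  "artin_schreier p = {z ^ p - z | z. True}"

lemma map_poly_to_ac_mult:
  "map_poly to_ac (a * b) = map_poly to_ac a * (map_poly to_ac b :: 'k::field alg_closure poly)"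
  by (rule poly_eqI) (simp add: coeff_map_poly coeff_mult to_ac_sum)

lemma map_poly_to_ac_eq_0_iff: "map_poly to_ac a = (0 :: 'k::field alg_closure poly) \<longleftrightarrow> a = 0"
  by (rule map_poly_eq_0_iff) auto

definition base_change :: "'k::field poly fract \<Rightarrow> 'k alg_closure poly fract" where
  "base_change u = (THE v. \<exists>a b. b \<noteq> 0 \<and> u = Fract a b \<and>
     v = Fract (map_poly to_ac a) (map_poly to_ac b))"

lemma base_change_Fract:
  assumes "b \<noteq> 0"
  shows "base_change (Fract a b) = Fract (map_poly to_ac a) (map_poly to_ac b)"
  unfolding base_change_def
proof (rule the_equality)
  fix v
  assume "\<exists>a' b'. b' \<noteq> 0 \<and> Fract a b = Fract a' b' \<and>
    v = Fract (map_poly to_ac a') (map_poly to_ac b')"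
  then obtain a' b' where *: "b' \<noteq> 0" "Fract a b = Fract a' b'"
    "v = Fract (map_poly to_ac a') (map_poly to_ac b')"
    by blast
  hence "map_poly to_ac (a * b') = map_poly to_ac (a' * b)"
    using assms by (simp add: eq_fract)
  thus "v = Fract (map_poly to_ac a) (map_poly to_ac b)"
    using * assms by (simp add: eq_fract map_poly_to_ac_eq_0_iff map_poly_to_ac_mult)
qed (use assms in blast)

datatype 'a proj_line = Affine 'a | Infinity

fun ord_quot :: "'a::field proj_line \<Rightarrow> 'a poly \<Rightarrow> 'a poly \<Rightarrow> int" where
  "ord_quot (Affine z) a b = int (Polynomial.order z a) - int (Polynomial.order z b)"
| "ord_quot Infinity a b = int (Polynomial.degree b) - int (Polynomial.degree a)"

text \<open>The order of vanishing at a point; the value at the zero function is irrelevant, since only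
  poles are of interest below.\<close>

definition ord_at :: "'a::field proj_line \<Rightarrow> 'a poly fract \<Rightarrow> int" where
  "ord_at Q f = (if f = 0 then 0
     else (THE d. \<exists>a b. a \<noteq> 0 \<and> b \<noteq> 0 \<and> f = Fract a b \<and> d = ord_quot Q a b))"

lemma ord_at_Fract:
  assumes "a \<noteq> 0" "b \<noteq> 0"
  shows "ord_at Q (Fract a b) = ord_quot Q a b"
proof -
  have "ord_quot Q a b = ord_quot Q c d"
    if "c \<noteq> 0" "d \<noteq> 0" "Fract a b = Fract c d" for c d
  proof -
    have eq: "a * d = c * b"
      using that assms by (simp add: eq_fract)
    have "Polynomial.order z a + Polynomial.order z d = Polynomial.order z c + Polynomial.order z b" for z
      using arg_cong[OF eq, of "Polynomial.order z"] assms that by (simp add: order_mult)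
    hence 1: "int (Polynomial.order z a) + int (Polynomial.order z d)
        = int (Polynomial.order z c) + int (Polynomial.order z b)" for z
      by (simp flip: of_nat_add)
    have "Polynomial.degree a + Polynomial.degree d = Polynomial.degree c + Polynomial.degree b"
      using arg_cong[OF eq, of Polynomial.degree] assms that by (simp add: degree_mult_eq)
    thus ?thesis
      using 1 by (cases Q) (auto simp: algebra_simps)
  qed
  hence "(THE e. \<exists>c d. c \<noteq> 0 \<and> d \<noteq> 0 \<and> Fract a b = Fract c d \<and> e = ord_quot Q c d) = ord_quot Q a b"
    using assms by (intro the_equality) (blast, metis)
  moreover have "Fract a b \<noteq> 0"
    using assms by (simp add: Zero_fract_def eq_fract)
  ultimately show ?thesis
    by (simp add: ord_at_def)
qed

definition pole_order :: "'k::field alg_closure proj_line \<Rightarrow> 'k poly fract \<Rightarrow> nat" where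
  "pole_order Q u = nat (- ord_at Q (base_change u))"

text \<open>An effective divisor is a finite multiset of points.\<close>

definition div_infinity :: "'k::field poly fract \<Rightarrow> 'k alg_closure proj_line multiset" where
  "div_infinity u = (\<Sum>Q \<in> {Q. pole_order Q u > 0}. replicate_mset (pole_order Q u) Q)"

lemma finite_poles: "finite {Q. pole_order Q (u :: 'k::field poly fract) > 0}"
proof -
  obtain a b where u: "u = Fract a b" "b \<noteq> 0"
    by (cases u)
  define a' b' :: "'k alg_closure poly" where "a' = map_poly to_ac a" and "b' = map_poly to_ac b"
  have b': "b' \<noteq> 0"
    using u by (simp add: b'_def map_poly_to_ac_eq_0_iff)
  have bc: "base_change u = Fract a' b'"
    using u by (simp add: base_change_Fract a'_def b'_def)
  have "{Q. pole_order Q u > 0} \<subseteq> insert Infinity (Affine ` {z. poly b' z = 0})"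
  proof
    fix Q assume "Q \<in> {Q. pole_order Q u > 0}"
    hence neg: "ord_at Q (Fract a' b') < 0"
      by (simp add: pole_order_def bc)
    hence "a' \<noteq> 0"
      by (auto simp: ord_at_def Zero_fract_def eq_fract b')
    hence "ord_quot Q a' b' < 0"
      using neg b' by (simp add: ord_at_Fract)
    thus "Q \<in> insert Infinity (Affine ` {z. poly b' z = 0})"
      using b' by (cases Q) (auto simp: order_root)
  qed
  thus ?thesis
    using b' poly_roots_finite finite_subset by blast
qed

lemma count_div_infinity [simp]: "count (div_infinity u) Q = pole_order Q u"
  by (auto simp: div_infinity_def count_sum finite_poles)

section \<open>Artin--Schreier curves with automorphism\<close>

definition AS_poly :: "nat \<Rightarrow> 'a::field \<Rightarrow> 'a poly" where
  "AS_poly p u = Polynomial.monom 1 p - Polynomial.monom 1 1 - [:u:]"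

text \<open>
  \<open>AS_curve p u\<close>: the equation \<open>y^p - y = u\<close> defines an Artin--Schreier curve; the second conjunct
  is geometric irreducibility. Curves with automorphism are indexed by such \<open>u\<close>.
\<close>

definition AS_curve :: "nat \<Rightarrow> 'k::field poly fract \<Rightarrow> bool" where
  "AS_curve p u \<longleftrightarrow> u \<notin> artin_schreier p \<and> irreducible (AS_poly p (base_change u))"

text \<open>
  A smooth projective geometrically irreducible curve \<open>C\<close> is represented by its function field
  \<open>k(C)\<close>, an extension of \<open>k\<close>; \<open>k\<close>-isomorphisms of curves correspond contravariantly to
  \<open>k\<close>-isomorphisms of function fields. The function field \<open>k(x)[y]/(y^p - y - u)\<close> is modelled on
  the reduced representatives, i.e. the polynomials in \<open>y\<close> of degree less than \<open>p\<close>.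
\<close>

definition fun_field :: "nat \<Rightarrow> 'k::field poly fract \<Rightarrow> 'k poly fract poly ring" where
  "fun_field p u = \<lparr>
     carrier = {f. Polynomial.degree f < p},
     monoid.mult = (\<lambda>f g. (f * g) mod AS_poly p u),
     one = 1,
     ring.zero = 0,
     add = (+)\<rparr>"

definition const :: "'k::field \<Rightarrow> 'k poly fract poly" where
  "const c = [:to_fract [:c:]:]"

text \<open>The comorphism of \<open>(x, y) \<mapsto> (x, y + 1)\<close>.\<close>

definition iota :: "nat \<Rightarrow> 'k::field poly fract \<Rightarrow> 'k poly fract poly \<Rightarrow> 'k poly fract poly" where
  "iota p u = (\<lambda>f \<in> carrier (fun_field p u). pcompose f [:1, 1:])"

definition fun_field_iso ::
  "nat \<Rightarrow> 'k::field poly fract \<Rightarrow> 'k poly fract \<Rightarrow> ('k poly fract poly \<Rightarrow> 'k poly fract poly) set" where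
  "fun_field_iso p u v = {\<phi> \<in> ring_iso (fun_field p u) (fun_field p v). \<forall>c. \<phi> (const c) = const c}"

text \<open>\<open>\<phi>\<close> is the comorphism of an isomorphism from the curve of \<open>u1\<close> to that of \<open>u2\<close>.\<close>

definition AS_isomorphic :: "nat \<Rightarrow> 'k::field poly fract \<Rightarrow> 'k poly fract \<Rightarrow> bool" where
  "AS_isomorphic p u1 u2 \<longleftrightarrow> (\<exists>\<phi> \<in> fun_field_iso p u2 u1.
     \<forall>f \<in> carrier (fun_field p u2). \<phi> (iota p u2 f) = iota p u1 (\<phi> f))"

definition AS_iso_rel :: "nat \<Rightarrow> 'k::field poly fract rel" where
  "AS_iso_rel p = {(u1, u2). AS_curve p u1 \<and> AS_curve p u2 \<and> AS_isomorphic p u1 u2}"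

definition Aut_curve :: "nat \<Rightarrow> 'k::field poly fract \<Rightarrow> ('k poly fract poly \<Rightarrow> 'k poly fract poly) monoid" where
  "Aut_curve p u = BijGroup (carrier (fun_field p u))
     \<lparr>carrier := fun_field_iso p u u \<inter> extensional (carrier (fun_field p u))\<rparr>"

definition centralizer :: "('g, 'b) monoid_scheme \<Rightarrow> 'g set \<Rightarrow> 'g set" where
  "centralizer G H = {g \<in> carrier G. \<forall>h \<in> H. g \<otimes>\<^bsub>G\<^esub> h = h \<otimes>\<^bsub>G\<^esub> g}"

definition Cent_iota :: "nat \<Rightarrow> 'k::field poly fract \<Rightarrow> ('k poly fract poly \<Rightarrow> 'k poly fract poly) set" where
  "Cent_iota p u = centralizer (Aut_curve p u) (generate (Aut_curve p u) {iota p u})"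

section \<open>Weighted branch divisors and their types\<close>

text \<open>
  The branch divisor of the curve of \<open>u\<close> is read off from a representative \<open>v\<close> of the class of \<open>u\<close>
  modulo \<open>artin_schreier p\<close> in standard form, i.e. all of whose poles have order prime to \<open>p\<close>.
\<close>

definition branch_divisor_of :: "nat \<Rightarrow> 'k::field poly fract \<Rightarrow> 'k alg_closure proj_line multiset \<Rightarrow> bool" where
  "branch_divisor_of p u W \<longleftrightarrow> (\<exists>v. v - u \<in> artin_schreier p \<and>
     (\<forall>Q. pole_order Q v > 0 \<longrightarrow> coprime (pole_order Q v) p) \<and> W = div_infinity v)"

definition weighted_branch_divisor :: "nat \<Rightarrow> 'k::field alg_closure proj_line multiset \<Rightarrow> bool" where
  "weighted_branch_divisor p W \<longleftrightarrow> (\<exists>u. AS_curve p u \<and> branch_divisor_of p u W)"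

definition frobenius_orbit :: "'k::field alg_closure proj_line \<Rightarrow> 'k alg_closure proj_line set" where
  "frobenius_orbit Q = range (\<lambda>n. (map_proj_line (\<lambda>z. z ^ CARD('k)) ^^ n) Q)"

definition ramification_data :: "'k::field alg_closure proj_line multiset \<Rightarrow> nat multiset" where
  "ramification_data W = image_mset (\<lambda>Q. count W Q + 1) (mset_set (set_mset W))"

text \<open>
  One pair (degree, pole order) for each Frobenius orbit in the support; \<open>W\<close> being Frobenius-stable,
  \<open>count W\<close> is constant on an orbit.
\<close>

definition splitting_behavior :: "'k::field alg_closure proj_line multiset \<Rightarrow> (nat \<times> nat) multiset" where
  "splitting_behavior W =
     image_mset (\<lambda>P. (card P, the_elem (count W ` P))) (mset_set (frobenius_orbit ` set_mset W))"

definition has_type :: "'k::field alg_closure proj_line multiset \<Rightarrow> nat multiset \<Rightarrow> (nat \<times> nat) multiset \<Rightarrow> bool" where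
  "has_type W R S \<longleftrightarrow> ramification_data W = R \<and> splitting_behavior W = S"

definition curves_of_type :: "nat \<Rightarrow> nat multiset \<Rightarrow> (nat \<times> nat) multiset \<Rightarrow> 'k::field poly fract set" where
  "curves_of_type p R S = {u. AS_curve p u \<and> (\<exists>W. branch_divisor_of p u W \<and> has_type W R S)}"

definition divisors_of_type ::
  "nat \<Rightarrow> nat multiset \<Rightarrow> (nat \<times> nat) multiset \<Rightarrow> 'k::field alg_closure proj_line multiset set" where
  "divisors_of_type p R S = {W. weighted_branch_divisor p W \<and> has_type W R S}"

definition N_of :: "nat \<Rightarrow> 'k::field alg_closure proj_line multiset \<Rightarrow> 'k poly fract set set" where
  "N_of p W = {u. div_infinity u = W} // {(u, v). v - u \<in> artin_schreier p}"

section \<open>The projective linear group\<close>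

definition PGL2 :: "('k::field ^ 2 ^ 2) set set" where
  "PGL2 = {A. invertible A} // {(A, B). \<exists>c. c \<noteq> 0 \<and> B = mat c ** A}"

fun moebius :: "'k::field ^ 2 ^ 2 \<Rightarrow> 'k alg_closure proj_line \<Rightarrow> 'k alg_closure proj_line" where
  "moebius A (Affine z) =
     (if to_ac (A $ 2 $ 1) * z + to_ac (A $ 2 $ 2) = 0 then Infinity
      else Affine ((to_ac (A $ 1 $ 1) * z + to_ac (A $ 1 $ 2)) / (to_ac (A $ 2 $ 1) * z + to_ac (A $ 2 $ 2))))"
| "moebius A Infinity =
     (if A $ 2 $ 1 = 0 then Infinity else Affine (to_ac (A $ 1 $ 1) / to_ac (A $ 2 $ 1)))"

text \<open>Independent of the chosen matrix, since proportional matrices act alike.\<close>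

definition PGL2_divisor ::
  "('k::field ^ 2 ^ 2) set \<Rightarrow> 'k alg_closure proj_line multiset \<Rightarrow> 'k alg_closure proj_line multiset" where
  "PGL2_divisor \<gamma> W = image_mset (moebius (SOME A. A \<in> \<gamma>)) W"

definition Gamma_of :: "'k::field alg_closure proj_line multiset \<Rightarrow> ('k ^ 2 ^ 2) set set" where
  "Gamma_of W = {\<gamma> \<in> PGL2. PGL2_divisor \<gamma> W = W}"

definition PGL2_orbit_rel :: "'k::field alg_closure proj_line multiset rel" where
  "PGL2_orbit_rel = {(W, W'). \<exists>\<gamma> \<in> PGL2. W' = PGL2_divisor \<gamma> W}"

end

theory Submission
  imports Defs
begin

text \<open>
  Both sides count orbits of \<open>PGL\<^sub>2(k)\<close>. An isomorphism of function fields commuting with \<open>\<iota>\<close>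
  preserves the fixed field \<open>k(x)\<close> of \<open>\<iota>\<close> and satisfies \<open>y \<mapsto> y + z\<close> with \<open>z \<in> k(x)\<close>, so it amounts to a
  pair \<open>(\<gamma>, z)\<close> with \<open>u\<^sub>2 \<circ> \<gamma> = u\<^sub>1 + z\<^sup>p - z\<close>. Hence the curves up to isomorphism are the orbits of
  \<open>PGL\<^sub>2(k)\<close> on the set \<open>M\<close> of classes of functions \<open>u\<close> modulo \<open>AS(k(x))\<close>, and the centralizer of \<open>\<iota>\<close>
  has \<open>p\<close> times as many elements as the stabilizer of the class. By orbit counting the left-hand side
  is \<open>p\<^sup>-\<^sup>1 |M| / |PGL\<^sub>2(k)|\<close> and \<open>T = |D| / |PGL\<^sub>2(k)|\<close>, where \<open>D\<close> is the set of divisors of type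
  \<open>R, S\<close>. Sending the class of a function in standard form to its polar divisor maps \<open>M\<close> onto \<open>D\<close> with
  fibres \<open>N\<^sub>W\<close>. It remains to see that \<open>|N\<^sub>W|\<close> depends on the type of \<open>W\<close> only: the space \<open>L(W)\<close> of a
  Frobenius-stable \<open>W\<close> has \<open>q\<^bsup>deg W + 1\<^esup>\<close> elements, inclusion-exclusion over the Frobenius orbits gives
  the number of functions with polar divisor exactly \<open>W\<close>, and each class contains \<open>|L(\<lfloor>W/p\<rfloor>)| / p\<close> of
  them.
\<close>

text \<open>The count runs over invertible matrices rather than \<open>PGL2\<close>: every
  projective class contains \<open>q - 1\<close> of them, and this factor enters both sides and
  cancels. Matrices act on functions by substitution, which reverses products and moves polar
  divisors by the inverse matrix. Only orbits and sizes of stabilizers matter, so the reversal is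
  harmless. The factor \<open>p\<close> in the centralizer is the choice of \<open>z\<close> for a
  given matrix, since the additive map \<open>z ^ p - z\<close> has the prime field as its kernel.
  That every divisor in \<open>D\<close> is hit needs no existence theorem, because a weighted
  branch divisor is by definition that of some curve. The obstacle is the size of the fibres: two
  divisors of one type may lie in different orbits, where no symmetry relates the functions with
  these poles. So the fibres are computed explicitly. Frobenius makes this feasible: a function over
  \<open>k\<close> has the same pole order at all points of an orbit, so a pole order can only drop
  on a whole orbit at once.\<close>

locale field_hom =
  fixes \<sigma> :: "'a::field \<Rightarrow> 'b::field"
  assumes hom_1 [simp]: "\<sigma> 1 = 1"
    and hom_add [simp]: "\<sigma> (x + y) = \<sigma> x + \<sigma> y"
    and hom_mult [simp]: "\<sigma> (x * y) = \<sigma> x * \<sigma> y"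
begin

lemma hom_0 [simp]: "\<sigma> 0 = 0"
  by (metis add_cancel_right_left hom_add)

lemma hom_uminus [simp]: "\<sigma> (- x) = - \<sigma> x"
  using hom_add[of x "- x"] by (simp add: add_eq_0_iff)

lemma hom_diff [simp]: "\<sigma> (x - y) = \<sigma> x - \<sigma> y"
  using hom_add[of x "- y"] by simp

lemma hom_power [simp]: "\<sigma> (x ^ n) = \<sigma> x ^ n"
  by (induction n) simp_all

lemma hom_of_nat [simp]: "\<sigma> (of_nat n) = of_nat n"
  by (induction n) simp_all

lemma hom_eq_0_iff [simp]: "\<sigma> x = 0 \<longleftrightarrow> x = 0"
proof
  assume 0: "\<sigma> x = 0"
  show "x = 0"
  proof (rule ccontr)
    assume "x \<noteq> 0"
    hence "\<sigma> (x * inverse x) = 1" by simp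
    thus False using 0 by (subst (asm) hom_mult) simp
  qed
qed simp

lemma hom_eq_iff [simp]: "\<sigma> x = \<sigma> y \<longleftrightarrow> x = y"
  using hom_eq_0_iff[of "x - y"] by (simp del: hom_eq_0_iff)

lemma inj_hom: "inj \<sigma>"
  by (simp add: inj_on_def)

lemma hom_inverse [simp]: "\<sigma> (inverse x) = inverse (\<sigma> x)"
proof (cases "x = 0")
  case False
  hence "\<sigma> (x * inverse x) = 1" by simp
  thus ?thesis
    by (subst (asm) hom_mult) (simp add: inverse_unique)
qed simp

lemma hom_divide [simp]: "\<sigma> (x / y) = \<sigma> x / \<sigma> y"
  by (simp add: divide_inverse)

lemma hom_sum: "\<sigma> (\<Sum>x\<in>A. f x) = (\<Sum>x\<in>A. \<sigma> (f x))"
  by (induction A rule: infinite_finite_induct) simp_all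

lemma coeff_map [simp]: "poly.coeff (map_poly \<sigma> p) n = \<sigma> (poly.coeff p n)"
  by (simp add: coeff_map_poly)

lemma map_poly_add [simp]: "map_poly \<sigma> (p + q) = map_poly \<sigma> p + map_poly \<sigma> q"
  by (rule poly_eqI) simp

lemma map_poly_diff [simp]: "map_poly \<sigma> (p - q) = map_poly \<sigma> p - map_poly \<sigma> q"
  by (rule poly_eqI) simp

lemma map_poly_mult [simp]: "map_poly \<sigma> (p * q) = map_poly \<sigma> p * map_poly \<sigma> q"
  by (rule poly_eqI) (simp add: coeff_mult hom_sum)

lemma map_poly_pCons' [simp]: "map_poly \<sigma> (pCons a q) = pCons (\<sigma> a) (map_poly \<sigma> q)"
  by (simp add: map_poly_pCons)

lemma map_poly_power [simp]: "map_poly \<sigma> (p ^ n) = map_poly \<sigma> p ^ n"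
  by (induction n) simp_all

lemma map_poly_eq_iff [simp]: "map_poly \<sigma> p = map_poly \<sigma> q \<longleftrightarrow> p = q"
  by (auto simp: poly_eq_iff)

lemma map_poly_eq_0 [simp]: "map_poly \<sigma> p = 0 \<longleftrightarrow> p = 0"
  by (auto simp: poly_eq_iff)

lemma degree_map [simp]: "Polynomial.degree (map_poly \<sigma> p) = Polynomial.degree p"
  by (cases "p = 0") (simp_all add: map_poly_degree_eq)

lemma poly_map: "poly (map_poly \<sigma> p) (\<sigma> z) = \<sigma> (poly p z)"
  by (induction p) simp_all

lemma map_pcompose: "map_poly \<sigma> (pcompose p q) = pcompose (map_poly \<sigma> p) (map_poly \<sigma> q)"
  by (induction p) (simp_all add: pcompose_pCons)

text \<open>Division with remainder survives \<open>\<sigma>\<close>, so the image of the remainder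
  is divisible by that of \<open>a\<close> while having smaller degree; it must vanish. This is how
  divisibility descends from the closure to \<open>k\<close>.\<close>

lemma map_poly_dvd_iff: "map_poly \<sigma> a dvd map_poly \<sigma> b \<longleftrightarrow> a dvd b"
proof
  assume "map_poly \<sigma> a dvd map_poly \<sigma> b"
  moreover have "map_poly \<sigma> b = map_poly \<sigma> a * map_poly \<sigma> (b div a) + map_poly \<sigma> (b mod a)"
    by (subst mult_div_mod_eq[of a b, symmetric], subst map_poly_add, subst map_poly_mult) (rule refl)
  ultimately have dvd: "map_poly \<sigma> a dvd map_poly \<sigma> (b mod a)"
    by (simp add: dvd_add_right_iff)
  show "a dvd b"
  proof (cases "a = 0 \<or> b mod a = 0")
    case False
    hence "Polynomial.degree (b mod a) < Polynomial.degree a"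
      using degree_mod_less by blast
    thus ?thesis
      using dvd dvd_imp_degree_le[OF dvd] False by simp
  qed (use dvd in \<open>auto simp: dvd_eq_mod_eq_0\<close>)
next
  assume "a dvd b"
  thus "map_poly \<sigma> a dvd map_poly \<sigma> b"
    by (metis dvd_def map_poly_mult)
qed

lemma order_map: "Polynomial.order (\<sigma> z) (map_poly \<sigma> p) = Polynomial.order z p"
proof (cases "p = 0")
  case False
  have *: "map_poly \<sigma> ([:- z, 1:] ^ n) = [:- \<sigma> z, 1:] ^ n" for n
    by (simp only: map_poly_power) simp
  have "n \<le> Polynomial.order (\<sigma> z) (map_poly \<sigma> p) \<longleftrightarrow> n \<le> Polynomial.order z p" for n
    using order_divides[of "\<sigma> z" n "map_poly \<sigma> p"] order_divides[of z n p]
      map_poly_dvd_iff[of "[:- z, 1:] ^ n" p] False unfolding * by simp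
  thus ?thesis
    by (meson order_antisym order_refl)
qed (simp add: Polynomial.order_def)

end

section \<open>Polynomials over the algebraic closure, and fractions in lowest terms\<close>

lemma field_hom_to_ac: "field_hom (to_ac :: 'a::field \<Rightarrow> _)"
  by unfold_locales simp_all

interpretation to_ac: field_hom "to_ac :: 'a::field \<Rightarrow> 'a alg_closure"
  by (rule field_hom_to_ac)

lemma field_hom_comp: "field_hom f \<Longrightarrow> field_hom g \<Longrightarrow> field_hom (\<lambda>x. f (g x))"
  by (simp add: field_hom_def)

text \<open>A nonconstant \<open>p\<close> has a root, which \<open>q\<close> shares by the
  condition on orders; cancel the common linear factor and induct on the degree.\<close>

lemma dvd_if_order_le:
  fixes p q :: "'a::alg_closed_field poly"
  assumes "p \<noteq> 0" and "\<And>z. Polynomial.order z p \<le> Polynomial.order z q"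
  shows "p dvd q"
proof (cases "q = 0")
  case False
  show ?thesis
    using assms False
  proof (induction "Polynomial.degree p" arbitrary: p q rule: less_induct)
    case less
    show ?case
    proof (cases "Polynomial.degree p = 0")
      case True
      thus ?thesis using is_unit_iff_degree[OF \<open>p \<noteq> 0\<close>] unit_imp_dvd by blast
    next
      case False
      then obtain z where z: "poly p z = 0"
        using alg_closed_imp_poly_has_root by blast
      hence "poly q z = 0"
        using less.prems(1,3) less.prems(2)[of z] by (auto simp: order_root)
      obtain p' q' where p': "p = [:-z, 1:] * p'" and q': "q = [:-z, 1:] * q'"
        using z \<open>poly q z = 0\<close> by (metis dvd_def poly_eq_0_iff_dvd)
      have nz: "p' \<noteq> 0" "q' \<noteq> 0" using p' q' less.prems by auto
      have "Polynomial.order w p' \<le> Polynomial.order w q'" for w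
        using less.prems(2)[of w] order_mult[OF less.prems(1)[unfolded p'], of w] order_mult[OF less.prems(3)[unfolded q'], of w]
        unfolding p' q' by linarith
      moreover have "Polynomial.degree p' < Polynomial.degree p"
        using nz unfolding p' by (simp add: degree_mult_eq del: mult_pCons_left)
      ultimately have "p' dvd q'"
        using less.hyps[of p' q'] nz by blast
      thus ?thesis unfolding p' q' by (rule mult_dvd_mono[OF dvd_refl])
    qed
  qed
qed simp

lemma monic_eq_if_order_eq:
  fixes p q :: "'a::alg_closed_field poly"
  assumes "lead_coeff p = 1" "lead_coeff q = 1" "\<And>z. Polynomial.order z p = Polynomial.order z q"
  shows "p = q"
proof -
  have nz: "p \<noteq> 0" "q \<noteq> 0" using assms by auto
  have "p dvd q" "q dvd p" using nz assms dvd_if_order_le by (metis order_refl)+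
  then obtain c where c: "q = p * c" by auto
  have "Polynomial.degree q = Polynomial.degree p"
    using \<open>p dvd q\<close> \<open>q dvd p\<close> nz by (simp add: dvd_imp_degree_le order_antisym)
  hence "Polynomial.degree c = 0" using nz c by (auto simp: degree_mult_eq)
  then obtain d where d: "c = [:d:]" by (auto elim: degree_eq_zeroE)
  have "lead_coeff c = 1" using c assms(1,2) by (simp add: lead_coeff_mult)
  thus ?thesis using c d by simp
qed

lemma poly_bezout:
  fixes a b :: "'a::field poly"
  shows "\<exists>d r s. d = r * a + s * b \<and> d dvd a \<and> d dvd b"
proof (induction "if b = 0 then 0 else Suc (Polynomial.degree b)" arbitrary: a b rule: less_induct)
  case less
  show ?case
  proof (cases "b = 0")
    case True
    show ?thesis by (rule exI[of _ a], rule exI[of _ 1], rule exI[of _ 0]) (simp add: True)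
  next
    case False
    hence "(if a mod b = 0 then 0 else Suc (Polynomial.degree (a mod b))) < (if b = 0 then 0 else Suc (Polynomial.degree b))"
      using degree_mod_less[of b a] by auto
    then obtain d r s where d: "d = r * b + s * (a mod b)" "d dvd b" "d dvd a mod b"
      using less by blast
    have "d = s * a + (r - s * (a div b)) * b"
      by (subst d(1), subst minus_div_mult_eq_mod[of a b, symmetric]) (simp add: algebra_simps)
    moreover have "d dvd a" using d by (simp add: dvd_mod_iff)
    ultimately show ?thesis using d by blast
  qed
qed

text \<open>Lowest terms are recorded by a Bezout identity, the form of coprimality that
  \<open>bezout_dvd_mult_power\<close> consumes.\<close>

lemma fract_coprime_rep:
  fixes u :: "'a::field poly fract"
  obtains a b r s where "b \<noteq> 0" "u = Fract a b" "r * a + s * b = 1"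
proof -
  obtain a0 b0 where u: "u = Fract a0 b0" "b0 \<noteq> 0" by (cases u)
  obtain d r s where d: "d = r * a0 + s * b0" "d dvd a0" "d dvd b0"
    using poly_bezout by blast
  obtain a b where ab: "a0 = d * a" "b0 = d * b" using d(2,3) by (elim dvdE)
  have nz: "d \<noteq> 0" "b \<noteq> 0" using u ab by auto
  have "d * (r * a + s * b) = d * 1" using d(1) ab by (simp add: algebra_simps)
  hence "r * a + s * b = 1" using nz by (simp only: mult_cancel_left) simp
  moreover have "u = Fract a b" using u ab nz by (simp add: eq_fract)
  ultimately show ?thesis using that nz by blast
qed

lemma bezout_dvd_mult_power:
  fixes a b y :: "'a::comm_ring_1"
  assumes "r * a + s * b = 1" "b dvd y * a ^ m"
  shows "b dvd y"
  using assms(2)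
proof (induction m)
  case (Suc m)
  have "y * a ^ m = y * a ^ m * (r * a + s * b)" using assms by simp
  also have "\<dots> = r * (y * a ^ Suc m) + b * (y * a ^ m * s)" by (simp add: algebra_simps)
  also have "b dvd \<dots>" using Suc.prems by (auto intro: dvd_add)
  finally show ?case by (rule Suc.IH)
qed simp

subsection \<open>Constants and substitution\<close>

definition cst :: "'a::field \<Rightarrow> 'a poly fract" where
  "cst c = to_fract [:c:]"

definition frX :: "'a::field poly fract" where
  "frX = to_fract [:0, 1:]"

interpretation cst: field_hom "cst :: 'a::field \<Rightarrow> _"
proof
  show "cst (1::'a) = 1" unfolding cst_def by (subst one_pCons[symmetric]) (rule to_fract_1)
  show "cst (x + y :: 'a) = cst x + cst y" for x y unfolding cst_def by (subst to_fract_add[symmetric]) simp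
  show "cst (x * y :: 'a) = cst x * cst y" for x y unfolding cst_def by (subst to_fract_mult[symmetric]) simp
qed

lemma to_fract_eq_poly: "to_fract p = poly (map_poly cst p) frX"
proof (induction p)
  case (pCons a p)
  have "to_fract (pCons a p) = to_fract [:a:] + to_fract [:0, 1:] * to_fract p"
    unfolding to_fract_add[symmetric] to_fract_mult[symmetric] by simp
  also have "\<dots> = cst a + frX * poly (map_poly cst p) frX"
    unfolding pCons by (simp add: cst_def frX_def)
  finally show ?case by simp
qed simp

lemma frX_neq_cst: "frX \<noteq> cst c"
  by (simp add: frX_def cst_def)

lemma khom_Fract:
  assumes "field_hom \<sigma>"
  shows "\<sigma> (Fract a b) = poly (map_poly (\<lambda>c. \<sigma> (cst c)) a) (\<sigma> frX) / poly (map_poly (\<lambda>c. \<sigma> (cst c)) b) (\<sigma> frX)"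
proof -
  interpret field_hom \<sigma> by fact
  have "poly (map_poly (\<lambda>c. \<sigma> (cst c)) p) (\<sigma> frX) = \<sigma> (poly (map_poly cst p) frX)" for p
    by (subst poly_map[symmetric]) (simp add: map_poly_map_poly o_def)
  thus ?thesis by (simp add: Fract_conv_to_fract to_fract_eq_poly)
qed

text \<open>Constants and \<open>x\<close> generate \<open>k(x)\<close> as a field. Identities
  between compositions of substitutions and base change are proved by this criterion.\<close>

lemma khom_eqI:
  assumes "field_hom \<sigma>" "field_hom \<tau>" "\<And>c. \<sigma> (cst c) = \<tau> (cst c)" "\<sigma> frX = \<tau> frX"
  shows "\<sigma> u = \<tau> u"
  by (cases u) (simp add: khom_Fract[OF assms(1)] khom_Fract[OF assms(2)] assms(3,4))

text \<open>The rational root argument in homogeneous form: every term except that with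
  \<open>i = m\<close> contains a factor \<open>d\<close>, every term except that with
  \<open>i = 0\<close> a factor \<open>c\<close>, and powers of the other one cancel by
  coprimality.\<close>

lemma homogeneous_dvd:
  fixes c d :: "'a::comm_ring_1"
  assumes bez: "r * c + s * d = 1" and 0: "(\<Sum>i\<le>m. B i * c ^ i * d ^ (m - i)) = 0"
  shows "d dvd B m" and "c dvd B 0"
proof -
  have "(\<Sum>i\<le>m. B i * c ^ i * d ^ (m - i)) = B m * c ^ m + (\<Sum>i<m. B i * c ^ i * d ^ (m - i))"
    by (simp add: lessThan_Suc_atMost[symmetric])
  hence "B m * c ^ m = - (\<Sum>i<m. B i * c ^ i * d ^ (m - i))"
    using 0 by (simp add: add_eq_0_iff2)
  also have "d dvd \<dots>" unfolding dvd_minus_iff by (rule dvd_sum) (auto intro!: dvd_mult dvd_power)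
  finally show "d dvd B m" using bezout_dvd_mult_power[OF bez] by blast
  have "(\<Sum>i\<le>m. B i * c ^ i * d ^ (m - i)) = B 0 * d ^ m + (\<Sum>i\<in>{..m} - {0}. B i * c ^ i * d ^ (m - i))"
    by (subst sum.remove[of _ 0]) auto
  hence "B 0 * d ^ m = - (\<Sum>i\<in>{..m} - {0}. B i * c ^ i * d ^ (m - i))"
    using 0 by (simp add: add_eq_0_iff2)
  moreover have "c dvd - (\<Sum>i\<in>{..m} - {0}. B i * c ^ i * d ^ (m - i))" unfolding dvd_minus_iff
    by (rule dvd_sum) (auto intro!: dvd_mult2 dvd_mult dvd_power)
  ultimately have "c dvd B 0 * d ^ m" by simp
  moreover have "s * d + r * c = 1" using bez by (simp only: add.commute)
  ultimately show "c dvd B 0" using bezout_dvd_mult_power by metis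
qed

lemma fract_homogenize:
  fixes c d :: "'a::field poly"
  assumes "d \<noteq> 0"
  shows "(\<Sum>i\<le>m. to_fract (B i) * Fract c d ^ i) * to_fract d ^ m
    = to_fract (\<Sum>i\<le>m. B i * c ^ i * d ^ (m - i))"
proof -
  have pow: "to_fract (x ^ n) = to_fract x ^ n" for x :: "'a poly" and n
    by (induction n) simp_all
  have "to_fract (B i) * Fract c d ^ i * to_fract d ^ m = to_fract (B i * c ^ i * d ^ (m - i))" if "i \<le> m" for i
  proof -
    have "to_fract d ^ m = to_fract d ^ i * to_fract d ^ (m - i)"
      using that by (simp flip: power_add)
    thus ?thesis
      using assms by (simp add: Fract_conv_to_fract power_divide pow)
  qed
  thus ?thesis unfolding sum_distrib_right to_fract_sum by (intro sum.cong) auto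
qed

definition eval_at :: "'a::field poly fract \<Rightarrow> 'a poly \<Rightarrow> 'a poly fract" where
  "eval_at t p = poly (map_poly cst p) t"

lemma eval_at_simps [simp]:
  "eval_at t 0 = 0" "eval_at t 1 = 1" "eval_at t (pCons a p) = cst a + t * eval_at t p"
  "eval_at t (p + q) = eval_at t p + eval_at t q" "eval_at t (p * q) = eval_at t p * eval_at t q"
  by (simp_all add: eval_at_def)

lemma eval_at_sum: "Polynomial.degree p \<le> m \<Longrightarrow> eval_at t p = (\<Sum>i\<le>m. to_fract [:poly.coeff p i:] * t ^ i)"
  by (simp add: eval_at_def poly_altdef cst_def[symmetric])
     (rule sum.mono_neutral_left, auto simp: coeff_eq_0)

lemma Fract_consts: "d \<noteq> 0 \<Longrightarrow> Fract [:c:] [:d:] = cst (c / d)"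
  by (simp add: cst_def to_fract_def eq_fract)

text \<open>A nonconstant rational function is transcendental over the constants: if
  \<open>t = c / d\<close> were a root, \<open>c\<close> and \<open>d\<close> would divide nonzero
  constants and \<open>t\<close> would be constant. This makes substitution of \<open>t\<close> into
  fractions well defined.\<close>

lemma eval_at_neq_0:
  assumes t: "t \<notin> range cst" and "p \<noteq> 0"
  shows "eval_at t p \<noteq> 0"
  using assms(2)
proof (induction p)
  case (pCons a p)
  show ?case
  proof (cases "a = 0")
    \<comment> \<open>A zero constant coefficient only contributes a factor \<open>t\<close>.
      Stripping it leaves the case where both extreme coefficients of the polynomial are
      nonzero.\<close>
    case True
    moreover have "t \<noteq> 0" using t cst.hom_0 by (metis rangeI)
    ultimately show ?thesis using pCons by auto
  next
    case False
    show ?thesis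
    proof
      assume 0: "eval_at t (pCons a p) = 0"
      define P where "P = pCons a p"
      define m where "m = Polynomial.degree P"
      obtain c d r s where cd: "d \<noteq> 0" "t = Fract c d" "r * c + s * d = 1"
        by (rule fract_coprime_rep)
      have "(\<Sum>i\<le>m. to_fract [:poly.coeff P i:] * Fract c d ^ i) = 0"
        using 0 unfolding P_def[symmetric] cd(2) m_def by (subst (asm) eval_at_sum[OF order_refl])
      hence "to_fract (\<Sum>i\<le>m. [:poly.coeff P i:] * c ^ i * d ^ (m - i)) = 0"
        by (subst fract_homogenize[OF cd(1), symmetric]) simp
      hence 0: "(\<Sum>i\<le>m. [:poly.coeff P i:] * c ^ i * d ^ (m - i)) = 0"
        by (simp only: to_fract_eq_0_iff)
      have P: "poly.coeff P m \<noteq> 0" "poly.coeff P 0 \<noteq> 0"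
        using False by (simp_all add: P_def m_def)
      have "d dvd [:poly.coeff P m:]" "c dvd [:poly.coeff P 0:]"
        using homogeneous_dvd[OF cd(3) 0] by simp_all
      hence "Polynomial.degree d = 0" "Polynomial.degree c = 0"
        using P by (auto dest!: dvd_imp_degree_le)
      then obtain c0 d0 where "c = [:c0:]" "d = [:d0:]"
        by (metis degree_eq_zeroE)
      hence "t = cst (c0 / d0)" using cd Fract_consts by simp
      thus False using t by blast
    qed
  qed
qed simp

text \<open>The composition \<open>u(t)\<close>. The value is independent of the chosen fraction for
  nonconstant \<open>t\<close>, where no denominator can vanish.\<close>

definition subst :: "'a::field poly fract \<Rightarrow> 'a poly fract \<Rightarrow> 'a poly fract" where
  "subst t u = (THE v. \<exists>a b. b \<noteq> 0 \<and> u = Fract a b \<and> v = eval_at t a / eval_at t b)"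

lemma subst_Fract:
  assumes "t \<notin> range cst" "b \<noteq> 0"
  shows "subst t (Fract a b) = eval_at t a / eval_at t b"
  unfolding subst_def
proof (rule the_equality)
  fix v assume "\<exists>a' b'. b' \<noteq> 0 \<and> Fract a b = Fract a' b' \<and> v = eval_at t a' / eval_at t b'"
  then obtain a' b' where *: "b' \<noteq> 0" "Fract a b = Fract a' b'" "v = eval_at t a' / eval_at t b'" by blast
  hence "a * b' = a' * b" using assms by (simp add: eq_fract)
  hence "eval_at t a * eval_at t b' = eval_at t a' * eval_at t b" by (metis eval_at_simps(5))
  thus "v = eval_at t a / eval_at t b" using * assms by (simp add: eval_at_neq_0 frac_eq_eq)
qed (use assms in blast)

lemma field_hom_subst:
  fixes t :: "'a::field poly fract"
  assumes "t \<notin> range cst"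
  shows "field_hom (subst t)"
proof
  show "subst t 1 = 1" by (simp add: One_fract_def subst_Fract[OF assms])
  fix x y :: "'a poly fract"
  obtain a b where x: "x = Fract a b" "b \<noteq> 0" by (cases x)
  obtain c d where y: "y = Fract c d" "d \<noteq> 0" by (cases y)
  have nz: "eval_at t b \<noteq> 0" "eval_at t d \<noteq> 0" using x y assms by (simp_all add: eval_at_neq_0)
  show "subst t (x + y) = subst t x + subst t y"
    using x y nz by (simp add: subst_Fract[OF assms] add_frac_eq)
  show "subst t (x * y) = subst t x * subst t y"
    using x y by (simp add: subst_Fract[OF assms])
qed

lemma subst_cst [simp]: "t \<notin> range cst \<Longrightarrow> subst t (cst c) = cst c"
  by (simp add: cst_def to_fract_def subst_Fract)

lemma subst_frX [simp]: "t \<notin> range cst \<Longrightarrow> subst t frX = t"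
  by (simp add: frX_def to_fract_def subst_Fract)

definition mob :: "'a::field \<Rightarrow> 'a \<Rightarrow> 'a \<Rightarrow> 'a \<Rightarrow> 'a poly fract" where
  "mob a b c d = Fract [:b, a:] [:d, c:]"

lemma mob_conv: "mob a b c d = (cst a * frX + cst b) / (cst c * frX + cst d)"
proof -
  have "to_fract [:b, a:] = cst a * frX + cst b" for a b :: 'a
    unfolding cst_def frX_def to_fract_add[symmetric] to_fract_mult[symmetric] by simp
  thus ?thesis by (simp add: mob_def Fract_conv_to_fract)
qed

lemma mob_eq_iff:
  assumes "[:d, c:] \<noteq> 0" "[:d', c':] \<noteq> 0"
  shows "mob a b c d = mob a' b' c' d' \<longleftrightarrow> a * c' = a' * c \<and> a * d' + b * c' = a' * d + b' * c \<and> b * d' = b' * d"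
  unfolding mob_def using assms by (subst eq_fract) (auto simp: algebra_simps)

lemma mob_nonconst:
  assumes "a * d - b * c \<noteq> 0"
  shows "mob a b c d \<notin> range cst"
proof
  assume "mob a b c d \<in> range cst"
  then obtain k where "Fract [:b, a:] [:d, c:] = Fract [:k:] 1"
    by (auto simp: mob_def cst_def to_fract_def)
  moreover have "[:d, c:] \<noteq> 0" using assms by auto
  ultimately have "b = k * d" "a = k * c" by (simp_all add: eq_fract)
  thus False using assms by simp
qed

lemma nonconst_mob:
  assumes "mob a b c d \<notin> range cst" "[:d, c:] \<noteq> 0"
  shows "a * d - b * c \<noteq> 0"
proof
  assume 0: "a * d - b * c = 0"
  have "\<exists>k. [:b, a:] = [:k:] * [:d, c:]"
  proof (cases "d = 0")
    case True
    hence "c \<noteq> 0" "b = 0" using assms(2) 0 by auto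
    thus ?thesis using True by (intro exI[of _ "a / c"]) simp
  next
    case False
    hence "a = b * c / d" using 0 by (simp add: field_simps)
    thus ?thesis using False by (intro exI[of _ "b / d"]) simp
  qed
  then obtain k where "[:b, a:] = [:k:] * [:d, c:]" ..
  hence "mob a b c d = cst k"
    using assms(2) by (simp add: mob_def cst_def to_fract_def eq_fract)
  thus False using assms(1) by simp
qed

lemma khom_mob:
  assumes "field_hom \<sigma>"
  shows "\<sigma> (mob a b c d) = (\<sigma> (cst a) * \<sigma> frX + \<sigma> (cst b)) / (\<sigma> (cst c) * \<sigma> frX + \<sigma> (cst d))"
proof -
  interpret field_hom \<sigma> by fact
  show ?thesis by (simp add: mob_conv)
qed

text \<open>Comparing the extreme coefficients in \<open>x D(t) = C(t)\<close>, where \<open>t = \<sigma> x = c/d\<close>, shows that \<open>c\<close> and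
  \<open>d\<close> have degree at most \<open>1\<close>.\<close>

lemma surj_khom_imp_mob:
  fixes \<sigma> :: "'a::field poly fract \<Rightarrow> 'a poly fract"
  assumes hom: "field_hom \<sigma>" and cst: "\<And>c. \<sigma> (cst c) = cst c" and "surj \<sigma>"
  shows "\<exists>a b c d. a * d - b * c \<noteq> 0 \<and> \<sigma> frX = mob a b c d"
proof -
  interpret \<sigma>: field_hom \<sigma> by fact
  define t where "t = \<sigma> frX"
  have t: "t \<notin> range cst"
  proof
    assume "t \<in> range cst"
    then obtain k where "\<sigma> frX = \<sigma> (cst k)" by (auto simp: t_def cst)
    thus False unfolding \<sigma>.hom_eq_iff by (metis frX_neq_cst)
  qed
  obtain c d r s where cd: "d \<noteq> 0" "t = Fract c d" "r * c + s * d = 1"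
    by (rule fract_coprime_rep)
  obtain h where h: "\<sigma> h = frX" using \<open>surj \<sigma>\<close> by (metis surjD)
  obtain C D r' s' where CD: "D \<noteq> 0" "h = Fract C D" "r' * C + s' * D = 1"
    by (rule fract_coprime_rep)
  have "frX = eval_at t C / eval_at t D"
    using khom_Fract[OF hom, of C D] h CD cst by (simp add: eval_at_def t_def)
  hence eq: "frX * eval_at t D - eval_at t C = 0" using eval_at_neq_0[OF t CD(1)] by (metis eq_iff_diff_eq_0 nonzero_eq_divide_eq)
  define m where "m = max (Polynomial.degree C) (Polynomial.degree D)"
  define B where "B = (\<lambda>i. [:- poly.coeff C i, poly.coeff D i:])"
  have B: "to_fract (B i) = frX * to_fract [:poly.coeff D i:] - to_fract [:poly.coeff C i:]" for i
    unfolding frX_def to_fract_mult[symmetric] to_fract_diff[symmetric] B_def by simp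
  have "(\<Sum>i\<le>m. to_fract (B i) * t ^ i) = frX * eval_at t D - eval_at t C"
    by (subst (1 2) eval_at_sum[of _ m])
       (simp_all add: m_def B sum_distrib_left sum_subtractf algebra_simps)
  hence "(\<Sum>i\<le>m. to_fract (B i) * Fract c d ^ i) = 0"
    by (simp only: eq cd(2)[symmetric])
  hence "to_fract (\<Sum>i\<le>m. B i * c ^ i * d ^ (m - i)) = 0"
    by (subst fract_homogenize[OF cd(1), symmetric]) simp
  hence 0: "(\<Sum>i\<le>m. B i * c ^ i * d ^ (m - i)) = 0"
    by (simp only: to_fract_eq_0_iff)
  have Bm: "B m \<noteq> 0"
  proof
    assume "B m = 0"
    hence "poly.coeff C m = 0" "poly.coeff D m = 0" by (simp_all add: B_def)
    hence "C = 0 \<or> m \<noteq> Polynomial.degree C" "m \<noteq> Polynomial.degree D" using CD(1) by auto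
    thus False unfolding m_def by (auto simp: max_def split: if_splits)
  qed
  \<comment> \<open>\<open>C\<close> and \<open>D\<close> are coprime, so they cannot both vanish at
    \<open>0\<close>.\<close>
  have B0: "B 0 \<noteq> 0"
  proof
    assume "B 0 = 0"
    hence "poly C 0 = 0" "poly D 0 = 0" by (simp_all add: B_def poly_0_coeff_0)
    moreover have "poly (r' * C + s' * D) 0 = 1" using CD by simp
    ultimately show False by simp
  qed
  have deg: "Polynomial.degree (B i) \<le> 1" for i by (simp add: B_def)
  have "d dvd B m" "c dvd B 0" using homogeneous_dvd[OF cd(3) 0] by simp_all
  hence "Polynomial.degree d \<le> 1" "Polynomial.degree c \<le> 1"
    using Bm B0 deg dvd_imp_degree_le order_trans by blast+
  moreover have "\<exists>x y. p = [:x, y:]" if "Polynomial.degree p \<le> 1" for p :: "'a poly"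
    using that by (metis degree1_coeffs degree_eq_zeroE le_neq_implies_less less_one pCons_0_0)
  ultimately obtain a b c' d' where *: "c = [:b, a:]" "d = [:d', c':]" by metis
  have "t = mob a b c' d'" using cd * by (simp add: mob_def)
  moreover have "a * d' - b * c' \<noteq> 0"
    using nonconst_mob t cd(1) * calculation by metis
  ultimately show ?thesis unfolding t_def by blast
qed

subsection \<open>Action of invertible matrices\<close>

abbreviation GL2 :: "('k::field ^ 2 ^ 2) set" where
  "GL2 \<equiv> {A. invertible A}"

definition mobA :: "'k::field ^ 2 ^ 2 \<Rightarrow> 'k poly fract" where
  "mobA A = mob (A $ 1 $ 1) (A $ 1 $ 2) (A $ 2 $ 1) (A $ 2 $ 2)"

text \<open>The comorphism of the fractional linear map of \<open>A\<close>; hence the reversed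
  product in \<open>moebius_subst_comp\<close>.\<close>

definition moebius_subst :: "'k::field ^ 2 ^ 2 \<Rightarrow> 'k poly fract \<Rightarrow> 'k poly fract" where
  "moebius_subst A = subst (mobA A)"

lemma invertible_2: "invertible (A :: 'k::field ^ 2 ^ 2) \<longleftrightarrow> A $ 1 $ 1 * A $ 2 $ 2 - A $ 1 $ 2 * A $ 2 $ 1 \<noteq> 0"
  by (simp add: invertible_det_nz det_2)

lemma mobA_nonconst: "invertible A \<Longrightarrow> mobA A \<notin> range cst"
  unfolding invertible_2 mobA_def by (rule mob_nonconst)

lemma field_hom_moebius_subst: "invertible A \<Longrightarrow> field_hom (moebius_subst A)"
  unfolding moebius_subst_def by (intro field_hom_subst mobA_nonconst)

lemma moebius_subst_cst [simp]: "invertible A \<Longrightarrow> moebius_subst A (cst c) = cst c"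
  by (simp add: moebius_subst_def mobA_nonconst)

lemma moebius_subst_frX [simp]: "invertible A \<Longrightarrow> moebius_subst A frX = mobA A"
  by (simp add: moebius_subst_def mobA_nonconst)

lemma matrix_mult_2:
  fixes A B :: "'k::field ^ 2 ^ 2"
  shows "(A ** B) $ i $ j = A $ i $ 1 * B $ 1 $ j + A $ i $ 2 * B $ 2 $ j"
  by (simp add: matrix_matrix_mult_def sum_2)

lemma denom_neq_0:
  fixes t :: "'a::field poly fract"
  assumes "t \<notin> range cst" "[:d, c:] \<noteq> 0"
  shows "cst c * t + cst d \<noteq> 0"
  using eval_at_neq_0[OF assms] by (simp add: algebra_simps)

lemma moebius_subst_mobA:
  assumes A: "invertible A" and B: "invertible B"
  shows "moebius_subst A (mobA B) = mobA (B ** A)"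
proof -
  have nz: "cst (A $ 2 $ 1) * frX + cst (A $ 2 $ 2) \<noteq> 0"
    using A by (intro denom_neq_0) (auto simp: frX_neq_cst invertible_2)
  show ?thesis
    unfolding mobA_def khom_mob[OF field_hom_moebius_subst[OF A]]
    using A by (simp only: moebius_subst_frX moebius_subst_cst)
      (simp add: mobA_def mob_conv matrix_mult_2 add_divide_eq_iff nz divide_simps, simp add: algebra_simps)
qed

lemma moebius_subst_comp:
  assumes A: "invertible A" and B: "invertible B"
  shows "moebius_subst A (moebius_subst B u) = moebius_subst (B ** A) u"
proof (rule khom_eqI[where \<sigma> = "\<lambda>u. moebius_subst A (moebius_subst B u)" and \<tau> = "moebius_subst (B ** A)"])
  show "field_hom (\<lambda>u. moebius_subst A (moebius_subst B u))"
    using field_hom_comp[OF field_hom_moebius_subst[OF A] field_hom_moebius_subst[OF B]] .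
  show "field_hom (moebius_subst (B ** A))" by (intro field_hom_moebius_subst invertible_mult A B)
qed (use A B in \<open>simp_all add: moebius_subst_mobA invertible_mult\<close>)

lemma invertible_mat_1 [simp]: "invertible (mat 1 :: 'k::field ^ 'n ^ 'n)"
  by (auto simp: invertible_def)

lemma moebius_subst_one: "moebius_subst (mat 1) u = u"
proof (rule khom_eqI[where \<tau> = "\<lambda>x. x"])
  show "field_hom (\<lambda>x. x)" by unfold_locales auto
  have "moebius_subst (mat 1) frX = mobA (mat 1)" by simp
  also have "\<dots> = frX" by (simp add: mobA_def mob_def mat_def frX_def to_fract_def one_pCons)
  finally show "moebius_subst (mat 1) frX = frX" .
qed (simp_all add: field_hom_moebius_subst)

lemma GL2_inverse:
  assumes "invertible (A :: 'k::field ^ 2 ^ 2)"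
  obtains B where "invertible B" "A ** B = mat 1" "B ** A = mat 1"
  using assms unfolding invertible_def by blast

text \<open>For the forward direction write \<open>B = M ** A\<close>. Cancelling the injective
  substitution by \<open>A\<close> leaves a matrix \<open>M\<close> whose fraction is
  \<open>x\<close>, and such a matrix is scalar.\<close>

lemma mobA_eq_iff:
  assumes A: "invertible A" and B: "invertible B"
  shows "mobA A = mobA B \<longleftrightarrow> (\<exists>c. c \<noteq> 0 \<and> B = mat c ** A)"
proof
  have mc: "(mat c ** A) $ i $ j = c * A $ i $ j" for c i j
    by (simp add: matrix_matrix_mult_def mat_def if_distrib if_distribR cong: if_cong)
  have nz: "[:A $ 2 $ 2, A $ 2 $ 1:] \<noteq> 0" "[:B $ 2 $ 2, B $ 2 $ 1:] \<noteq> 0"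
    using A B by (auto simp: invertible_2)
  {
    assume "mobA A = mobA B"
    obtain A' where A': "A' ** A = mat 1" "invertible A'" using GL2_inverse[OF A] by metis
    have C: "B = (B ** A') ** A" using A' by (simp flip: matrix_mul_assoc)
    define M where "M = B ** A'"
    have M: "B = M ** A" "invertible M" using C B A' by (simp_all add: M_def invertible_mult)
    have "moebius_subst A (mobA M) = mobA B" using moebius_subst_mobA[OF A M(2)] M by simp
    also have "\<dots> = moebius_subst A (mobA (mat 1))" using \<open>mobA A = mobA B\<close> by (subst moebius_subst_mobA[OF A]) simp_all
    finally have "mobA M = mobA (mat 1)"
      by (simp add: field_hom.hom_eq_iff[OF field_hom_moebius_subst[OF A]])
    hence "M $ 2 $ 1 = 0 \<and> M $ 1 $ 1 = M $ 2 $ 2 \<and> M $ 1 $ 2 = 0"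
      using M(2) unfolding mobA_def by (subst (asm) mob_eq_iff) (auto simp: mat_def invertible_2)
    hence "M = mat (M $ 1 $ 1)" by (auto simp: vec_eq_iff mat_def forall_2)
    moreover have "M $ 1 $ 1 \<noteq> 0" using \<open>M $ 2 $ 1 = 0 \<and> _\<close> M(2) by (auto simp: invertible_2)
    ultimately show "\<exists>c. c \<noteq> 0 \<and> B = mat c ** A" using M by metis
  }
  {
    assume "\<exists>c. c \<noteq> 0 \<and> B = mat c ** A"
    then obtain c where "c \<noteq> 0" "B = mat c ** A" by blast
    thus "mobA A = mobA B"
      unfolding mobA_def mob_eq_iff[OF nz] by (simp add: mc algebra_simps)
  }
qed

lemma moebius_subst_eq_iff:
  assumes "invertible A" "invertible B"
  shows "moebius_subst A = moebius_subst B \<longleftrightarrow> mobA A = mobA B"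
  using assms by (metis moebius_subst_def moebius_subst_frX)

lemma surj_khom_imp_moebius_subst:
  fixes \<sigma> :: "'a::field poly fract \<Rightarrow> 'a poly fract"
  assumes "field_hom \<sigma>" "\<And>c. \<sigma> (cst c) = cst c" "surj \<sigma>"
  obtains A where "invertible A" "\<sigma> = moebius_subst A"
proof -
  obtain a b c d where abcd: "a * d - b * c \<noteq> 0" "\<sigma> frX = mob a b c d"
    using surj_khom_imp_mob[OF assms] by blast
  define A :: "'a ^ 2 ^ 2" where "A = vector [vector [a, b], vector [c, d]]"
  have A: "invertible A" "mobA A = mob a b c d"
    using abcd by (simp_all add: A_def invertible_2 mobA_def)
  have "\<sigma> u = moebius_subst A u" for u
    by (rule khom_eqI[OF assms(1) field_hom_moebius_subst[OF A(1)]]) (use A abcd assms(2) in simp_all)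
  thus ?thesis using that A by blast
qed

subsection \<open>Base change\<close>

lemma field_hom_base_change: "field_hom (base_change :: 'k::field poly fract \<Rightarrow> _)"
proof
  show "base_change (1 :: 'k poly fract) = 1"
    by (simp add: One_fract_def base_change_Fract)
  fix x y :: "'k poly fract"
  obtain a b where x: "x = Fract a b" "b \<noteq> 0" by (cases x)
  obtain c d where y: "y = Fract c d" "d \<noteq> 0" by (cases y)
  show "base_change (x + y) = base_change x + base_change y"
    using x y by (simp add: base_change_Fract)
  show "base_change (x * y) = base_change x * base_change y"
    using x y by (simp add: base_change_Fract)
qed

interpretation bc: field_hom "base_change :: 'k::field poly fract \<Rightarrow> _"
  by (rule field_hom_base_change)

lemma base_change_cst [simp]: "base_change (cst c) = cst (to_ac c)"
  by (simp add: cst_def to_fract_def base_change_Fract)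

lemma base_change_frX [simp]: "base_change frX = frX"
  by (simp add: frX_def to_fract_def base_change_Fract)

lemma base_change_moebius_subst:
  assumes A: "invertible A"
  shows "base_change (moebius_subst A u) = subst (mob (to_ac (A $ 1 $ 1)) (to_ac (A $ 1 $ 2)) (to_ac (A $ 2 $ 1)) (to_ac (A $ 2 $ 2))) (base_change u)"
    (is "_ = subst ?t _")
proof (rule khom_eqI[where \<sigma> = "\<lambda>u. base_change (moebius_subst A u)" and \<tau> = "\<lambda>u. subst ?t (base_change u)"])
  have "to_ac (A $ 1 $ 1 * A $ 2 $ 2 - A $ 1 $ 2 * A $ 2 $ 1) \<noteq> 0"
    using A by (simp only: to_ac_eq_0_iff invertible_2) simp
  hence t: "?t \<notin> range cst" by (intro mob_nonconst) simp
  show "field_hom (\<lambda>u. base_change (moebius_subst A u))" "field_hom (\<lambda>u. subst ?t (base_change u))"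
    using field_hom_comp[OF field_hom_base_change field_hom_moebius_subst[OF A]]
      field_hom_comp[OF field_hom_subst[OF t] field_hom_base_change] by blast+
  show "base_change (moebius_subst A (cst c)) = subst ?t (base_change (cst c))" for c
    using A t by simp
  show "base_change (moebius_subst A frX) = subst ?t (base_change frX)"
    using A t by (simp add: mobA_def khom_mob[OF field_hom_base_change]) (simp add: mob_conv)
qed

subsection \<open>Pole orders\<close>

text \<open>The junk value \<open>ord_at Q 0 = 0\<close> makes the zero function free of poles, so that the rules below
  need no exception for it.\<close>

definition pole :: "'a::field proj_line \<Rightarrow> 'a poly fract \<Rightarrow> nat" where
  "pole Q f = nat (- ord_at Q f)"

lemma pole_order_eq: "pole_order Q u = pole Q (base_change u)"
  by (simp add: pole_order_def pole_def)

lemma Fract_nonzero_iff: "b \<noteq> 0 \<Longrightarrow> Fract a b \<noteq> 0 \<longleftrightarrow> a \<noteq> 0"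
  by (simp add: Zero_fract_def eq_fract)

lemma fract_rep_nonzero:
  assumes "f \<noteq> 0"
  obtains a b where "a \<noteq> 0" "b \<noteq> 0" "f = Fract a b"
  using assms by (metis Fract_nonzero_iff Fract_cases)

lemma ord_at_mult:
  assumes "f \<noteq> 0" "g \<noteq> 0"
  shows "ord_at Q (f * g) = ord_at Q f + ord_at Q g"
proof -
  obtain a b where f: "a \<noteq> 0" "b \<noteq> 0" "f = Fract a b" using assms fract_rep_nonzero by blast
  obtain c d where g: "c \<noteq> 0" "d \<noteq> 0" "g = Fract c d" using assms fract_rep_nonzero by blast
  have "a * c \<noteq> 0" "b * d \<noteq> 0" using f g by auto
  thus ?thesis using f g
    by (cases Q) (simp_all add: ord_at_Fract order_mult degree_mult_eq)
qed

lemma ord_at_1 [simp]: "ord_at Q 1 = 0"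
  by (cases Q) (simp_all add: One_fract_def ord_at_Fract)

lemma ord_at_power: "f \<noteq> 0 \<Longrightarrow> ord_at Q (f ^ n) = int n * ord_at Q f"
proof (induction n)
  case 0
  show ?case by simp
next
  case (Suc n)
  thus ?case by (simp add: ord_at_mult algebra_simps)
qed

lemma ord_quot_add:
  assumes "a \<noteq> 0" "b \<noteq> 0" "a + b \<noteq> 0"
  shows "ord_quot Q (a + b) c \<ge> min (ord_quot Q a c) (ord_quot Q b c)"
proof (cases Q)
  case (Affine z)
  let ?m = "min (Polynomial.order z a) (Polynomial.order z b)"
  have "[:- z, 1:] ^ ?m dvd a + b"
    by (intro dvd_add) (simp_all add: order_divides)
  hence "?m \<le> Polynomial.order z (a + b)" using assms by (simp add: order_divides)
  thus ?thesis using Affine by auto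
next
  case Infinity
  thus ?thesis using degree_add_le_max[of a b] by auto
qed

lemma ord_at_add:
  assumes "f \<noteq> 0" "g \<noteq> 0" "f + g \<noteq> 0"
  shows "ord_at Q (f + g) \<ge> min (ord_at Q f) (ord_at Q g)"
proof -
  obtain a b where f: "a \<noteq> 0" "b \<noteq> 0" "f = Fract a b" using assms fract_rep_nonzero by blast
  obtain c d where g: "c \<noteq> 0" "d \<noteq> 0" "g = Fract c d" using assms fract_rep_nonzero by blast
  have bd: "b * d \<noteq> 0" using f g by simp
  have f': "f = Fract (a * d) (b * d)" and g': "g = Fract (c * b) (b * d)"
    and fg: "f + g = Fract (a * d + c * b) (b * d)"
    using f g by (simp_all add: eq_fract algebra_simps)
  have nz: "a * d \<noteq> 0" "c * b \<noteq> 0" "a * d + c * b \<noteq> 0"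
    using assms(3) f g unfolding fg Fract_nonzero_iff[OF bd] by auto
  show ?thesis
    unfolding fg unfolding f' g' ord_at_Fract[OF nz(1) bd] ord_at_Fract[OF nz(2) bd] ord_at_Fract[OF nz(3) bd]
    by (rule ord_quot_add[OF nz])
qed

lemma pole_0 [simp]: "pole Q 0 = 0"
  by (simp add: pole_def ord_at_def)

lemma pole_add_le: "pole Q (f + g) \<le> max (pole Q f) (pole Q g)"
proof (cases "f = 0 \<or> g = 0 \<or> f + g = 0")
  case False
  thus ?thesis using ord_at_add[of f g Q] by (auto simp: pole_def)
qed auto

lemma ord_at_uminus: "ord_at Q (- f) = ord_at Q f"
proof (cases "f = 0")
  case False
  then obtain a b where f: "a \<noteq> 0" "b \<noteq> 0" "f = Fract a b" using fract_rep_nonzero by blast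
  thus ?thesis by (cases Q) (simp_all add: ord_at_Fract)
qed simp

lemma pole_uminus [simp]: "pole Q (- f) = pole Q f"
  by (simp add: pole_def ord_at_uminus)

lemma pole_diff_le: "pole Q (f - g) \<le> max (pole Q f) (pole Q g)"
  using pole_add_le[of Q f "- g"] by simp

text \<open>The ultrametric inequality for \<open>f + g\<close> and for
  \<open>g = (f + g) - f\<close>: a strictly larger pole cannot be cancelled.\<close>

lemma pole_add_eq: "pole Q f < pole Q g \<Longrightarrow> pole Q (f + g) = pole Q g"
  using pole_add_le[of Q f g] pole_diff_le[of Q "f + g" f] by auto

lemma pole_diff_eq: "pole Q g < pole Q f \<Longrightarrow> pole Q (f - g) = pole Q f"
  using pole_add_eq[of Q "- g" f] by simp

lemma pole_power: "pole Q (f ^ n) = n * pole Q f"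
proof (cases "f = 0")
  case False
  thus ?thesis using nat_mult_distrib[of "int n" "- ord_at Q f"] by (simp add: pole_def ord_at_power)
qed (cases n; simp add: pole_def[of Q 1])

text \<open>Where \<open>z\<close> has a pole, \<open>z ^ p\<close> has a strictly larger one, which
  dominates; elsewhere no pole arises. Artin-Schreier elements thus have pole orders divisible by
  \<open>p\<close>, against which coprimality to \<open>p\<close> is played off below.\<close>

lemma pole_artin_schreier:
  assumes "p \<ge> 2"
  shows "pole Q (z ^ p - z) = p * pole Q z"
proof (cases "pole Q z = 0")
  case True
  thus ?thesis using pole_diff_le[of Q "z ^ p" z] by (simp add: pole_power)
next
  case False
  hence "pole Q z < pole Q (z ^ p)" using assms by (simp add: pole_power)
  thus ?thesis by (simp add: pole_diff_eq pole_power)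
qed

lemma ord_at_cst [simp]: "ord_at Q (cst c) = 0"
proof (cases "c = 0")
  case False
  hence "Polynomial.order z [:c:] = 0" for z by (intro order_0I) simp
  thus ?thesis using False by (cases Q) (simp_all add: cst_def to_fract_def ord_at_Fract)
qed (simp add: ord_at_def)

lemma pole_cst [simp]: "pole Q (cst c) = 0"
  by (simp add: pole_def)

subsection \<open>Moebius transformations\<close>

lemma order_linear:
  fixes a b :: "'a::field"
  assumes "[:b, a:] \<noteq> 0"
  shows "Polynomial.order z [:b, a:] = (if b + a * z = 0 then 1 else 0)"
proof (cases "b + a * z = 0")
  case True
  hence "b = - a * z" by (simp add: add_eq_0_iff2)
  hence eq: "[:b, a:] = Polynomial.smult a ([:- z, 1:] ^ 1)" by simp
  hence "a \<noteq> 0" using assms by auto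
  hence "Polynomial.order z [:b, a:] = 1" unfolding eq by (simp only: order_smult[OF \<open>a \<noteq> 0\<close>] order_power_n_n)
  thus ?thesis using True by simp
next
  case False
  thus ?thesis by (simp add: order_0I algebra_simps)
qed

text \<open>The formula of \<open>moebius\<close> with entries in the field of the points
  themselves, so that it matches \<open>mob\<close> over the closure.\<close>

fun moebius_map :: "'a::field \<Rightarrow> 'a \<Rightarrow> 'a \<Rightarrow> 'a \<Rightarrow> 'a proj_line \<Rightarrow> 'a proj_line" where
  "moebius_map a b c d (Affine z) = (if c * z + d = 0 then Infinity else Affine ((a * z + b) / (c * z + d)))"
| "moebius_map a b c d Infinity = (if c = 0 then Infinity else Affine (a / c))"

lemma moebius_eq_moebius_map:
  "moebius A Q = moebius_map (to_ac (A $ 1 $ 1)) (to_ac (A $ 1 $ 2)) (to_ac (A $ 2 $ 1)) (to_ac (A $ 2 $ 2)) Q"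
  by (cases Q) simp_all

text \<open>The base case of \<open>ord_at_subst_mob\<close>. As the determinant is nonzero,
  numerator and denominator never vanish together, so zeros and poles correspond point by point,
  \<open>Infinity\<close> included.\<close>

lemma ord_at_mob_linear:
  assumes det: "a * d - b * c \<noteq> 0"
  shows "ord_at Q (mob a b c d - cst x) = ord_at (moebius_map a b c d Q) (to_fract [:- x, 1:])"
proof -
  have nz: "[:d, c:] \<noteq> 0" "[:b - x * d, a - x * c:] \<noteq> 0" using det by auto
  have "mob a b c d - cst x = Fract [:b - x * d, a - x * c:] [:d, c:]"
    using nz by (simp add: mob_def cst_def to_fract_def eq_fract algebra_simps)
  hence L: "ord_at Q (mob a b c d - cst x) = ord_quot Q [:b - x * d, a - x * c:] [:d, c:]"
    using nz by (simp add: ord_at_Fract)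
  have R: "ord_at (moebius_map a b c d Q) (to_fract [:- x, 1:]) = ord_quot (moebius_map a b c d Q) [:- x, 1:] 1"
    by (simp add: to_fract_def ord_at_Fract)
  show ?thesis
  proof (cases Q)
    case (Affine z)
    have L': "ord_quot Q [:b - x * d, a - x * c:] [:d, c:]
        = (if b - x * d + (a - x * c) * z = 0 then 1 else 0) - (if d + c * z = 0 then 1 else 0)"
      unfolding Affine using nz by (simp only: ord_quot.simps order_linear not_False_eq_True) simp
    show ?thesis
    proof (cases "d + c * z = 0")
      case True
      have "b + a * z \<noteq> 0"
      proof
        assume "b + a * z = 0"
        hence "b = - a * z" "d = - c * z" using True by (simp_all add: add_eq_0_iff2)
        thus False using det by simp
      qed
      moreover have "b - x * d + (a - x * c) * z = b + a * z - x * (d + c * z)"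
        by (simp add: algebra_simps)
      ultimately have "b - x * d + (a - x * c) * z \<noteq> 0" by (simp only: True) simp
      thus ?thesis unfolding L R L' using True by (simp add: Affine add.commute)
    next
      case False
      hence 1: "moebius_map a b c d Q = Affine ((a * z + b) / (c * z + d))" by (simp add: Affine add.commute)
      have "b - x * d + (a - x * c) * z = 0 \<longleftrightarrow> a * z + b = x * (c * z + d)"
        by (auto simp: algebra_simps)
      also have "\<dots> \<longleftrightarrow> - x + 1 * ((a * z + b) / (c * z + d)) = 0"
        using False by (simp add: divide_simps) (auto simp: algebra_simps)
      finally show ?thesis unfolding L R[unfolded 1] 1 L' ord_quot.simps using False
        by (subst order_linear) auto
    qed
  next
    case Infinity
    show ?thesis unfolding L R using det nz
      by (auto simp: Infinity order_linear divide_simps eq_divide_eq)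
  qed
qed

text \<open>Over an algebraically closed field a nonzero function is a constant times a quotient of
  products of linear factors, and orders are additive; so the linear case suffices.\<close>

lemma ord_at_subst_mob:
  fixes a b c d :: "'a::alg_closed_field"
  assumes det: "a * d - b * c \<noteq> 0"
  shows "ord_at Q (subst (mob a b c d) f) = ord_at (moebius_map a b c d Q) f"
proof (cases "f = 0")
  case True
  thus ?thesis by (simp add: field_hom.hom_0[OF field_hom_subst[OF mob_nonconst[OF det]]] ord_at_def)
next
  case False
  let ?t = "mob a b c d" and ?Q = "moebius_map a b c d Q"
  have t: "?t \<notin> range cst" by (rule mob_nonconst[OF det])
  \<comment> \<open>Nonvanishing is carried along in the induction because orders are additive only
    for nonzero functions.\<close>
  have prod: "eval_at ?t (\<Prod>x\<in>#A. [:- x, 1:]) \<noteq> 0 \<and>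
      ord_at Q (eval_at ?t (\<Prod>x\<in>#A. [:- x, 1:])) = ord_at ?Q (to_fract (\<Prod>x\<in>#A. [:- x, 1:]))" for A
  proof (induction A)
    case (add x A)
    have lin: "eval_at ?t [:- x, 1:] = ?t - cst x" by simp
    have nz: "eval_at ?t [:- x, 1:] \<noteq> 0" "to_fract [:- x, 1:] \<noteq> 0"
      using eval_at_neq_0[OF t, of "[:- x, 1:]"] by simp_all
    have nz': "to_fract (\<Prod>x\<in>#A. [:- x, 1:]) \<noteq> 0" by (simp del: to_fract_eq_0_iff add: to_fract_eq_0_iff prod_mset_zero_iff) auto
    show ?case
      unfolding image_mset_add_mset prod_mset.add_mset eval_at_simps(5) to_fract_mult
        ord_at_mult[OF nz(1) conjunct1[OF add]] ord_at_mult[OF nz(2) nz']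
      using nz(1) add by (simp only: lin ord_at_mob_linear[OF det] mult_eq_0_iff) blast
  qed simp
  have fac: "\<exists>A e. p = [:e:] * (\<Prod>x\<in>#A. [:- x, 1:]) \<and> e \<noteq> 0" if p0: "p \<noteq> 0" for p :: "'a poly"
  proof -
    obtain A where "p = Polynomial.smult (lead_coeff p) (\<Prod>x\<in>#A. [:- x, 1:])"
      using alg_closed_imp_factorization[OF p0] by blast
    thus ?thesis using p0 by (intro exI[of _ A] exI[of _ "lead_coeff p"]) simp
  qed
  have poly: "eval_at ?t p \<noteq> 0 \<and> ord_at Q (eval_at ?t p) = ord_at ?Q (to_fract p)" if nz: "p \<noteq> 0" for p
  proof -
    obtain A e where p: "p = [:e:] * (\<Prod>x\<in>#A. [:- x, 1:])" and "e \<noteq> 0"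
      using fac[OF nz] by blast
    have A: "eval_at ?t (\<Prod>x\<in>#A. [:- x, 1:]) \<noteq> 0"
      "ord_at Q (eval_at ?t (\<Prod>x\<in>#A. [:- x, 1:])) = ord_at ?Q (to_fract (\<Prod>x\<in>#A. [:- x, 1:]))"
      using prod[of A] by blast+
    have A': "to_fract (\<Prod>x\<in>#A. [:- x, 1:]) \<noteq> 0" using nz p by auto
    have "eval_at ?t [:e:] = cst e" "to_fract [:e:] = cst e" by (simp_all add: cst_def)
    thus ?thesis using A A' \<open>e \<noteq> 0\<close> unfolding p eval_at_simps(5) to_fract_mult
      by (simp add: ord_at_mult)
  qed
  obtain g h where gh: "g \<noteq> 0" "h \<noteq> 0" "f = Fract g h" using False fract_rep_nonzero by blast
  have 1: "subst ?t f * eval_at ?t h = eval_at ?t g" "f * to_fract h = to_fract g"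
    using poly[OF gh(2)] gh(2) unfolding gh(3) subst_Fract[OF t gh(2)] by (simp_all add: Fract_conv_to_fract)
  have "subst ?t f \<noteq> 0" using 1(1) poly[OF gh(1)] by auto
  hence "ord_at Q (subst ?t f) + ord_at Q (eval_at ?t h) = ord_at Q (eval_at ?t g)"
    using poly[OF gh(2)] ord_at_mult 1(1) by metis
  moreover have "ord_at ?Q f + ord_at ?Q (to_fract h) = ord_at ?Q (to_fract g)"
    using False gh(2) ord_at_mult 1(2) by (metis to_fract_eq_0_iff)
  ultimately show ?thesis using poly gh by simp
qed

lemma det_to_ac:
  fixes A :: "'k::field ^ 2 ^ 2"
  shows "invertible A \<Longrightarrow> to_ac (A $ 1 $ 1) * to_ac (A $ 2 $ 2) - to_ac (A $ 1 $ 2) * to_ac (A $ 2 $ 1) \<noteq> 0"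
  unfolding to_ac_mult[symmetric] to_ac_diff[symmetric] to_ac_eq_0_iff by (simp add: invertible_2)

lemma pole_order_moebius_subst: "invertible A \<Longrightarrow> pole_order Q (moebius_subst A u) = pole_order (moebius A Q) u"
  by (simp only: pole_order_eq pole_def base_change_moebius_subst ord_at_subst_mob[OF det_to_ac] moebius_eq_moebius_map)

lemma moebius_map_comp:
  assumes "a * d - b * c \<noteq> 0" "a' * d' - b' * c' \<noteq> 0"
  shows "moebius_map a b c d (moebius_map a' b' c' d' Q) = moebius_map (a * a' + b * c') (a * b' + b * d') (c * a' + d * c') (c * b' + d * d') Q"
proof (cases Q)
  case (Affine z)
  let ?n = "a' * z + b'" and ?m = "c' * z + d'"
  have e1: "(a * a' + b * c') * z + (a * b' + b * d') = a * ?n + b * ?m"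
    and e2: "(c * a' + d * c') * z + (c * b' + d * d') = c * ?n + d * ?m" by (simp_all add: algebra_simps)
  have nm: "?n \<noteq> 0 \<or> ?m \<noteq> 0"
  proof (rule ccontr)
    assume "\<not> ?thesis"
    hence "b' = - a' * z" "d' = - c' * z" by (simp_all add: add_eq_0_iff)
    thus False using assms by simp
  qed
  show ?thesis
  proof (cases "?m = 0")
    case True
    thus ?thesis unfolding Affine moebius_map.simps(1) e1 e2 using nm by simp
  next
    case False
    have "x * (n / m) + y = (x * n + y * m) / m" if "m \<noteq> 0" for x y n m :: 'a
      using that by (simp add: field_simps)
    hence "c * (?n / ?m) + d = (c * ?n + d * ?m) / ?m" "a * (?n / ?m) + b = (a * ?n + b * ?m) / ?m"
      using False by blast+
    thus ?thesis unfolding Affine moebius_map.simps(1) e1 e2 using False by simp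
  qed
next
  case Infinity
  show ?thesis
  proof (cases "c' = 0")
    case True
    thus ?thesis using assms by (auto simp: Infinity)
  next
    case False
    hence "c * (a' / c') + d = (c * a' + d * c') / c'" "a * (a' / c') + b = (a * a' + b * c') / c'"
      by (simp_all add: add_divide_distrib)
    thus ?thesis using False by (simp add: Infinity)
  qed
qed

lemma moebius_mult:
  assumes "invertible A" "invertible B"
  shows "moebius A (moebius B Q) = moebius (A ** B) Q"
  unfolding moebius_eq_moebius_map moebius_map_comp[OF det_to_ac[OF assms(1)] det_to_ac[OF assms(2)]] matrix_mult_2 by simp

lemma moebius_one [simp]: "moebius (mat 1) Q = Q"
  by (cases Q) (simp_all add: mat_def)

lemma bij_moebius:
  assumes "invertible A"
  shows "bij (moebius A)"
proof -
  obtain B where "invertible B" "A ** B = mat 1" "B ** A = mat 1" using GL2_inverse assms by metis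
  hence "moebius A \<circ> moebius B = id" "moebius B \<circ> moebius A = id"
    using assms by (auto simp: fun_eq_iff moebius_mult)
  thus ?thesis using o_bij by blast
qed

lemma count_image_mset_bij: "bij f \<Longrightarrow> count (image_mset f M) (f x) = count M x"
  by (induction M) (auto simp: bij_is_inj inj_eq)

text \<open>The matrix carries the poles of the composed function to those of \<open>u\<close>; so
  substituting \<open>A\<close> moves polar divisors by the inverse of \<open>A\<close>.\<close>

lemma div_infinity_moebius_subst:
  assumes "invertible A"
  shows "image_mset (moebius A) (div_infinity (moebius_subst A u)) = div_infinity u"
proof (rule multiset_eqI)
  fix Q
  obtain Q' where "Q = moebius A Q'" using bij_moebius[OF assms] by (metis bij_pointE)
  thus "count (image_mset (moebius A) (div_infinity (moebius_subst A u))) Q = count (div_infinity u) Q"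
    using assms by (simp add: count_image_mset_bij bij_moebius pole_order_moebius_subst)
qed

subsection \<open>Finite fields and Frobenius\<close>

lemma (in field_hom) CHAR_eq: "CHAR('b) = CHAR('a)"
proof (rule CHAR_eqI)
  show "of_nat CHAR('a) = (0 :: 'b)" using hom_of_nat[of "CHAR('a)"] by simp
  fix m assume "of_nat m = (0 :: 'b)"
  hence "\<sigma> (of_nat m) = 0" by simp
  thus "CHAR('a) dvd m" by (simp only: hom_eq_0_iff of_nat_eq_0_iff_char_dvd)
qed

lemma finite_field_fermat:
  fixes x :: "'a::{field, finite}"
  shows "x ^ CARD('a) = x"
proof (cases "x = 0")
  case False
  have "(\<Prod>y\<in>UNIV - {0}. x * y) = (\<Prod>y\<in>UNIV - {0}. y)"
    by (rule prod.reindex_bij_witness[of _ "\<lambda>y. y / x" "(*) x"]) (use False in auto)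
  hence "x ^ (CARD('a) - 1) * \<Prod>(UNIV - {0 :: 'a}) = 1 * \<Prod>(UNIV - {0 :: 'a})"
    by (simp add: prod.distrib card_Diff_singleton)
  moreover have "\<Prod>(UNIV - {0 :: 'a}) \<noteq> 0" by simp
  ultimately have "x ^ (CARD('a) - 1) = 1" by (metis mult_right_cancel)
  thus ?thesis by (metis mult.right_neutral power_eq_if zero_less_card_finite less_irrefl)
qed simp

text \<open>Translation by \<open>1\<close> permutes the field; compare the sums of all
  elements.\<close>

lemma of_nat_card_finite_field: "of_nat CARD('a::{field, finite}) = (0 :: 'a)"
proof -
  have "(\<Sum>x\<in>(UNIV :: 'a set). x + 1) = (\<Sum>x\<in>UNIV. x)"
    by (rule sum.reindex_bij_witness[of _ "\<lambda>x. x - 1" "\<lambda>x. x + 1"]) auto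
  thus ?thesis by (simp add: sum.distrib)
qed

locale finite_char =
  fixes ty :: "'k::{field, finite} itself" and p n :: nat
  assumes prime_p: "prime p" and card_k: "CARD('k) = p ^ n"
begin

lemma CHAR_k: "CHAR('k) = p"
proof -
  have "CHAR('k) dvd p ^ n" using of_nat_card_finite_field[where 'a = 'k]
    by (simp only: card_k of_nat_eq_0_iff_char_dvd)
  moreover have "prime CHAR('k)" using finite_imp_CHAR_pos[where 'a = 'k] by (intro prime_CHAR_semidom) simp
  ultimately have "CHAR('k) dvd p" using prime_dvd_power by blast
  thus ?thesis using prime_p \<open>prime CHAR('k)\<close> primes_dvd_imp_eq by blast
qed

lemma p_ge_2: "p \<ge> 2"
  using prime_p prime_ge_2_nat by blast

lemma CHAR_ac: "CHAR('k alg_closure) = p"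
  using to_ac.CHAR_eq CHAR_k by simp

lemma CHAR_kx: "CHAR('k poly fract) = p"
  using cst.CHAR_eq[where 'a = 'k] CHAR_k by simp

lemma CHAR_acx: "CHAR('k alg_closure poly fract) = p"
  using cst.CHAR_eq[where 'a = "'k alg_closure"] CHAR_ac by simp

end

definition frob :: "'k::{field, finite} alg_closure \<Rightarrow> 'k alg_closure" where
  "frob z = z ^ CARD('k)"

abbreviation frobP :: "'k::{field, finite} alg_closure proj_line \<Rightarrow> 'k alg_closure proj_line" where
  "frobP \<equiv> map_proj_line (\<lambda>z. z ^ CARD('k))"

lemma frobP_Affine: "frobP (Affine z) = Affine (frob z)"
  by (simp add: frob_def)

lemma frob_to_ac: "frob (to_ac c) = to_ac c"
  by (simp add: frob_def finite_field_fermat flip: to_ac_power)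

text \<open>The polynomial \<open>x ^ q - x\<close> has at most \<open>q\<close> roots, and
  \<open>k\<close> already supplies \<open>q\<close> of them. This is the criterion for descent from
  the closure to \<open>k\<close>.\<close>

lemma frob_fixed_imp_range:
  fixes z :: "'k::{field, finite} alg_closure"
  assumes "frob z = z"
  shows "z \<in> range to_ac"
proof -
  let ?P = "Polynomial.monom 1 CARD('k) - Polynomial.monom 1 1 :: 'k alg_closure poly"
  have gt: "CARD('k) > 1"
    using card_mono[of "UNIV" "{0, 1 :: 'k}"] by simp
  have deg: "Polynomial.degree ?P = CARD('k)"
    using gt degree_add_eq_left[of "- Polynomial.monom 1 1" "Polynomial.monom 1 CARD('k) :: 'k alg_closure poly"]
    by (simp add: degree_monom_eq)
  hence nz: "?P \<noteq> 0" using gt by auto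
  have roots: "{x. poly ?P x = 0} = {x. frob x = x}" by (simp add: poly_monom frob_def)
  have "range to_ac = {x :: 'k alg_closure. frob x = x}"
  proof (rule card_seteq)
    show "finite {x :: 'k alg_closure. frob x = x}"
      using poly_roots_finite[OF nz] unfolding roots .
    show "range to_ac \<subseteq> {x :: 'k alg_closure. frob x = x}" by (auto simp: frob_to_ac)
    have "card {x :: 'k alg_closure. frob x = x} \<le> CARD('k)"
      using card_poly_roots_bound[OF nz] unfolding roots deg .
    also have "\<dots> = card (range (to_ac :: 'k \<Rightarrow> _))" by (rule card_image[symmetric]) (rule inj_to_ac)
    finally show "card {x :: 'k alg_closure. frob x = x} \<le> card (range (to_ac :: 'k \<Rightarrow> _))" .
  qed
  thus ?thesis using assms by blast
qed

definition stable :: "'k::{field, finite} alg_closure proj_line multiset \<Rightarrow> bool" where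
  "stable W \<longleftrightarrow> (\<forall>Q. count W (frobP Q) = count W Q)"

context finite_char
begin

lemma field_hom_frob: "field_hom (frob :: 'k alg_closure \<Rightarrow> _)"
proof
  fix x y :: "'k alg_closure"
  show "frob (x + y) = frob x + frob y"
    unfolding frob_def by (rule freshmans_dream'[where n = n]) (simp_all add: CHAR_k prime_p card_k)
qed (simp_all add: frob_def power_mult_distrib)

lemma bij_frob: "bij (frob :: 'k alg_closure \<Rightarrow> _)"
proof (rule bijI)
  show "inj (frob :: 'k alg_closure \<Rightarrow> _)" by (rule field_hom.inj_hom[OF field_hom_frob])
  show "surj (frob :: 'k alg_closure \<Rightarrow> _)"
    unfolding surj_def frob_def using nth_root_exists[of "CARD('k)"] by (metis zero_less_card_finite)
qed

lemma bij_frobP: "bij (frobP :: 'k alg_closure proj_line \<Rightarrow> _)"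
proof (rule bijI)
  show "inj (frobP :: 'k alg_closure proj_line \<Rightarrow> _)"
    using bij_is_inj[OF bij_frob] by (intro proj_line.inj_map) (simp add: frob_def[abs_def])
  show "surj (frobP :: 'k alg_closure proj_line \<Rightarrow> _)"
    unfolding surj_def
  proof
    fix Q :: "'k alg_closure proj_line"
    show "\<exists>x. Q = frobP x"
    proof (cases Q)
      case (Affine z)
      then obtain w where "frob w = z" using bij_is_surj[OF bij_frob] by (metis surjD)
      thus ?thesis using Affine by (intro exI[of _ "Affine w"]) (simp add: frob_def)
    qed (auto intro: exI[of _ Infinity])
  qed
qed

lemma order_frob:
  fixes g :: "'k poly"
  shows "Polynomial.order (frob z) (map_poly to_ac g) = Polynomial.order z (map_poly to_ac g)"
proof -
  interpret F: field_hom "frob :: 'k alg_closure \<Rightarrow> _" by (rule field_hom_frob)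
  have "map_poly frob (map_poly to_ac g) = map_poly to_ac g"
    by (rule poly_eqI) (simp add: frob_to_ac)
  thus ?thesis using F.order_map[of z "map_poly to_ac g"] by simp
qed

text \<open>The coefficients of \<open>u\<close> lie in \<open>k\<close> and are fixed by Frobenius,
  so conjugate points look alike to \<open>u\<close>. Stability of polar divisors and the count by
  orbits rest on this.\<close>

lemma pole_order_frobP: "pole_order (frobP Q) (u :: 'k poly fract) = pole_order Q u"
proof (cases "u = 0")
  case False
  then obtain a b where u: "a \<noteq> 0" "b \<noteq> 0" "u = Fract a b" using fract_rep_nonzero by blast
  show ?thesis
    using u by (cases Q) (simp_all add: pole_order_def base_change_Fract ord_at_Fract order_frob flip: frob_def)
qed (simp add: pole_order_eq)

lemma stable_div_infinity: "stable (div_infinity (u :: 'k poly fract))"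
  by (simp add: stable_def pole_order_frobP)

lemma order_prod_linear_powers:
  fixes e :: "'a::field \<Rightarrow> nat"
  assumes "finite S"
  shows "(\<Prod>x\<in>S. [:- x, 1:] ^ e x) \<noteq> 0 \<and>
    Polynomial.order z (\<Prod>x\<in>S. [:- x, 1:] ^ e x) = (if z \<in> S then e z else 0)"
  using assms
proof (induction S)
  case (insert x S)
  have nz: "[:- x, 1:] ^ e x * (\<Prod>x\<in>S. [:- x, 1:] ^ e x) \<noteq> 0" using insert by auto
  have "Polynomial.order z ([:- x, 1:] ^ e x) = (if z = x then e x else 0)"
    by (auto simp: order_power_n_n intro: order_0I)
  thus ?case using insert nz order_mult[OF nz, of z] by simp
qed simp

text \<open>Descent of a divisor: the product of linear factors over the affine part of
  \<open>W\<close> is fixed by Frobenius because \<open>W\<close> is stable, so its coefficients lie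
  in \<open>k\<close>. The point \<open>Infinity\<close> has no linear factor and appears in the
  degree equation only.\<close>

lemma divisor_poly:
  fixes W :: "'k alg_closure proj_line multiset"
  assumes W: "stable W"
  obtains g :: "'k poly" where "lead_coeff g = 1"
    "\<And>z. Polynomial.order z (map_poly to_ac g) = count W (Affine z)"
    "size W = Polynomial.degree g + count W Infinity"
proof -
  interpret F: field_hom "frob :: 'k alg_closure \<Rightarrow> _" by (rule field_hom_frob)
  define S where "S = {z. Affine z \<in># W}"
  define e where "e = (\<lambda>z. count W (Affine z))"
  define g' where "g' = (\<Prod>x\<in>S. [:- x, 1:] ^ e x)"
  have "finite (Affine -` set_mset W)" by (rule finite_vimageI) (auto simp: inj_def)
  hence fin: "finite S" by (simp add: S_def vimage_def)
  have ord: "Polynomial.order z g' = e z" for z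
    using order_prod_linear_powers[OF fin, of e z] by (auto simp: g'_def S_def e_def not_in_iff)
  have monic: "lead_coeff g' = 1" by (simp add: g'_def lead_coeff_prod lead_coeff_power)
  have "map_poly frob g' = g'"
  proof (rule monic_eq_if_order_eq)
    show "lead_coeff (map_poly frob g') = 1" using monic by simp
    fix z :: "'k alg_closure"
    obtain w where w: "z = frob w" using bij_is_surj[OF bij_frob] by (metis surjD)
    have "Polynomial.order z (map_poly frob g') = e w" unfolding w F.order_map ord ..
    also have "\<dots> = e z" using W unfolding stable_def e_def w by (metis frobP_Affine)
    finally show "Polynomial.order z (map_poly frob g') = Polynomial.order z g'" by (simp add: ord)
  qed (fact monic)
  hence "frob (poly.coeff g' i) = poly.coeff g' i" for i by (metis F.coeff_map)
  hence "poly.coeff g' i \<in> range to_ac" for i by (rule frob_fixed_imp_range)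
  hence g: "map_poly to_ac (map_poly of_ac g') = g'"
    by (intro poly_eqI) (simp add: coeff_map_poly to_ac_of_ac)
  define g where "g = map_poly of_ac g'"
  have gg: "map_poly to_ac g = g'" using g by (simp add: g_def)
  have "to_ac (lead_coeff g) = 1" using monic unfolding gg[symmetric] by simp
  hence 1: "lead_coeff g = 1" by (metis to_ac_1 to_ac_eq_iff)
  have "Polynomial.degree g = Polynomial.degree g'" using gg by (metis to_ac.degree_map)
  also have "\<dots> = (\<Sum>x\<in>S. e x)" unfolding g'_def by (subst degree_prod_sum_eq) (auto simp: degree_linear_power)
  also have "\<dots> = (\<Sum>Q\<in>Affine ` S. count W Q)" by (subst sum.reindex) (auto simp: inj_on_def e_def)
  finally have deg: "Polynomial.degree g = (\<Sum>Q\<in>Affine ` S. count W Q)" .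
  have "size W = (\<Sum>Q\<in>set_mset W. count W Q)" by (simp add: size_multiset_overloaded_eq)
  also have "\<dots> = (\<Sum>Q\<in>insert Infinity (Affine ` S). count W Q)"
  proof (rule sum.mono_neutral_left)
    show "set_mset W \<subseteq> insert Infinity (Affine ` S)"
    proof
      fix Q assume "Q \<in># W" thus "Q \<in> insert Infinity (Affine ` S)" by (cases Q) (auto simp: S_def)
    qed
  qed (use fin in \<open>auto simp: not_in_iff\<close>)
  also have "\<dots> = count W Infinity + Polynomial.degree g" using fin by (subst sum.insert) (auto simp: deg)
  finally have "size W = Polynomial.degree g + count W Infinity" by simp
  thus ?thesis using that[of g] 1 ord by (simp add: gg e_def)
qed

text \<open>The Riemann-Roch space of \<open>W\<close>. It contains \<open>0\<close> thanks to the
  default pole order of the zero function.\<close>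

definition L :: "'k alg_closure proj_line multiset \<Rightarrow> 'k poly fract set" where
  "L W = {u. \<forall>Q. pole_order Q u \<le> count W Q}"

lemma card_poly_degree:
  "finite {f :: 'k poly. Polynomial.degree f \<le> m} \<and> card {f :: 'k poly. Polynomial.degree f \<le> m} = CARD('k) ^ Suc m"
proof (induction m)
  case 0
  have eq: "{f :: 'k poly. Polynomial.degree f \<le> 0} = range (\<lambda>c. [:c:])"
    by (auto elim: degree_eq_zeroE)
  have "inj (\<lambda>c :: 'k. [:c:])" by (simp add: inj_def)
  thus ?case unfolding eq by (simp add: card_image)
next
  case (Suc m)
  let ?D = "\<lambda>m. {f :: 'k poly. Polynomial.degree f \<le> m}"
  have eq: "?D (Suc m) = (\<lambda>(a, f). pCons a f) ` (UNIV \<times> ?D m)"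
  proof (intro Set.set_eqI iffI)
    fix f assume f: "f \<in> ?D (Suc m)"
    obtain a f' where f': "f = pCons a f'" by (cases f)
    hence "Polynomial.degree f' \<le> m" using f by (cases "f' = 0") auto
    thus "f \<in> (\<lambda>(a, f). pCons a f) ` (UNIV \<times> ?D m)" using f' by auto
  qed (auto intro: order_trans[OF degree_pCons_le])
  have "inj_on (\<lambda>(a, f). pCons a f) (UNIV \<times> ?D m)" by (auto simp: inj_on_def)
  thus ?case unfolding eq using Suc by (simp add: card_image card_cartesian_product)
qed

text \<open>The polynomial \<open>g\<close> of the affine part is a common denominator for the whole
  space. The condition at \<open>Infinity\<close> turns into the degree bound for \<open>f\<close>,
  because \<open>size W\<close> exceeds the degree of \<open>g\<close> by the multiplicity
  there.\<close>

lemma L_eq: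
  fixes g :: "'k poly"
  assumes g: "lead_coeff g = 1" "\<And>z. Polynomial.order z (map_poly to_ac g) = count W (Affine z)"
    "size W = Polynomial.degree g + count W Infinity"
  shows "L W = (\<lambda>f. Fract f g) ` {f. Polynomial.degree f \<le> size W}"
proof (intro Set.set_eqI iffI)
  have g0: "g \<noteq> 0" using g(1) by auto
  fix u
  {
    assume u: "u \<in> L W"
    show "u \<in> (\<lambda>f. Fract f g) ` {f. Polynomial.degree f \<le> size W}"
    proof (cases "u = 0")
      case True
      thus ?thesis by (intro image_eqI[of _ _ 0]) (auto simp: Zero_fract_def eq_fract g0)
    next
      case False
      then obtain a b where ab: "a \<noteq> 0" "b \<noteq> 0" "u = Fract a b" using fract_rep_nonzero by blast
      have po: "pole_order Q u = nat (- ord_quot Q (map_poly to_ac a) (map_poly to_ac b))" for Q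
        using ab by (simp add: pole_order_def base_change_Fract ord_at_Fract)
      have "map_poly to_ac b dvd map_poly to_ac (a * g)"
      proof (rule dvd_if_order_le)
        show "map_poly to_ac b \<noteq> (0 :: 'k alg_closure poly)" using ab by simp
        fix z
        have "pole_order (Affine z) u \<le> count W (Affine z)" using u by (simp add: L_def)
        moreover have "Polynomial.order z (map_poly to_ac (a * g)) = Polynomial.order z (map_poly to_ac a) + count W (Affine z)"
          using ab g0 by (simp add: order_mult g(2))
        ultimately show "Polynomial.order z (map_poly to_ac b) \<le> Polynomial.order z (map_poly to_ac (a * g))"
          unfolding po by simp
      qed
      hence "b dvd a * g" by (simp only: to_ac.map_poly_dvd_iff)
      then obtain f where f: "a * g = b * f" by (rule dvdE)
      hence "f \<noteq> 0" using ab g0 by auto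
      have "pole_order Infinity u \<le> count W Infinity" using u by (simp add: L_def)
      moreover have "Polynomial.degree a + Polynomial.degree g = Polynomial.degree b + Polynomial.degree f"
        using arg_cong[OF f, of Polynomial.degree] ab g0 \<open>f \<noteq> 0\<close> by (simp add: degree_mult_eq)
      ultimately have "Polynomial.degree f \<le> size W" unfolding po g(3) by simp
      moreover have "u = Fract f g" using f ab g0 by (simp add: eq_fract mult.commute)
      ultimately show ?thesis by blast
    qed
  }
  {
    assume "u \<in> (\<lambda>f. Fract f g) ` {f. Polynomial.degree f \<le> size W}"
    then obtain f where f: "u = Fract f g" "Polynomial.degree f \<le> size W" by blast
    show "u \<in> L W"
    proof (cases "f = 0")
      case True
      hence "u = 0" using f g0 by (simp add: Zero_fract_def eq_fract)
      thus ?thesis by (simp add: L_def pole_order_eq)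
    next
      case False
      hence po: "pole_order Q u = nat (- ord_quot Q (map_poly to_ac f) (map_poly to_ac g))" for Q
        using f g0 by (simp add: pole_order_def base_change_Fract ord_at_Fract)
      have "pole_order Q u \<le> count W Q" for Q
        using f(2) by (cases Q) (simp_all add: po g)
      thus ?thesis by (simp add: L_def)
    qed
  }
qed

text \<open>Riemann-Roch in genus zero; stability of \<open>W\<close> supplies the denominator over
  \<open>k\<close>.\<close>

lemma card_L:
  assumes "stable W"
  shows "finite (L W)" "card (L W) = CARD('k) ^ Suc (size W)"
proof -
  obtain g :: "'k poly" where g: "lead_coeff g = 1" "\<And>z. Polynomial.order z (map_poly to_ac g) = count W (Affine z)"
    "size W = Polynomial.degree g + count W Infinity" using divisor_poly[OF assms] by blast
  have "g \<noteq> 0" using g(1) by auto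
  hence "inj_on (\<lambda>f. Fract f g) A" for A by (auto simp: inj_on_def eq_fract)
  thus "finite (L W)" "card (L W) = CARD('k) ^ Suc (size W)"
    unfolding L_eq[OF g] using card_poly_degree by (simp_all add: card_image)
qed

subsection \<open>Frobenius orbits\<close>

lemma funpow_frobP_stable: "stable W \<Longrightarrow> count W ((frobP ^^ i) Q) = count W Q"
  by (induction i) (simp_all add: stable_def)

lemma orbit_self: "Q \<in> frobenius_orbit Q"
  unfolding frobenius_orbit_def by (rule range_eqI[of _ _ 0]) simp

lemma count_orbit:
  assumes "stable W" "Q' \<in> frobenius_orbit (Q :: 'k alg_closure proj_line)"
  shows "count W Q' = count W Q"
  using assms by (auto simp: frobenius_orbit_def funpow_frobP_stable)

lemma orbit_subset:
  assumes "stable W" "Q \<in># W"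
  shows "frobenius_orbit (Q :: 'k alg_closure proj_line) \<subseteq> set_mset W"
  using count_orbit[OF assms(1)] assms(2) by (metis count_greater_zero_iff subsetI)

lemma finite_orbit:
  assumes "stable W" "Q \<in># W"
  shows "finite (frobenius_orbit (Q :: 'k alg_closure proj_line))"
  using orbit_subset[OF assms] finite_subset by blast

text \<open>Orbits are made of forward iterates only, so returning from \<open>Q'\<close> to
  \<open>Q\<close> needs an argument: the orbit of \<open>Q'\<close> is the image of that of
  \<open>Q\<close> under an injective iterate and is contained in it, and the latter is
  finite.\<close>

lemma orbit_eq:
  fixes Q :: "'k alg_closure proj_line"
  assumes fin: "finite (frobenius_orbit Q)" and "Q' \<in> frobenius_orbit Q"
  shows "frobenius_orbit Q' = frobenius_orbit Q"
proof -
  obtain i where i: "Q' = (frobP ^^ i) Q" using assms by (auto simp: frobenius_orbit_def)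
  have "frobenius_orbit Q' = (frobP ^^ i) ` frobenius_orbit Q"
    by (auto simp: frobenius_orbit_def i image_image simp flip: funpow_add comp_apply[of "frobP ^^ _" "frobP ^^ _"] intro!: image_eqI)
       (simp_all add: add.commute)
  moreover have "inj (frobP ^^ i :: 'k alg_closure proj_line \<Rightarrow> _)"
    using bij_frobP bij_is_inj inj_fn by blast
  ultimately have "card (frobenius_orbit Q') = card (frobenius_orbit Q)"
    by (simp add: card_image inj_on_subset)
  moreover have "frobenius_orbit Q' \<subseteq> frobenius_orbit Q"
    by (auto simp: frobenius_orbit_def i simp flip: funpow_add comp_apply[of "frobP ^^ _" "frobP ^^ _"])
  ultimately show ?thesis using fin by (simp add: card_subset_eq)
qed

abbreviation orbits :: "'k alg_closure proj_line multiset \<Rightarrow> 'k alg_closure proj_line set set" where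
  "orbits W \<equiv> frobenius_orbit ` set_mset W"

lemma orbits_disjoint:
  assumes "stable W" "P \<in> orbits W" "P' \<in> orbits W" "P \<noteq> P'"
  shows "P \<inter> P' = {}"
proof (rule ccontr)
  assume "P \<inter> P' \<noteq> {}"
  then obtain Q where Q: "Q \<in> P" "Q \<in> P'" by blast
  thus False using assms orbit_eq finite_orbit by (metis imageE)
qed

lemma Union_orbits: "stable W \<Longrightarrow> \<Union> (orbits W) = set_mset W"
  using orbit_subset orbit_self by fast

lemma finite_orbits: "stable W \<Longrightarrow> P \<in> orbits W \<Longrightarrow> finite P"
  using finite_orbit by blast

lemma the_elem_count:
  assumes "stable W" "P \<in> orbits W" "Q \<in> P"
  shows "the_elem (count W ` P) = count W Q"
proof -
  have "count W ` P = {count W Q}"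
    using assms count_orbit by (auto simp: image_iff)
  thus ?thesis by simp
qed

text \<open>Multiplicities are constant along orbits, so sums over the support can be read off from
  the type. It is applied to \<open>h e = e\<close> and to \<open>h e = e div p\<close>.\<close>

lemma sum_splitting_behavior:
  fixes h :: "nat \<Rightarrow> nat" and W :: "'k alg_closure proj_line multiset"
  assumes "stable W"
  shows "(\<Sum>Q\<in>set_mset W. h (count W Q)) = (\<Sum>(m, e)\<in>#splitting_behavior W. m * h e)"
proof -
  have "(\<Sum>(m, e)\<in>#splitting_behavior W. m * h e) = (\<Sum>P\<in>orbits W. card P * h (the_elem (count W ` P)))"
    by (simp add: splitting_behavior_def sum_unfold_sum_mset image_mset.compositionality o_def)
  also have "\<dots> = (\<Sum>P\<in>orbits W. \<Sum>Q\<in>P. h (count W Q))"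
  proof (rule sum.cong[OF refl])
    fix P assume P: "P \<in> orbits W"
    have "(\<Sum>Q\<in>P. h (count W Q)) = (\<Sum>Q\<in>P. h (the_elem (count W ` P)))"
      by (rule sum.cong) (simp_all add: the_elem_count[OF assms P])
    thus "card P * h (the_elem (count W ` P)) = (\<Sum>Q\<in>P. h (count W Q))" by simp
  qed
  also have "\<dots> = (\<Sum>Q\<in>\<Union> (orbits W). h (count W Q))"
    using assms by (subst sum.Union_disjoint) (auto simp: finite_orbits orbits_disjoint)
  finally show ?thesis by (simp add: Union_orbits[OF assms])
qed

lemma size_stable: "stable (W :: 'k alg_closure proj_line multiset) \<Longrightarrow> size W = (\<Sum>(m, e)\<in>#splitting_behavior W. m * e)"
  using sum_splitting_behavior[of W "\<lambda>x. x"] by (simp add: size_multiset_overloaded_eq)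

subsection \<open>Counting functions with a given polar divisor\<close>

text \<open>Interpolates between \<open>L W\<close>, for empty \<open>T\<close>, and the functions
  with polar divisor exactly \<open>W\<close>, so that the count can treat one orbit at a
  time.\<close>

definition L_exact :: "'k alg_closure proj_line set set \<Rightarrow> 'k alg_closure proj_line multiset \<Rightarrow> 'k poly fract set" where
  "L_exact T W = {u \<in> L W. \<forall>P\<in>T. \<forall>Q\<in>P. pole_order Q u = count W Q}"

lemma pole_order_orbit: "Q' \<in> frobenius_orbit Q \<Longrightarrow> pole_order Q' (u :: 'k poly fract) = pole_order Q u"
  using count_orbit[OF stable_div_infinity[of u]] by simp

lemma stable_diff_orbit:
  assumes W: "stable W" and P: "P \<in> orbits W"
  shows "stable (W - mset_set P)"
  unfolding stable_def
proof
  fix Q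
  obtain Q0 where Q0: "P = frobenius_orbit Q0" "Q0 \<in># W" using P by blast
  have fin: "finite (frobenius_orbit Q0)" using finite_orbit W Q0 by blast
  have *: "Q' = frobP Q \<Longrightarrow> frobenius_orbit Q' \<subseteq> frobenius_orbit Q" for Q' Q :: "'k alg_closure proj_line"
    by (auto simp: frobenius_orbit_def simp del: funpow.simps simp flip: funpow_Suc_right comp_apply[of "frobP ^^ _" frobP])
  have "frobP Q \<in> P \<longleftrightarrow> Q \<in> P"
  proof
    assume "Q \<in> P"
    hence "frobenius_orbit Q = P" using orbit_eq[OF fin] Q0 by simp
    thus "frobP Q \<in> P" using *[OF refl, of Q] orbit_self by blast
  next
    assume a: "frobP Q \<in> P"
    \<comment> \<open>An orbit is closed under forward steps. Being finite, it is mapped onto itself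
      by the injective \<open>frobP\<close>, which permits the step back from \<open>frobP Q\<close>
      to \<open>Q\<close>.\<close>
    have "frobP ` P \<subseteq> P"
    proof
      fix Q' assume "Q' \<in> frobP ` P"
      then obtain Q'' where "Q'' \<in> P" "Q' = frobP Q''" by blast
      hence "frobenius_orbit Q'' = P" using orbit_eq[OF fin] Q0 by simp
      thus "Q' \<in> P" using *[OF \<open>Q' = frobP Q''\<close>] orbit_self by blast
    qed
    hence "frobP ` P = P"
      using fin Q0 bij_is_inj[OF bij_frobP] by (metis endo_inj_surj inj_on_subset subset_UNIV)
    then obtain Q' where "Q' \<in> P" "frobP Q' = frobP Q" using a by (metis imageE)
    thus "Q \<in> P" using bij_is_inj[OF bij_frobP] by (simp add: inj_eq)
  qed
  thus "count (W - mset_set P) (frobP Q) = count (W - mset_set P) Q"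
    using W by (simp add: stable_def count_mset_set')
qed

text \<open>Inclusion-exclusion as an induction on \<open>T\<close>. A function that misses the
  bound at one point of the orbit \<open>P\<close> misses it at all of them, hence lies in the space
  of \<open>W - mset_set P\<close>, whose degree is smaller by \<open>card P\<close>. Each orbit
  thus contributes one factor.\<close>

lemma card_L_exact:
  assumes "finite T" "T \<subseteq> orbits W" "stable W"
  shows "real (card (L_exact T W)) = real CARD('k) ^ Suc (size W) * (\<Prod>P\<in>T. 1 - 1 / real CARD('k) ^ card P)"
  using assms
proof (induction T arbitrary: W rule: finite_induct)
  case empty
  thus ?case by (simp add: L_exact_def card_L)
next
  case (insert P T W)
  let ?W = "W - mset_set P"
  have P: "P \<in> orbits W" and W: "stable W" using insert.prems by auto
  then obtain Q0 where Q0: "P = frobenius_orbit Q0" "Q0 \<in># W" by blast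
  have fin: "finite P" using finite_orbits W P by blast
  have W': "stable ?W" by (rule stable_diff_orbit[OF W P])
  have cnt: "count ?W Q = (if Q \<in> P then count W Q - 1 else count W Q)" for Q
    using fin by (simp add: count_mset_set')
  have disj: "Q \<notin> P" if "P' \<in> T" "Q \<in> P'" for P' Q
    using orbits_disjoint[OF W P, of P'] insert.prems(1) insert.hyps(2) that by blast
  \<comment> \<open>The induction hypothesis is used for \<open>?W\<close> too: subtracting
    \<open>P\<close> leaves the other orbits in the support, whether or not \<open>P\<close> itself
    survives.\<close>
  have T: "T \<subseteq> orbits ?W"
  proof
    fix P' assume P': "P' \<in> T"
    then obtain Q where Q: "P' = frobenius_orbit Q" "Q \<in># W" using insert.prems by blast
    hence "Q \<notin> P" using disj[OF P'] orbit_self by blast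
    hence "Q \<in># ?W" using Q cnt[of Q] by (simp flip: count_greater_zero_iff)
    thus "P' \<in> orbits ?W" using Q by blast
  qed
  have pos: "count W Q > 0" if "Q \<in> P" for Q
    using orbit_subset[OF W Q0(2)] Q0 that by auto
  have sub: "mset_set P \<subseteq># W"
    using pos fin by (auto simp: subseteq_mset_def count_mset_set' Suc_le_eq)
  hence size: "size ?W + card P = size W"
    using fin size_mset_mono[OF sub] by (simp add: size_Diff_submset)
  have U: "L_exact T W = L_exact (insert P T) W \<union> L_exact T ?W"
  proof (intro Set.set_eqI iffI)
    fix u assume u: "u \<in> L_exact T W"
    have le: "pole_order Q u \<le> count W Q" for Q using u by (simp add: L_exact_def L_def)
    show "u \<in> L_exact (insert P T) W \<union> L_exact T ?W"
    proof (cases "pole_order Q0 u = count W Q0")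
      case True
      hence "pole_order Q u = count W Q" if "Q \<in> P" for Q
        using that Q0 pole_order_orbit count_orbit[OF W] by simp
      thus ?thesis using u by (auto simp: L_exact_def)
    next
      case False
      hence "pole_order Q0 u < count W Q0" using le[of Q0] by simp
      hence lt: "pole_order Q u < count W Q" if "Q \<in> P" for Q
        using that Q0 pole_order_orbit count_orbit[OF W] by simp
      have "pole_order Q u \<le> count ?W Q" for Q
        unfolding cnt using lt[of Q] le[of Q] by auto
      moreover have "\<forall>P'\<in>T. \<forall>Q\<in>P'. pole_order Q u = count ?W Q"
        using u disj unfolding cnt L_exact_def by auto
      ultimately show ?thesis by (simp add: L_exact_def L_def)
    qed
  next
    fix u assume "u \<in> L_exact (insert P T) W \<union> L_exact T ?W"
    thus "u \<in> L_exact T W"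
    proof
      assume u: "u \<in> L_exact T ?W"
      have "pole_order Q u \<le> count ?W Q" for Q using u by (simp add: L_exact_def L_def)
      hence "pole_order Q u \<le> count W Q" for Q
        by (rule order_trans) (simp add: cnt)
      moreover have "\<forall>P'\<in>T. \<forall>Q\<in>P'. pole_order Q u = count W Q"
        using u disj unfolding cnt L_exact_def by auto
      ultimately show ?thesis by (simp add: L_exact_def L_def)
    qed (auto simp: L_exact_def)
  qed
  have "L_exact (insert P T) W \<inter> L_exact T ?W = {}"
  proof (rule equals0I)
    fix u assume "u \<in> L_exact (insert P T) W \<inter> L_exact T ?W"
    hence "pole_order Q0 u = count W Q0" "pole_order Q0 u \<le> count ?W Q0"
      using Q0 orbit_self by (auto simp: L_exact_def L_def)
    moreover have "Q0 \<in> P" using Q0 orbit_self by simp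
    moreover from this have "count ?W Q0 = count W Q0 - 1" by (simp only: cnt if_True)
    ultimately show False using pos[of Q0] by linarith
  qed
  moreover have "finite (L_exact T' W)" "finite (L_exact T' ?W)" for T'
    using card_L(1)[OF W] card_L(1)[OF W'] by (auto simp: L_exact_def)
  ultimately have "card (L_exact T W) = card (L_exact (insert P T) W) + card (L_exact T ?W)"
    by (subst U) (rule card_Un_disjoint)
  hence "real (card (L_exact (insert P T) W)) = real (card (L_exact T W)) - real (card (L_exact T ?W))"
    by simp
  also have "\<dots> = (real CARD('k) ^ Suc (size W) - real CARD('k) ^ Suc (size ?W)) * (\<Prod>P\<in>T. 1 - 1 / real CARD('k) ^ card P)"
    using insert.IH[OF _ W] insert.IH[OF T W'] insert.prems by (simp add: algebra_simps)
  also have "real CARD('k) ^ Suc (size W) - real CARD('k) ^ Suc (size ?W)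
      = real CARD('k) ^ Suc (size W) * (1 - 1 / real CARD('k) ^ card P)"
    unfolding size[symmetric] by (simp add: power_add field_simps)
  finally show ?case using insert.hyps by (simp add: mult.assoc)
qed

definition exact :: "'k alg_closure proj_line multiset \<Rightarrow> 'k poly fract set" where
  "exact W = {u. div_infinity u = W}"

lemma exact_iff: "u \<in> exact W \<longleftrightarrow> (\<forall>Q. pole_order Q u = count W Q)"
  by (auto simp: exact_def multiset_eq_iff)

lemma exact_eq:
  assumes "stable W"
  shows "exact W = L_exact (orbits W) W"
proof (intro Set.set_eqI iffI)
  fix u assume "u \<in> L_exact (orbits W) W"
  hence u: "pole_order Q u \<le> count W Q" "Q \<in># W \<Longrightarrow> pole_order Q u = count W Q" for Q
    using orbit_self[of Q] by (auto simp: L_exact_def L_def)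
  show "u \<in> exact W" unfolding exact_iff
    using u by (metis le_zero_eq not_in_iff)
qed (auto simp: exact_iff L_exact_def L_def)

lemma card_exact:
  assumes "stable W"
  shows "finite (exact W)" and "real (card (exact W)) = real CARD('k) ^ Suc (\<Sum>(m, e)\<in>#splitting_behavior W. m * e) *
    (\<Prod>(m, e)\<in>#splitting_behavior W. 1 - 1 / real CARD('k) ^ m)"
proof -
  have "exact W \<subseteq> L W" by (auto simp: exact_iff L_def)
  thus "finite (exact W)" using card_L(1)[OF assms] finite_subset by blast
  have "(\<Prod>(m, e)\<in>#splitting_behavior W. 1 - 1 / real CARD('k) ^ m) = (\<Prod>P\<in>orbits W. 1 - 1 / real CARD('k) ^ card P)"
    by (simp add: splitting_behavior_def prod_unfold_prod_mset image_mset.compositionality o_def)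
  thus "real (card (exact W)) = real CARD('k) ^ Suc (\<Sum>(m, e)\<in>#splitting_behavior W. m * e) *
    (\<Prod>(m, e)\<in>#splitting_behavior W. 1 - 1 / real CARD('k) ^ m)"
    using card_L_exact[of "orbits W" W] assms by (simp add: exact_eq size_stable)
qed

text \<open>The divisor \<open>\<lfloor>W/p\<rfloor>\<close>: a function \<open>z\<close> lies in
  its space exactly if \<open>z ^ p - z\<close> lies in that of \<open>W\<close>.\<close>

definition div_mset :: "'k alg_closure proj_line multiset \<Rightarrow> 'k alg_closure proj_line multiset" where
  "div_mset W = (\<Sum>Q\<in>set_mset W. replicate_mset (count W Q div p) Q)"

lemma count_div_mset [simp]: "count (div_mset W) Q = count W Q div p"
  by (auto simp: div_mset_def count_sum not_in_iff)

lemma card_L_div_mset: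
  assumes "stable W"
  shows "finite (L (div_mset W))"
    and "card (L (div_mset W)) = CARD('k) ^ Suc (\<Sum>(m, e)\<in>#splitting_behavior W. m * (e div p))"
proof -
  have st: "stable (div_mset W)" using assms by (simp add: stable_def)
  have "size (div_mset W) = (\<Sum>Q\<in>set_mset W. count W Q div p)"
    by (simp add: div_mset_def size_multiset_sum)
  thus "finite (L (div_mset W))" "card (L (div_mset W)) = CARD('k) ^ Suc (\<Sum>(m, e)\<in>#splitting_behavior W. m * (e div p))"
    using card_L[OF st] sum_splitting_behavior[OF assms, of "\<lambda>e. e div p"] by simp_all
qed

end

subsection \<open>Artin--Schreier polynomials\<close>

lemma card_eq_card_image_times:
  assumes "finite A" "\<And>a. a \<in> A \<Longrightarrow> card {b \<in> A. f b = f a} = k"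
  shows "card A = card (f ` A) * k"
proof -
  have "card A = (\<Sum>y\<in>f ` A. card {x \<in> A. f x = y})"
    using sum.image_gen[OF assms(1), of "\<lambda>_. 1 :: nat" f] by simp
  also have "\<dots> = (\<Sum>y\<in>f ` A. k)" by (rule sum.cong) (use assms(2) in auto)
  finally show ?thesis by simp
qed

text \<open>The last part puts the sum of the roots of a factor into the ground field, as needed in
  \<open>AS_factor_imp_AS\<close>.\<close>

lemma coeff_prod_linear:
  fixes A :: "'a::comm_ring_1 multiset"
  shows "Polynomial.degree (\<Prod>r\<in>#A. [:- r, 1:]) \<le> size A"
    and "poly.coeff (\<Prod>r\<in>#A. [:- r, 1:]) (size A) = 1"
    and "size A = Suc k \<Longrightarrow> poly.coeff (\<Prod>r\<in>#A. [:- r, 1:]) k = - \<Sum>\<^sub># A"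
proof -
  have "poly.coeff (\<Prod>r\<in>#A. [:- r, 1:]) (size A) = 1 \<and> (\<forall>m > size A. poly.coeff (\<Prod>r\<in>#A. [:- r, 1:]) m = 0) \<and>
    (\<forall>k. size A = Suc k \<longrightarrow> poly.coeff (\<Prod>r\<in>#A. [:- r, 1:]) k = - \<Sum>\<^sub># A)"
  proof (induction A)
    case (add x A)
    show ?case
    proof (cases "A = {#}")
      case False
      then obtain k where "size A = Suc k" by (metis Suc_pred nonempty_has_size)
      thus ?thesis using add by (auto simp: coeff_pCons split: nat.splits)
    qed (auto simp: coeff_pCons split: nat.splits)
  qed auto
  thus "poly.coeff (\<Prod>r\<in>#A. [:- r, 1:]) (size A) = 1"
    and "size A = Suc k \<Longrightarrow> poly.coeff (\<Prod>r\<in>#A. [:- r, 1:]) k = - \<Sum>\<^sub># A"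
    and "Polynomial.degree (\<Prod>r\<in>#A. [:- r, 1:]) \<le> size A"
    by (auto intro: degree_le)
qed

context
  fixes p :: nat and dummy :: "'a::field itself"
  assumes p: "prime p" and CHAR: "CHAR('a) = p"
begin

lemma frobenius_add: "(x + y :: 'a) ^ p = x ^ p + y ^ p"
  using p CHAR by (intro freshmans_dream) auto

lemma frobenius_diff: "(x - y :: 'a) ^ p = x ^ p - y ^ p"
  using frobenius_add[of "x - y" y] by (simp add: algebra_simps)

lemma of_nat_power_p: "(of_nat i :: 'a) ^ p = of_nat i"
  using prime_gt_0_nat[OF p] by (induction i) (simp_all add: frobenius_add)

lemma inj_on_of_nat_p: "inj_on (of_nat :: nat \<Rightarrow> 'a) {..<p}"
proof (rule linorder_inj_onI)
  fix i j assume "i < j" "i \<in> {..<p}" "j \<in> {..<p}"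
  thus "(of_nat i :: 'a) \<noteq> of_nat j"
    using CHAR by (subst of_nat_eq_iff_char_dvd) (auto dest: dvd_imp_le)
qed auto

lemma degree_AS_poly: "Polynomial.degree (AS_poly p (u :: 'a)) = p"
proof -
  have "Polynomial.degree (- Polynomial.monom 1 1 - [:u:]) < Polynomial.degree (Polynomial.monom (1 :: 'a) p)"
    using prime_ge_2_nat[OF p] by (simp add: degree_monom_eq degree_diff_less)
  thus ?thesis unfolding AS_poly_def
    using degree_add_eq_left[of "- Polynomial.monom 1 1 - [:u:]" "Polynomial.monom (1 :: 'a) p"]
    by (simp add: degree_monom_eq diff_diff_eq2 algebra_simps)
qed

lemma poly_AS_poly: "poly (AS_poly p u) (y :: 'a) = y ^ p - y - u"
  by (simp add: AS_poly_def poly_monom)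

text \<open>The prime field supplies \<open>p\<close> roots of a polynomial of degree
  \<open>p\<close>, so there are no others.\<close>

lemma power_p_eq_iff: "(z :: 'a) ^ p = z \<longleftrightarrow> z \<in> of_nat ` {..<p}"
proof -
  have deg: "Polynomial.degree (AS_poly p (0 :: 'a)) = p" by (rule degree_AS_poly)
  hence nz: "AS_poly p (0 :: 'a) \<noteq> 0" using prime_gt_0_nat[OF p] by auto
  have roots: "{z. poly (AS_poly p (0 :: 'a)) z = 0} = {z. z ^ p = z}" by (simp add: poly_AS_poly)
  have "of_nat ` {..<p} = {z :: 'a. z ^ p = z}"
  proof (rule card_seteq)
    show "finite {z :: 'a. z ^ p = z}" using poly_roots_finite[OF nz] unfolding roots .
    show "of_nat ` {..<p} \<subseteq> {z :: 'a. z ^ p = z}" by (auto simp: of_nat_power_p)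
    show "card {z :: 'a. z ^ p = z} \<le> card (of_nat ` {..<p} :: 'a set)"
      using card_poly_roots_bound[OF nz] unfolding roots deg by (simp add: card_image inj_on_of_nat_p)
  qed
  thus ?thesis by blast
qed

text \<open>The map \<open>z ^ p - z\<close> is additive with the prime field as kernel, so its
  fibres are cosets of that field. The factor \<open>p\<close> of the final formula originates
  here.\<close>

lemma AS_eq_iff: "(z :: 'a) ^ p - z = w ^ p - w \<longleftrightarrow> (\<exists>i<p. z = w + of_nat i)"
proof -
  have "z ^ p - z = w ^ p - w \<longleftrightarrow> (z - w) ^ p = z - w"
    unfolding frobenius_diff by (auto simp: algebra_simps)
  also have "\<dots> \<longleftrightarrow> (\<exists>i<p. z = w + of_nat i)"
    unfolding power_p_eq_iff by (auto simp: algebra_simps)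
  finally show ?thesis .
qed

lemma card_AS_solutions: "finite {z :: 'a. z ^ p - z = w ^ p - w}" "card {z :: 'a. z ^ p - z = w ^ p - w} = p"
proof -
  have eq: "{z :: 'a. z ^ p - z = w ^ p - w} = (\<lambda>i. w + of_nat i) ` {..<p}"
    unfolding AS_eq_iff by auto
  have "inj_on (\<lambda>i. w + of_nat i) {..<p}" using inj_on_of_nat_p by (simp add: inj_on_def)
  thus "finite {z :: 'a. z ^ p - z = w ^ p - w}" "card {z :: 'a. z ^ p - z = w ^ p - w} = p"
    unfolding eq by (simp_all add: card_image)
qed

lemma AS_zero: "(0 :: 'a) \<in> artin_schreier p"
  using prime_gt_0_nat[OF p] by (auto simp: artin_schreier_def intro!: exI[of _ 0])

lemma AS_diff: "x \<in> artin_schreier p \<Longrightarrow> y \<in> artin_schreier p \<Longrightarrow> x - y \<in> (artin_schreier p :: 'a set)"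
proof -
  assume "x \<in> artin_schreier p" "y \<in> artin_schreier p"
  then obtain z w where "x = z ^ p - z" "y = w ^ p - w" by (auto simp: artin_schreier_def)
  hence "x - y = (z - w) ^ p - (z - w)" by (simp add: frobenius_diff)
  thus ?thesis by (auto simp: artin_schreier_def)
qed

lemma AS_uminus: "x \<in> artin_schreier p \<Longrightarrow> - x \<in> (artin_schreier p :: 'a set)"
  using AS_diff[OF AS_zero, of x] by simp

lemma AS_add: "x \<in> artin_schreier p \<Longrightarrow> y \<in> artin_schreier p \<Longrightarrow> x + y \<in> (artin_schreier p :: 'a set)"
  using AS_diff[OF _ AS_uminus, of x y] by simp

end

section \<open>Irreducibility of Artin-Schreier polynomials, using the facts above over the closure
  as well\<close>

context
  fixes p :: nat and dummy :: "'a::field itself"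
  assumes p: "prime p" and CHAR: "CHAR('a) = p"
begin

text \<open>The roots of a factor of degree \<open>d\<close> are \<open>y + i\<close> for a root \<open>y\<close> and integers \<open>i\<close>, so that their
  sum \<open>d y + m\<close> is in the ground field; hence so is \<open>y\<close> if \<open>0 < d < p\<close>.\<close>

lemma AS_factor_imp_AS:
  assumes fac: "AS_poly p u = g * h" and d: "0 < Polynomial.degree g" "Polynomial.degree g < p"
  shows "(u :: 'a) \<in> artin_schreier p"
proof -
  let ?d = "Polynomial.degree g"
  let ?c = "to_ac :: 'a \<Rightarrow> 'a alg_closure"
  have Cac: "CHAR('a alg_closure) = p" using CHAR by simp
  have g0: "g \<noteq> 0" using d by auto
  obtain A where A: "size A = ?d" "map_poly ?c g = Polynomial.smult (?c (lead_coeff g)) (\<Prod>x\<in>#A. [:- x, 1:])"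
    using alg_closed_imp_factorization[of "map_poly ?c g"] g0 by auto
  have root: "r ^ p - r = ?c u" if "r \<in># A" for r
  proof -
    have "poly (map_poly ?c g) r = 0"
      unfolding A(2) using that by (auto simp: poly_prod_mset prod_mset_zero_iff)
    hence "poly (map_poly ?c (AS_poly p u)) r = 0" unfolding fac by simp
    moreover have "map_poly ?c (AS_poly p u) = AS_poly p (?c u)"
      unfolding AS_poly_def by (rule poly_eqI) (simp add: coeff_map_poly coeff_pCons split: nat.splits)
    ultimately have "poly (AS_poly p (?c u)) r = 0" by simp
    thus ?thesis by (simp add: AS_poly_def poly_monom)
  qed
  obtain y where y: "y \<in># A" using A(1) d by (metis multiset_nonemptyE size_empty less_irrefl)
  have shift: "\<exists>i. r = y + of_nat i" if "r \<in># A" for r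
  proof -
    have "r ^ p - r = y ^ p - y" using root[OF that] root[OF y] by simp
    thus ?thesis unfolding AS_eq_iff[OF p Cac] by blast
  qed
  have "\<exists>m. \<Sum>\<^sub># B = of_nat (size B) * y + of_nat m" if "B \<subseteq># A" for B
    using that
  proof (induction B)
    case (add r B)
    then obtain m where "\<Sum>\<^sub># B = of_nat (size B) * y + of_nat m" by (metis subset_mset.order_trans mset_subset_eq_add_right add_mset_add_single mset_subset_eq_add_left)
    moreover obtain i where "r = y + of_nat i" using shift mset_subset_eqD[OF add.prems, of r] by auto
    ultimately show ?case by (intro exI[of _ "m + i"]) (simp add: algebra_simps)
  qed (auto intro: exI[of _ 0])
  from this[OF subset_mset.order_refl] obtain m where m: "\<Sum>\<^sub># A = of_nat ?d * y + of_nat m"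
    unfolding A(1) by blast
  obtain k where k: "?d = Suc k" using d by (metis Suc_pred)
  have "?c (poly.coeff g k) = ?c (lead_coeff g) * - \<Sum>\<^sub># A"
    using arg_cong[OF A(2), of "\<lambda>q. poly.coeff q k"] coeff_prod_linear(3)[of A k] A(1) k by simp
  moreover have "?c (lead_coeff g) \<noteq> 0" using g0 by simp
  ultimately have "\<Sum>\<^sub># A = ?c (- poly.coeff g k / lead_coeff g)"
    by (simp add: field_simps)
  moreover have d0: "(of_nat ?d :: 'a alg_closure) \<noteq> 0"
    using d Cac by (auto simp: of_nat_eq_0_iff_char_dvd dest: dvd_imp_le)
  ultimately have "y = (?c (- poly.coeff g k / lead_coeff g) - of_nat m) / of_nat ?d"
    using m by (simp add: field_simps)
  hence "y = ?c ((- poly.coeff g k / lead_coeff g - of_nat m) / of_nat ?d)" by simp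
  then obtain z where "y = ?c z" by blast
  hence "?c (z ^ p - z) = ?c u" using root[OF y] by simp
  hence "u = z ^ p - z" by (simp only: to_ac_eq_iff)
  thus ?thesis by (auto simp: artin_schreier_def)
qed

text \<open>A solution \<open>z\<close> gives a linear factor, which is proper because
  \<open>p \<ge> 2\<close>. Conversely a proper factor has degree strictly between \<open>0\<close>
  and \<open>p\<close>, where \<open>AS_factor_imp_AS\<close> applies.\<close>

lemma irreducible_AS_poly_iff: "irreducible (AS_poly p (u :: 'a)) \<longleftrightarrow> u \<notin> artin_schreier p"
proof
  assume irr: "irreducible (AS_poly p u)"
  show "u \<notin> artin_schreier p"
  proof
    assume "u \<in> artin_schreier p"
    then obtain z where "u = z ^ p - z" by (auto simp: artin_schreier_def)
    hence "[:- z, 1:] dvd AS_poly p u" by (simp add: poly_eq_0_iff_dvd[symmetric] poly_AS_poly[OF p CHAR])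
    then obtain q where q: "AS_poly p u = [:- z, 1:] * q" by (rule dvdE)
    hence "is_unit [:- z, 1:] \<or> is_unit q" using irr irreducibleD by blast
    moreover have "q \<noteq> 0" using q irr by auto
    ultimately have "Polynomial.degree q = 0" by (auto simp: is_unit_iff_degree)
    hence "Polynomial.degree (AS_poly p u) = 1" unfolding q using \<open>q \<noteq> 0\<close> by (subst degree_mult_eq) auto
    thus False using degree_AS_poly[OF p CHAR, of u] prime_ge_2_nat[OF p] by simp
  qed
next
  assume u: "u \<notin> artin_schreier p"
  show "irreducible (AS_poly p u)"
  proof (rule irreducibleI)
    show "AS_poly p u \<noteq> 0" using degree_AS_poly[OF p CHAR, of u] prime_gt_0_nat[OF p] by auto
    thus "\<not> is_unit (AS_poly p u)" using degree_AS_poly[OF p CHAR, of u] prime_gt_0_nat[OF p] by (simp add: is_unit_iff_degree)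
    fix g h assume gh: "AS_poly p u = g * h"
    hence nz: "g \<noteq> 0" "h \<noteq> 0" using \<open>AS_poly p u \<noteq> 0\<close> by auto
    have "Polynomial.degree g + Polynomial.degree h = p"
      using degree_AS_poly[OF p CHAR, of u] unfolding gh using nz by (simp add: degree_mult_eq)
    moreover have "Polynomial.degree g = 0 \<or> Polynomial.degree g \<ge> p"
      using AS_factor_imp_AS[OF gh] u by linarith
    ultimately show "is_unit g \<or> is_unit h" using nz by (auto simp: is_unit_iff_degree)
  qed
qed

end

lemma hom_artin_schreier: "field_hom \<sigma> \<Longrightarrow> x \<in> artin_schreier p \<Longrightarrow> \<sigma> x \<in> artin_schreier p"
  unfolding artin_schreier_def
  by (auto simp: field_hom.hom_diff field_hom.hom_power)

subsection \<open>Standard forms\<close>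

definition standard :: "nat \<Rightarrow> 'k::field poly fract \<Rightarrow> bool" where
  "standard p v \<longleftrightarrow> (\<forall>Q. pole_order Q v > 0 \<longrightarrow> coprime (pole_order Q v) p)"

context finite_char
begin

lemmas AS_kx = AS_zero[where 'a = "'k poly fract", OF prime_p CHAR_kx]
  AS_add[where 'a = "'k poly fract", OF prime_p CHAR_kx]
  AS_uminus[where 'a = "'k poly fract", OF prime_p CHAR_kx]
  AS_diff[where 'a = "'k poly fract", OF prime_p CHAR_kx]

lemma AS_cong: "v - u \<in> artin_schreier p \<Longrightarrow> w - v \<in> artin_schreier p \<Longrightarrow> w - u \<in> artin_schreier p"
  for u v w :: "'k poly fract"
  using AS_kx(2)[of "v - u" "w - v"] by simp

lemma AS_sym: "v - u \<in> artin_schreier p \<Longrightarrow> u - v \<in> artin_schreier p"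
  for u v :: "'k poly fract"
  using AS_kx(3)[of "v - u"] by simp

lemma AS_curve_iff: "AS_curve p (u :: 'k poly fract) \<longleftrightarrow> base_change u \<notin> artin_schreier p"
  unfolding AS_curve_def irreducible_AS_poly_iff[OF prime_p CHAR_acx]
  using hom_artin_schreier[OF field_hom_base_change] by blast

lemma AS_curve_cong:
  fixes u v :: "'k poly fract"
  assumes "v - u \<in> artin_schreier p"
  shows "AS_curve p u \<longleftrightarrow> AS_curve p v"
proof -
  have "base_change v - base_change u \<in> artin_schreier p"
    using hom_artin_schreier[OF field_hom_base_change assms] by simp
  thus ?thesis
    unfolding AS_curve_iff
    using AS_add[OF prime_p CHAR_acx, of "base_change v - base_change u" "base_change u"]
      AS_diff[OF prime_p CHAR_acx, of "base_change v" "base_change v - base_change u"] by auto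
qed

lemma pole_order_AS: "pole_order Q (z ^ p - z :: 'k poly fract) = p * pole_order Q z"
  using p_ge_2 by (simp add: pole_order_eq pole_artin_schreier)

lemma not_coprime_mult: "\<not> coprime (p * m) p"
  using p_ge_2 by (auto simp: coprime_mult_left_iff)

text \<open>The argument takes place over the closure: for any \<open>z\<close> there, defined over
  \<open>k\<close> or not, the pole orders of \<open>z ^ p - z\<close> are divisible by
  \<open>p\<close>.\<close>

lemma AS_curve_if_pole:
  assumes "standard p v" "pole_order Q v > 0"
  shows "AS_curve p (v :: 'k poly fract)"
  unfolding AS_curve_iff
proof
  assume "base_change v \<in> artin_schreier p"
  then obtain z where "base_change v = z ^ p - z" by (auto simp: artin_schreier_def)
  hence "pole_order Q v = p * pole Q z" using p_ge_2 by (simp add: pole_order_eq pole_artin_schreier)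
  thus False using assms not_coprime_mult by (metis standard_def)
qed

lemma L_empty: "L {#} = range cst"
proof -
  have "lead_coeff (1 :: 'k poly) = 1" by simp
  from L_eq[OF this, of "{#}"] have "L {#} = (\<lambda>f. Fract f 1) ` {f. Polynomial.degree f \<le> 0}"
    by simp
  also have "{f. Polynomial.degree f \<le> 0} = range (\<lambda>c :: 'k. [:c:])"
    by (auto elim: degree_eq_zeroE)
  finally show ?thesis by (simp add: image_image cst_def to_fract_def)
qed

text \<open>Without poles \<open>v\<close> is a constant, and over the closure every constant has
  the form \<open>z ^ p - z\<close>, even if it does not over \<open>k\<close>. So geometric
  irreducibility is visible on the divisor.\<close>

lemma AS_curve_standard_iff:
  fixes v :: "'k poly fract"
  assumes "standard p v"
  shows "AS_curve p v \<longleftrightarrow> div_infinity v \<noteq> {#}"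
proof
  assume "div_infinity v \<noteq> {#}"
  then obtain Q where "count (div_infinity v) Q > 0" by (metis multiset_nonemptyE count_greater_zero_iff)
  thus "AS_curve p v" using AS_curve_if_pole[OF assms] by simp
next
  assume c: "AS_curve p v"
  show "div_infinity v \<noteq> {#}"
  proof
    assume "div_infinity v = {#}"
    hence "pole_order Q v = 0" for Q by (metis count_div_infinity count_empty)
    hence "v \<in> L {#}" by (simp add: L_def)
    then obtain c where v: "v = cst c" by (auto simp: L_empty)
    have "Polynomial.degree (AS_poly p (to_ac c)) > 0"
      using degree_AS_poly[OF prime_p CHAR_ac, of "to_ac c"] p_ge_2 by simp
    then obtain z where "poly (AS_poly p (to_ac c)) z = 0"
      using alg_closed_imp_poly_has_root by blast
    hence "to_ac c = z ^ p - z" by (simp add: poly_AS_poly[OF prime_p CHAR_ac])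
    hence "base_change v = cst z ^ p - cst z" by (simp add: v flip: cst.hom_power cst.hom_diff)
    thus False using c by (auto simp: AS_curve_iff artin_schreier_def)
  qed
qed

text \<open>If the orders at \<open>Q\<close> differed, the difference would have the larger one as
  its pole order, prime to \<open>p\<close>, while its pole orders are multiples of
  \<open>p\<close>. So the branch divisor is an invariant of the class.\<close>

lemma standard_unique:
  fixes u v :: "'k poly fract"
  assumes "standard p u" "standard p v" "v - u \<in> artin_schreier p"
  shows "div_infinity u = div_infinity v"
proof (rule multiset_eqI)
  fix Q
  obtain z where z: "v - u = z ^ p - z" using assms by (auto simp: artin_schreier_def)
  have "pole_order Q (v - u) = p * pole_order Q z" unfolding z by (rule pole_order_AS)
  hence 0: "\<not> coprime (pole_order Q (v - u)) p" using not_coprime_mult by simp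
  have "pole_order Q u = pole_order Q v"
  proof (rule ccontr)
    assume ne: "pole_order Q u \<noteq> pole_order Q v"
    show False
    proof (cases "pole_order Q u < pole_order Q v")
      case True
      hence "pole_order Q (v - u) = pole_order Q v" by (simp add: pole_order_eq pole_diff_eq)
      thus False using 0 True assms(2) by (metis standard_def less_zeroE not_gr_zero)
    next
      case False
      hence lt: "pole_order Q v < pole_order Q u" using ne by simp
      hence "pole_order Q (u - v) = pole_order Q u" by (simp add: pole_order_eq pole_diff_eq)
      moreover have "pole_order Q (v - u) = pole_order Q (u - v)"
        using pole_uminus[of Q "base_change (u - v)"] by (simp add: pole_order_eq)
      ultimately show False using 0 lt assms(1) by (metis standard_def less_zeroE not_gr_zero)
    qed
  qed
  thus "count (div_infinity u) Q = count (div_infinity v) Q" by simp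
qed

definition coprime_divisor :: "'k alg_closure proj_line multiset \<Rightarrow> bool" where
  "coprime_divisor W \<longleftrightarrow> (\<forall>Q. count W Q > 0 \<longrightarrow> coprime (count W Q) p)"

lemma standard_iff: "standard p v \<longleftrightarrow> coprime_divisor (div_infinity v)"
  by (simp add: standard_def coprime_divisor_def)

lemma branch_divisor_of_iff:
  "branch_divisor_of p u W \<longleftrightarrow> (\<exists>v. v - u \<in> artin_schreier p \<and> v \<in> exact W) \<and> coprime_divisor W"
  unfolding branch_divisor_of_def exact_def standard_def[symmetric] standard_iff by auto

text \<open>Irreducibility is traded for \<open>W \<noteq> {#}\<close>, a condition that Moebius
  transformations visibly preserve.\<close>

lemma curves_of_type_iff:
  "(u :: 'k poly fract) \<in> curves_of_type p R S \<longleftrightarrow>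
    (\<exists>v W. v - u \<in> artin_schreier p \<and> v \<in> exact W \<and> coprime_divisor W \<and> W \<noteq> {#} \<and> has_type W R S)"
proof -
  have "AS_curve p u \<longleftrightarrow> W \<noteq> {#}" if "v - u \<in> artin_schreier p" "v \<in> exact W" "coprime_divisor W" for v W
    using that AS_curve_cong[OF that(1)] AS_curve_standard_iff[of v] unfolding standard_iff exact_def by auto
  thus ?thesis unfolding curves_of_type_def branch_divisor_of_iff by blast
qed

lemma weighted_branch_divisor_iff:
  "weighted_branch_divisor p W \<longleftrightarrow> exact W \<noteq> {} \<and> coprime_divisor W \<and> W \<noteq> {#}"
proof -
  have "AS_curve p u \<longleftrightarrow> W \<noteq> {#}" if "v - u \<in> artin_schreier p" "v \<in> exact W" "coprime_divisor W" for u v W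
    using that AS_curve_cong[OF that(1)] AS_curve_standard_iff[of v] unfolding standard_iff exact_def by auto
  moreover have "u - u \<in> artin_schreier p" for u :: "'k poly fract" using AS_kx(1) by simp
  ultimately show ?thesis unfolding weighted_branch_divisor_def branch_divisor_of_iff by blast
qed

lemma stable_if_exact: "u \<in> exact W \<Longrightarrow> stable W"
  using stable_div_infinity by (auto simp: exact_def)

definition AS_class :: "'k poly fract \<Rightarrow> 'k poly fract set" where
  "AS_class u = {v. v - u \<in> artin_schreier p}"

lemma AS_class_eq_iff: "AS_class u = AS_class v \<longleftrightarrow> v - u \<in> artin_schreier p"
proof
  assume "AS_class u = AS_class v"
  moreover have "v \<in> AS_class v" using AS_kx(1) by (simp add: AS_class_def)
  ultimately have "v \<in> AS_class u" by simp
  thus "v - u \<in> artin_schreier p" by (simp add: AS_class_def)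
next
  assume "v - u \<in> artin_schreier p"
  thus "AS_class u = AS_class v" using AS_cong AS_sym unfolding AS_class_def by blast
qed

lemma N_of_eq: "N_of p W = AS_class ` exact W"
  by (auto simp: N_of_def quotient_def exact_def AS_class_def)

text \<open>The map \<open>z ^ p - z\<close> has fibres of size \<open>p\<close> on
  \<open>L (div_mset W)\<close>, and the members of \<open>exact W\<close> congruent to a given one
  form a coset of its image. Eliminating the size of the image gives the equation.\<close>

lemma card_N_of:
  assumes W: "stable W" "coprime_divisor W"
  shows "card (N_of p W) * card (L (div_mset W)) = p * card (exact W)"
proof -
  let ?V = "div_mset W" and ?f = "\<lambda>z :: 'k poly fract. z ^ p - z"
  have fib1: "card {b \<in> L ?V. ?f b = ?f a} = p" if a: "a \<in> L ?V" for a
  proof -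
    have "b \<in> L ?V" if "?f b = ?f a" for b
    proof -
      have "p * pole_order Q b = p * pole_order Q a" for Q
        using that pole_order_AS by metis
      hence "pole_order Q b = pole_order Q a" for Q using p_ge_2 by simp
      thus ?thesis using a by (simp add: L_def)
    qed
    hence "{b \<in> L ?V. ?f b = ?f a} = {b. ?f b = ?f a}" by blast
    thus ?thesis using card_AS_solutions(2)[OF prime_p CHAR_kx] by simp
  qed
  have 1: "card (L ?V) = card (?f ` L ?V) * p"
    using fib1 by (intro card_eq_card_image_times card_L_div_mset W)
  have fib2: "card {v \<in> exact W. AS_class v = AS_class u} = card (?f ` L ?V)" if u: "u \<in> exact W" for u
  proof -
    have "{v \<in> exact W. AS_class v = AS_class u} = (\<lambda>w. u + w) ` ?f ` L ?V"
    proof (intro Set.set_eqI iffI)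
      fix v assume "v \<in> {v \<in> exact W. AS_class v = AS_class u}"
      hence v: "v \<in> exact W" "v - u \<in> artin_schreier p" using AS_class_eq_iff[of u v] by auto
      then obtain z where z: "v - u = ?f z" by (auto simp: artin_schreier_def)
      have "p * pole_order Q z \<le> count W Q" for Q
      proof -
        have "p * pole_order Q z = pole_order Q (v - u)" unfolding z by (simp add: pole_order_AS)
        also have "\<dots> \<le> max (pole_order Q v) (pole_order Q u)"
          using pole_diff_le by (simp add: pole_order_eq)
        also have "\<dots> = count W Q" using u v by (simp add: exact_iff)
        finally show ?thesis .
      qed
      hence "z \<in> L ?V" using p_ge_2 by (simp add: L_def less_eq_div_iff_mult_less_eq mult.commute)
      moreover have "v = u + ?f z" using z by (simp add: algebra_simps)
      ultimately show "v \<in> (\<lambda>w. u + w) ` ?f ` L ?V" by blast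
    next
      fix v assume "v \<in> (\<lambda>w. u + w) ` ?f ` L ?V"
      then obtain z where z: "z \<in> L ?V" "v = u + ?f z" by blast
      have "pole_order Q v = count W Q" for Q
      proof (cases "count W Q = 0")
        case True
        hence "pole_order Q (?f z) = 0" using z(1) unfolding pole_order_AS L_def
          by (metis (mono_tags, lifting) count_div_mset div_0 le_zero_eq mem_Collect_eq mult_0_right)
        thus ?thesis using True u pole_add_le[of Q "base_change u" "base_change (?f z)"] unfolding z(2)
          by (simp add: pole_order_eq exact_iff)
      next
        case False
        hence "coprime (count W Q) p" using W(2) by (simp add: coprime_divisor_def)
        \<comment> \<open>Coprimality makes this inequality strict, so the pole of the added term
          stays below that of \<open>u\<close> and cannot cancel it.\<close>
        hence "p * (count W Q div p) \<noteq> count W Q" using not_coprime_mult by metis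
        moreover have "p * pole_order Q z \<le> p * (count W Q div p)" using z(1) by (simp add: L_def)
        moreover have "p * (count W Q div p) \<le> count W Q" by simp
        ultimately have "p * pole_order Q z < count W Q" by linarith
        hence "pole_order Q (?f z) < pole_order Q u"
          using u by (simp add: pole_order_AS exact_iff)
        hence "pole_order Q (?f z + u) = pole_order Q u"
          using pole_add_eq[of Q "base_change (?f z)" "base_change u"] by (simp add: pole_order_eq)
        thus ?thesis unfolding z(2) using u by (simp add: add.commute exact_iff)
      qed
      moreover have "v - u \<in> artin_schreier p" using z(2) by (auto simp: artin_schreier_def)
      ultimately show "v \<in> {v \<in> exact W. AS_class v = AS_class u}" using AS_class_eq_iff[of u v] by (auto simp: exact_iff)
    qed
    thus ?thesis by (simp add: card_image)
  qed
  have "card (exact W) = card (AS_class ` exact W) * card (?f ` L ?V)"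
    using fib2 by (intro card_eq_card_image_times card_exact W)
  thus ?thesis using 1 by (simp add: N_of_eq)
qed

text \<open>In \<open>card_N_of\<close> everything but the number sought is determined by the
  splitting behavior, and the size of \<open>L (div_mset W)\<close> is nonzero and cancels.\<close>

lemma card_N_of_eq:
  assumes "stable W" "coprime_divisor W" "stable W'" "coprime_divisor W'"
    and "splitting_behavior W = splitting_behavior W'"
  shows "card (N_of p W) = card (N_of p W')"
proof -
  have "real (card (exact W)) = real (card (exact W'))"
    using card_exact(2) assms by simp
  moreover have "card (L (div_mset W)) = card (L (div_mset W'))" "card (L (div_mset W')) \<noteq> 0"
    using card_L_div_mset(2) assms by simp_all
  ultimately show ?thesis
    using card_N_of[OF assms(1,2)] card_N_of[OF assms(3,4)] by (metis mult_cancel2 of_nat_eq_iff)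
qed

lemma finite_N_of: "stable W \<Longrightarrow> finite (N_of p (W :: 'k alg_closure proj_line multiset))"
  unfolding N_of_eq by (intro finite_imageI card_exact)

end

subsection \<open>Isomorphisms of the function fields\<close>

text \<open>The comorphism attached to a pair: \<open>\<sigma>\<close> acts on the coefficients,
  that is on the base, and \<open>y\<close> goes to \<open>y + z\<close>.\<close>

definition Phi :: "('a::field \<Rightarrow> 'b::field) \<Rightarrow> 'b \<Rightarrow> 'a poly \<Rightarrow> 'b poly" where
  "Phi \<sigma> z f = pcompose (map_poly \<sigma> f) [:z, 1:]"

context field_hom
begin

lemma Phi_add: "Phi \<sigma> z (f + g) = Phi \<sigma> z f + Phi \<sigma> z g"
  by (simp add: Phi_def pcompose_add)

lemma Phi_diff: "Phi \<sigma> z (f - g) = Phi \<sigma> z f - Phi \<sigma> z g"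
  by (simp add: Phi_def pcompose_diff)

lemma Phi_mult: "Phi \<sigma> z (f * g) = Phi \<sigma> z f * Phi \<sigma> z g"
  by (simp add: Phi_def pcompose_mult)

lemma Phi_const: "Phi \<sigma> z [:c:] = [:\<sigma> c:]"
  by (simp add: Phi_def)

lemma Phi_1: "Phi \<sigma> z 1 = 1"
  by (simp add: Phi_def pcompose_1)

lemma Phi_Y: "Phi \<sigma> z [:0, 1:] = [:z, 1:]"
  by (simp add: Phi_def pcompose_pCons)

lemma Phi_power: "Phi \<sigma> z (f ^ m) = Phi \<sigma> z f ^ m"
  by (induction m) (simp_all add: Phi_1 Phi_mult)

lemma degree_Phi: "Polynomial.degree (Phi \<sigma> z f) = Polynomial.degree f"
  by (simp add: Phi_def degree_pcompose)

lemma Phi_eq_iff: "Phi \<sigma> z f = Phi \<sigma> z g \<longleftrightarrow> f = g"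
proof
  assume "Phi \<sigma> z f = Phi \<sigma> z g"
  hence "pcompose (map_poly \<sigma> (f - g)) [:z, 1:] = 0"
    using Phi_diff[of z f g] by (simp add: Phi_def)
  hence "map_poly \<sigma> (f - g) = 0" by (subst (asm) pcompose_eq_0_iff) auto
  hence "f - g = 0" by (simp only: map_poly_eq_0)
  thus "f = g" by simp
qed simp

end

lemma AS_poly_conv: "AS_poly p u = [:0, 1:] ^ p - [:0, 1:] - [:u:]"
  by (simp add: AS_poly_def monom_altdef)

context finite_char
begin

lemma degree_ASP: "Polynomial.degree (AS_poly p (u :: 'k poly fract)) = p"
  by (rule degree_AS_poly[OF prime_p CHAR_kx])

lemma power_linear: "[:z, 1:] ^ p = [:0, 1:] ^ p + [:z ^ p:]" for z :: "'k poly fract"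
proof -
  have "([:0, 1:] + [:z:]) ^ p = [:0, 1:] ^ p + [:z:] ^ p"
    by (rule freshmans_dream) (simp_all add: CHAR_kx prime_p)
  moreover have "[:z:] ^ m = [:z ^ m:]" for m by (induction m) (simp_all add: one_pCons)
  ultimately show ?thesis by simp
qed

lemma Phi_AS_poly:
  assumes "field_hom \<sigma>" "\<sigma> u2 = u1 + (z ^ p - z)"
  shows "Phi \<sigma> z (AS_poly p (u2 :: 'k poly fract)) = AS_poly p (u1 :: 'k poly fract)"
proof -
  interpret field_hom \<sigma> by fact
  show ?thesis
    unfolding AS_poly_conv Phi_diff Phi_power Phi_Y Phi_const power_linear[of z] assms(2) by simp
qed

lemma mod_AS_unique: "Polynomial.degree r < p \<Longrightarrow> f = q * AS_poly p (u :: 'k poly fract) + r \<Longrightarrow> f mod AS_poly p u = r"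
  by (simp add: mod_poly_less degree_ASP)

lemma degree_mod_AS: "Polynomial.degree (f mod AS_poly p (u :: 'k poly fract)) < p"
proof -
  have "AS_poly p u \<noteq> 0" using degree_ASP[of u] p_ge_2 by auto
  thus ?thesis using degree_mod_less[of "AS_poly p u" f] p_ge_2 by (auto simp: degree_ASP)
qed

text \<open>\<open>Phi\<close> preserves degrees and maps one modulus to the other, so it commutes
  with remainders. This gives multiplicativity on the reduced representatives.\<close>

lemma Phi_mod:
  assumes "field_hom \<sigma>" "\<sigma> u2 = u1 + (z ^ p - z)"
  shows "Phi \<sigma> z (f mod AS_poly p (u2 :: 'k poly fract)) = Phi \<sigma> z f mod AS_poly p (u1 :: 'k poly fract)"
proof -
  interpret field_hom \<sigma> by fact
  have "Phi \<sigma> z f = Phi \<sigma> z (f div AS_poly p u2 * AS_poly p u2 + f mod AS_poly p u2)"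
    by (simp only: div_mult_mod_eq)
  also have "\<dots> = Phi \<sigma> z (f div AS_poly p u2) * AS_poly p u1 + Phi \<sigma> z (f mod AS_poly p u2)"
    unfolding Phi_add Phi_mult Phi_AS_poly[OF assms] ..
  finally have "Phi \<sigma> z f mod AS_poly p u1 = Phi \<sigma> z (f mod AS_poly p u2)"
    by (rule mod_AS_unique[rotated]) (simp add: degree_Phi degree_mod_AS)
  thus ?thesis ..
qed

abbreviation Car :: "'k poly fract poly set" where
  "Car \<equiv> {f. Polynomial.degree f < p}"

lemma carrier_ff: "carrier (fun_field p (u :: 'k poly fract)) = Car"
  by (simp add: fun_field_def)

lemma ff_simps:
  "mult (fun_field p (u :: 'k poly fract)) f g = f * g mod AS_poly p u"
  "add (fun_field p (u :: 'k poly fract)) f g = f + g"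
  "one (fun_field p (u :: 'k poly fract)) = 1"
  by (simp_all add: fun_field_def)

lemma const_eq: "const c = [:cst c:]"
  by (simp add: const_def cst_def)

lemma iota_eq: "f \<in> Car \<Longrightarrow> iota p (u :: 'k poly fract) f = pcompose f [:1, 1:]"
  by (simp add: iota_def carrier_ff)

lemma const_in_Car: "[:c:] \<in> Car"
  using p_ge_2 by simp

lemma Y_in_Car: "[:c, 1:] \<in> Car"
  using p_ge_2 by simp

lemma iso_iff:
  "\<phi> \<in> fun_field_iso p u v \<longleftrightarrow> bij_betw \<phi> Car Car \<and> \<phi> 1 = 1 \<and> (\<forall>c. \<phi> [:cst c:] = [:cst c:]) \<and>
    (\<forall>f\<in>Car. \<forall>g\<in>Car. \<phi> (f + g) = \<phi> f + \<phi> g \<and> \<phi> (f * g mod AS_poly p u) = \<phi> f * \<phi> g mod AS_poly p v)"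
  for u v :: "'k poly fract"
  unfolding fun_field_iso_def ring_iso_def ring_hom_def carrier_ff ff_simps const_eq
  by (auto dest: bij_betwE)

lemma Phi_iso:
  fixes \<sigma> :: "'k poly fract \<Rightarrow> 'k poly fract"
  assumes hom: "field_hom \<sigma>" and "surj \<sigma>" and cst: "\<And>c. \<sigma> (cst c) = cst c"
    and u: "\<sigma> u2 = u1 + (z ^ p - z)"
  shows "Phi \<sigma> z \<in> fun_field_iso p u2 u1" and "f \<in> Car \<Longrightarrow> Phi \<sigma> z (iota p u2 f) = iota p u1 (Phi \<sigma> z f)"
proof -
  interpret field_hom \<sigma> by fact
  have "bij_betw (Phi \<sigma> z) Car Car"
    unfolding bij_betw_def
  proof
    show "inj_on (Phi \<sigma> z) Car" by (simp add: inj_on_def Phi_eq_iff)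
    show "Phi \<sigma> z ` Car = Car"
    proof
      show "Car \<subseteq> Phi \<sigma> z ` Car"
      proof
        fix g assume g: "g \<in> Car"
        \<comment> \<open>The preimage is found by undoing first the translation of \<open>y\<close>
          and then \<open>\<sigma>\<close> on the coefficients.\<close>
        define f where "f = map_poly (inv_into UNIV \<sigma>) (pcompose g [:- z, 1:])"
        have i0: "inv_into UNIV \<sigma> 0 = 0" using inv_f_f[OF inj_hom, of 0] by simp
        have "map_poly \<sigma> f = pcompose g [:- z, 1:]"
          by (rule poly_eqI) (simp add: f_def coeff_map_poly i0 surj_f_inv_f[OF \<open>surj \<sigma>\<close>])
        hence "Phi \<sigma> z f = pcompose g (pcompose [:- z, 1:] [:z, 1:])"
          by (simp add: Phi_def pcompose_assoc)
        hence "Phi \<sigma> z f = g" by (simp add: pcompose_pCons)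
        moreover have "f \<in> Car" using g degree_Phi[of z f] calculation by simp
        ultimately show "g \<in> Phi \<sigma> z ` Car" by blast
      qed
    qed (auto simp: degree_Phi)
  qed
  thus "Phi \<sigma> z \<in> fun_field_iso p u2 u1"
    unfolding iso_iff by (simp add: Phi_1 Phi_const cst Phi_add Phi_mult Phi_mod[OF hom u])
  assume f: "f \<in> Car"
  have "Phi \<sigma> z (pcompose f [:1, 1:]) = pcompose (map_poly \<sigma> f) (pcompose [:1, 1:] [:z, 1:])"
    by (simp add: Phi_def map_pcompose pcompose_assoc)
  also have "\<dots> = pcompose (Phi \<sigma> z f) [:1, 1:]"
    unfolding Phi_def pcompose_assoc[symmetric] by (simp add: pcompose_pCons add.commute)
  finally show "Phi \<sigma> z (iota p u2 f) = iota p u1 (Phi \<sigma> z f)"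
    using f by (simp add: iota_eq degree_Phi)
qed

text \<open>An invariant \<open>g\<close> takes the value \<open>g(0)\<close> on all
  \<open>p\<close> elements of the prime field, too often for a degree below \<open>p\<close>. Thus
  the fixed field of \<open>\<iota>\<close> is \<open>k(x)\<close>.\<close>

lemma shift_invariant_imp_const:
  fixes g :: "'k poly fract poly"
  assumes "Polynomial.degree g < p" "pcompose g [:1, 1:] = g"
  shows "\<exists>c. g = [:c:]"
proof -
  define h where "h = g - [:poly g 0:]"
  have "poly g (of_nat i) = poly g 0" for i
  proof (induction i)
    case (Suc i)
    have "poly g (of_nat (Suc i)) = poly (pcompose g [:1, 1:]) (of_nat i)"
      by (simp add: poly_pcompose add.commute)
    thus ?case using Suc assms by simp
  qed simp
  hence roots: "of_nat ` {..<p} \<subseteq> {x. poly h x = 0}" by (auto simp: h_def)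
  have "h = 0"
  proof (rule ccontr)
    assume "h \<noteq> 0"
    have "p = card (of_nat ` {..<p} :: 'k poly fract set)"
      using inj_on_of_nat_p[OF prime_p CHAR_kx] by (simp add: card_image)
    also have "\<dots> \<le> card {x. poly h x = 0}"
      using roots poly_roots_finite[OF \<open>h \<noteq> 0\<close>] by (rule card_mono[rotated])
    also have "\<dots> \<le> Polynomial.degree h" by (rule card_poly_roots_bound[OF \<open>h \<noteq> 0\<close>])
    also have "\<dots> < p" unfolding h_def using assms(1) by (intro degree_diff_less) auto
    finally show False by simp
  qed
  thus ?thesis by (auto simp: h_def)
qed

text \<open>Both \<open>\<phi> r\<close> for \<open>r\<close> in \<open>k(x)\<close> and
  \<open>\<phi> y - y\<close> are invariant under the shift, hence lie in \<open>k(x)\<close>; this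
  yields \<open>\<sigma>\<close> and \<open>z\<close>. The relation between \<open>u1\<close> and
  \<open>u2\<close> comes from computing the image of \<open>y ^ p\<close> in two ways.\<close>

lemma iso_imp_Phi:
  fixes \<phi> :: "'k poly fract poly \<Rightarrow> 'k poly fract poly"
  assumes iso: "\<phi> \<in> fun_field_iso p u2 u1"
    and comm: "\<And>f. f \<in> Car \<Longrightarrow> \<phi> (iota p u2 f) = iota p u1 (\<phi> f)"
  shows "\<exists>A z. invertible A \<and> moebius_subst A u2 - u1 = z ^ p - z \<and> (\<forall>f\<in>Car. \<phi> f = Phi (moebius_subst A) z f)"
proof -
  have bij: "bij_betw \<phi> Car Car" and one: "\<phi> 1 = 1" and c: "\<phi> [:cst c:] = [:cst c:]" for c
    using iso unfolding iso_iff by auto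
  have add: "\<phi> (f + g) = \<phi> f + \<phi> g" and mult: "\<phi> (f * g mod AS_poly p u2) = \<phi> f * \<phi> g mod AS_poly p u1"
    if "f \<in> Car" "g \<in> Car" for f g
    using iso that unfolding iso_iff by blast+
  have inj: "f = g" if "\<phi> f = \<phi> g" "f \<in> Car" "g \<in> Car" for f g
    using bij that by (auto simp: bij_betw_def inj_on_def)
  have cl: "\<phi> f \<in> Car" if "f \<in> Car" for f using bij that by (auto dest: bij_betwE)
  have comm': "\<phi> (pcompose f [:1, 1:]) = pcompose (\<phi> f) [:1, 1:]" if "f \<in> Car" for f
    using comm[OF that] that cl[OF that] by (simp only: iota_eq)
  have small: "f mod AS_poly p u = f" if "f \<in> Car" for f and u :: "'k poly fract"
    using that by (simp add: mod_poly_less degree_ASP)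
  have const: "\<exists>s. \<phi> [:r:] = [:s:]" for r
    using comm'[OF const_in_Car, of r] cl[OF const_in_Car, of r]
    by (intro shift_invariant_imp_const) simp_all
  define \<sigma> where "\<sigma> = (\<lambda>r. poly.coeff (\<phi> [:r:]) 0)"
  have \<sigma>: "\<phi> [:r:] = [:\<sigma> r:]" for r using const[of r] by (auto simp: \<sigma>_def)
  have hom: "field_hom \<sigma>"
  proof
    show "\<sigma> 1 = 1" using one by (simp add: \<sigma>_def flip: one_pCons)
    show "\<sigma> (r + s) = \<sigma> r + \<sigma> s" for r s
      using add[OF const_in_Car const_in_Car, of r s] by (simp add: \<sigma>)
    show "\<sigma> (r * s) = \<sigma> r * \<sigma> s" for r s
    proof -
      have "[:r:] * [:s:] mod AS_poly p u2 = [:r * s:]" using small[OF const_in_Car[of "r * s"]] by (simp add: mult.commute)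
      hence "\<phi> [:r * s:] = [:\<sigma> r:] * [:\<sigma> s:] mod AS_poly p u1"
        using mult[OF const_in_Car const_in_Car, of r s] by (simp add: \<sigma>)
      also have "\<dots> = [:\<sigma> r * \<sigma> s:]" using small[OF const_in_Car[of "\<sigma> r * \<sigma> s"]] by (simp add: mult.commute)
      finally show ?thesis by (simp add: \<sigma>)
    qed
  qed
  interpret field_hom \<sigma> by fact
  \<comment> \<open>By injectivity of \<open>\<phi>\<close> the preimage of an element of
    \<open>k(x)\<close> is again fixed by \<open>\<iota>\<close>, hence in
    \<open>k(x)\<close>.\<close>
  have surj: "surj \<sigma>"
    unfolding surj_def
  proof
    fix s
    have "[:s:] \<in> \<phi> ` Car" unfolding bij_betw_imp_surj_on[OF bij] by (rule const_in_Car)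
    then obtain f where f: "f \<in> Car" "\<phi> f = [:s:]" by force
    have "\<phi> (pcompose f [:1, 1:]) = \<phi> f" using comm'[OF f(1)] f(2) by simp
    moreover have "pcompose f [:1, 1:] \<in> Car" using f(1) by (simp add: degree_pcompose)
    ultimately have "pcompose f [:1, 1:] = f" using inj f(1) by blast
    then obtain r where "f = [:r:]" using shift_invariant_imp_const f(1) by blast
    thus "\<exists>r. s = \<sigma> r" using f(2) \<sigma> by auto
  qed
  have c': "\<sigma> (cst c) = cst c" for c using c[of c] by (simp add: \<sigma>)
  define h where "h = \<phi> [:0, 1:] - [:0, 1:]"
  have Y1: "\<phi> [:1, 1:] = 1 + \<phi> [:0, 1:]"
    using add[OF const_in_Car[of 1] Y_in_Car[of 0]] one by (simp add: one_pCons)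
  have "pcompose (\<phi> [:0, 1:]) [:1, 1:] = 1 + \<phi> [:0, 1:]"
    using comm'[OF Y_in_Car[of 0]] Y1 by (simp add: pcompose_pCons)
  hence "pcompose h [:1, 1:] = h"
    by (simp add: h_def pcompose_diff pcompose_pCons one_pCons)
  moreover have "Polynomial.degree h < p"
    unfolding h_def using cl[OF Y_in_Car[of 0]] Y_in_Car[of 0] by (intro degree_diff_less) auto
  ultimately obtain z where z: "h = [:z:]" using shift_invariant_imp_const by blast
  hence Y: "\<phi> [:0, 1:] = [:z, 1:]" by (simp add: h_def algebra_simps)
  have Phi: "\<phi> f = Phi \<sigma> z f" if "f \<in> Car" for f
    using that
  proof (induction f)
    case 0
    show ?case using \<sigma>[of 0] by (simp add: Phi_def)
  next
    case (pCons a f)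
    show ?case
    proof (cases "f = 0")
      case True
      thus ?thesis by (simp add: \<sigma> Phi_const)
    next
      case False
      have f: "f \<in> Car" and Yf: "[:0, 1:] * f \<in> Car" using pCons.prems False by auto
      have "\<phi> ([:0, 1:] * f) = [:z, 1:] * Phi \<sigma> z f mod AS_poly p u1"
        using mult[OF Y_in_Car f, of 0] pCons.IH[OF f] small[OF Yf, of u2] by (simp only: Y)
      also have "\<dots> = Phi \<sigma> z ([:0, 1:] * f) mod AS_poly p u1" by (simp only: Phi_mult Phi_Y)
      also have "\<dots> = Phi \<sigma> z ([:0, 1:] * f)" using Yf by (intro small) (simp only: mem_Collect_eq degree_Phi)
      finally have "\<phi> ([:a:] + [:0, 1:] * f) = Phi \<sigma> z ([:a:] + [:0, 1:] * f)"
        using add[OF const_in_Car Yf, of a] by (simp only: \<sigma> Phi_add Phi_const)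
      thus ?thesis by simp
    qed
  qed
  have "\<sigma> u2 = u1 + (z ^ p - z)"
  proof -
    \<comment> \<open>\<open>y ^ p\<close> is not a reduced representative, so it enters as the
      product of \<open>y\<close> and \<open>y ^ (p - 1)\<close>, whose residue is
      \<open>y + u2\<close>.\<close>
    have Yp: "[:0, 1:] ^ (p - 1) \<in> Car" using p_ge_2 by (simp add: degree_linear_power)
    have eqp: "x * x ^ (p - 1) = x ^ p" for x :: "'k poly fract poly" using p_ge_2 by (simp add: power_eq_if)
    have "[:0, 1:] ^ p mod AS_poly p u2 = [:u2, 1:]"
      using Y_in_Car by (intro mod_AS_unique[of _ _ 1]) (simp_all add: AS_poly_conv)
    hence "\<phi> [:u2, 1:] = \<phi> [:0, 1:] * \<phi> ([:0, 1:] ^ (p - 1)) mod AS_poly p u1"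
      using mult[OF Y_in_Car[of 0] Yp] by (simp only: eqp)
    also have "\<dots> = [:z, 1:] ^ p mod AS_poly p u1"
      by (simp only: Phi[OF Yp] Phi_power Phi_Y Y eqp)
    also have "\<dots> = [:u1 + z ^ p, 1:]"
      using Y_in_Car by (intro mod_AS_unique[of _ _ 1]) (simp_all add: AS_poly_conv power_linear[of z])
    finally have "\<phi> [:u2, 1:] = [:u1 + z ^ p, 1:]" .
    moreover have "\<phi> [:u2, 1:] = [:\<sigma> u2 + z, 1:]"
      by (simp add: Phi[OF Y_in_Car] Phi_def pcompose_pCons)
    ultimately show ?thesis by (simp add: algebra_simps)
  qed
  moreover obtain A where "invertible A" "\<sigma> = moebius_subst A" using surj_khom_imp_moebius_subst[OF hom c' surj] by blast
  ultimately show ?thesis using Phi by (intro exI[of _ A] exI[of _ z]) simp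
qed

lemma surj_moebius_subst:
  assumes "invertible (A :: 'k ^ 2 ^ 2)"
  shows "surj (moebius_subst A)"
proof -
  obtain B where "invertible B" "B ** A = mat 1" using GL2_inverse[OF assms] by metis
  hence "moebius_subst A (moebius_subst B u) = u" for u using assms by (simp add: moebius_subst_comp moebius_subst_one)
  thus ?thesis by (metis surjI)
qed

lemma AS_isomorphic_iff:
  "AS_isomorphic p u1 u2 \<longleftrightarrow> (\<exists>A. invertible A \<and> moebius_subst A u2 - u1 \<in> artin_schreier p)"
  for u1 u2 :: "'k poly fract"
proof
  assume "AS_isomorphic p u1 u2"
  then obtain \<phi> where "\<phi> \<in> fun_field_iso p u2 u1" "\<And>f. f \<in> Car \<Longrightarrow> \<phi> (iota p u2 f) = iota p u1 (\<phi> f)"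
    by (auto simp: AS_isomorphic_def carrier_ff)
  from iso_imp_Phi[OF this]
  show "\<exists>A. invertible A \<and> moebius_subst A u2 - u1 \<in> artin_schreier p"
    by (auto simp: artin_schreier_def)
next
  assume "\<exists>A. invertible A \<and> moebius_subst A u2 - u1 \<in> artin_schreier p"
  then obtain A z where A: "invertible A" and z: "moebius_subst A u2 - u1 = z ^ p - z" by (auto simp: artin_schreier_def)
  hence "moebius_subst A u2 = u1 + (z ^ p - z)" by (simp add: algebra_simps)
  from Phi_iso[OF field_hom_moebius_subst[OF A] surj_moebius_subst[OF A] moebius_subst_cst[OF A] this]
  show "AS_isomorphic p u1 u2" by (auto simp: AS_isomorphic_def carrier_ff)
qed

lemma Phi_moebius_subst_iso:
  assumes A: "invertible (A :: 'k ^ 2 ^ 2)" and z: "moebius_subst A u2 - u1 = z ^ p - z"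
  shows "Phi (moebius_subst A) z \<in> fun_field_iso p u2 u1"
    and "f \<in> Car \<Longrightarrow> Phi (moebius_subst A) z (iota p u2 f) = iota p u1 (Phi (moebius_subst A) z f)"
proof -
  have "moebius_subst A u2 = u1 + (z ^ p - z)" using z by (simp add: algebra_simps)
  from Phi_iso[OF field_hom_moebius_subst[OF A] surj_moebius_subst[OF A] moebius_subst_cst[OF A] this]
  show "Phi (moebius_subst A) z \<in> fun_field_iso p u2 u1"
    and "f \<in> Car \<Longrightarrow> Phi (moebius_subst A) z (iota p u2 f) = iota p u1 (Phi (moebius_subst A) z f)" by blast+
qed

subsection \<open>The centralizer of \<open>\<iota>\<close>\<close>

lemma iso_inv:
  assumes "\<phi> \<in> fun_field_iso p u (u :: 'k poly fract)"
  shows "inv_into Car \<phi> \<in> fun_field_iso p u u"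
proof -
  let ?i = "inv_into Car \<phi>"
  have bij: "bij_betw \<phi> Car Car" and one: "\<phi> 1 = 1" and c: "\<And>c. \<phi> [:cst c:] = [:cst c:]"
    using assms unfolding iso_iff by auto
  have i1: "?i (\<phi> f) = f" if "f \<in> Car" for f
    using bij that by (rule bij_betw_inv_into_left)
  have i2: "\<phi> (?i f) = f" "?i f \<in> Car" if "f \<in> Car" for f
    using bij that bij_betw_inv_into[OF bij] by (auto simp: bij_betw_inv_into_right dest: bij_betwE)
  have "?i (f + g) = ?i f + ?i g \<and> ?i (f * g mod AS_poly p u) = ?i f * ?i g mod AS_poly p u"
    if f: "f \<in> Car" and g: "g \<in> Car" for f g
  proof -
    have "f + g = \<phi> (?i f + ?i g) \<and> f * g mod AS_poly p u = \<phi> (?i f * ?i g mod AS_poly p u)"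
      using assms i2[OF f] i2[OF g] unfolding iso_iff by auto
    moreover have "?i f + ?i g \<in> Car" using i2(2)[OF f] i2(2)[OF g] by (auto intro: degree_add_less)
    moreover have "?i f * ?i g mod AS_poly p u \<in> Car" by (simp add: degree_mod_AS)
    ultimately show ?thesis using i1 by metis
  qed
  moreover have "?i 1 = 1" using i1[of 1] one p_ge_2 by simp
  moreover have "?i [:cst c:] = [:cst c:]" for c using i1[OF const_in_Car, of "cst c"] c[of c] by simp
  ultimately show ?thesis unfolding iso_iff using bij_betw_inv_into[OF bij] by blast
qed

text \<open>Membership in \<open>fun_field_iso\<close> ignores values outside the carrier, whereas
  elements of \<open>Aut_curve\<close> are extensional; this passes between a map and its
  restriction.\<close>

lemma iso_cong:
  assumes "\<phi> \<in> fun_field_iso p u (v :: 'k poly fract)" "\<And>f. f \<in> Car \<Longrightarrow> \<psi> f = \<phi> f"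
  shows "\<psi> \<in> fun_field_iso p u v"
proof -
  have "bij_betw \<psi> Car Car \<longleftrightarrow> bij_betw \<phi> Car Car" using assms(2) by (intro bij_betw_cong) auto
  moreover have "f + g \<in> Car" if "f \<in> Car" "g \<in> Car" for f g using that by (auto intro: degree_add_less)
  moreover have "f mod AS_poly p u \<in> Car" for f by (simp add: degree_mod_AS)
  moreover have "1 \<in> Car" using p_ge_2 by simp
  ultimately show ?thesis using assms const_in_Car unfolding iso_iff by metis
qed

lemma iso_closed: "\<phi> \<in> fun_field_iso p u v \<Longrightarrow> f \<in> Car \<Longrightarrow> \<phi> f \<in> Car" for u v :: "'k poly fract"
  unfolding iso_iff using bij_betwE by blast

lemma subgroup_isos:
  "subgroup (fun_field_iso p u u \<inter> extensional Car) (BijGroup Car)" for u :: "'k poly fract"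
proof -
  let ?H = "fun_field_iso p u u \<inter> extensional Car"
  have Bij: "?H \<subseteq> Bij Car" by (auto simp: Bij_def iso_iff)
  show ?thesis
  proof (rule subgroup.intro)
    show "?H \<subseteq> carrier (BijGroup Car)" using Bij by (simp add: BijGroup_def)
    fix \<phi> \<psi> assume h: "\<phi> \<in> ?H" "\<psi> \<in> ?H"
    have "\<psi> f \<in> Car" if "f \<in> Car" for f using h that iso_closed by blast
    moreover have "(\<phi> \<circ> \<psi>) \<in> fun_field_iso p u u"
      using h unfolding fun_field_iso_def by (auto intro: ring_iso_set_trans)
    ultimately have "compose Car \<phi> \<psi> \<in> fun_field_iso p u u"
      by (elim iso_cong) (simp add: compose_def)
    thus "\<phi> \<otimes>\<^bsub>BijGroup Car\<^esub> \<psi> \<in> ?H"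
      using h Bij by (auto simp: BijGroup_def)
  next
    have "(\<lambda>f. f) \<in> fun_field_iso p u u" using bij_betw_id[of Car] by (simp add: iso_iff id_def)
    thus "\<one>\<^bsub>BijGroup Car\<^esub> \<in> ?H" by (auto simp: BijGroup_def elim: iso_cong)
  next
    fix \<phi> assume h: "\<phi> \<in> ?H"
    hence "inv_into Car \<phi> \<in> fun_field_iso p u u" using iso_inv by blast
    hence "restrict (inv_into Car \<phi>) Car \<in> fun_field_iso p u u" by (elim iso_cong) simp
    thus "inv\<^bsub>BijGroup Car\<^esub> \<phi> \<in> ?H" using h Bij by (subst inv_BijGroup) auto
  qed
qed

lemma Aut_curve_eq:
  "Aut_curve p u = BijGroup Car \<lparr>carrier := fun_field_iso p u u \<inter> extensional Car\<rparr>" for u :: "'k poly fract"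
  by (simp add: Aut_curve_def carrier_ff)

lemma group_Aut_curve: "group (Aut_curve p u)" for u :: "'k poly fract"
  unfolding Aut_curve_eq by (rule subgroup.subgroup_is_group[OF subgroup_isos group_BijGroup])

lemma carrier_Aut: "carrier (Aut_curve p u) = fun_field_iso p u u \<inter> extensional Car" for u :: "'k poly fract"
  by (simp add: Aut_curve_eq)

lemma mult_Aut:
  fixes u :: "'k poly fract"
  assumes "\<phi> \<in> carrier (Aut_curve p u)" "\<psi> \<in> carrier (Aut_curve p u)"
  shows "\<phi> \<otimes>\<^bsub>Aut_curve p u\<^esub> \<psi> = compose Car \<phi> \<psi>"
proof -
  have "\<phi> \<in> Bij Car" "\<psi> \<in> Bij Car"
    using assms subgroup.subset[OF subgroup_isos, of u] unfolding carrier_Aut by (auto simp: BijGroup_def)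
  thus ?thesis by (simp add: Aut_curve_eq BijGroup_def)
qed

lemma centralizer_generate_singleton:
  assumes "group G" "a \<in> carrier G"
  shows "centralizer G (generate G {a}) = {g \<in> carrier G. g \<otimes>\<^bsub>G\<^esub> a = a \<otimes>\<^bsub>G\<^esub> g}"
proof -
  interpret group G by fact
  have "g \<otimes>\<^bsub>G\<^esub> h = h \<otimes>\<^bsub>G\<^esub> g" if g: "g \<in> carrier G" "g \<otimes>\<^bsub>G\<^esub> a = a \<otimes>\<^bsub>G\<^esub> g" and "h \<in> generate G {a}" for g h
    using that(3)
  proof (induction h rule: generate.induct)
    case one
    show ?case using g by simp
  next
    case (incl h)
    thus ?case using g by simp
  next
    case (inv h)
    have "inv\<^bsub>G\<^esub> a \<otimes>\<^bsub>G\<^esub> (g \<otimes>\<^bsub>G\<^esub> a) \<otimes>\<^bsub>G\<^esub> inv\<^bsub>G\<^esub> a = inv\<^bsub>G\<^esub> a \<otimes>\<^bsub>G\<^esub> (a \<otimes>\<^bsub>G\<^esub> g) \<otimes>\<^bsub>G\<^esub> inv\<^bsub>G\<^esub> a"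
      using g by simp
    moreover have "inv\<^bsub>G\<^esub> a \<otimes>\<^bsub>G\<^esub> (g \<otimes>\<^bsub>G\<^esub> a) \<otimes>\<^bsub>G\<^esub> inv\<^bsub>G\<^esub> a = inv\<^bsub>G\<^esub> a \<otimes>\<^bsub>G\<^esub> g"
      using g(1) assms(2) by (simp add: m_assoc)
    moreover have "inv\<^bsub>G\<^esub> a \<otimes>\<^bsub>G\<^esub> (a \<otimes>\<^bsub>G\<^esub> g) \<otimes>\<^bsub>G\<^esub> inv\<^bsub>G\<^esub> a = g \<otimes>\<^bsub>G\<^esub> inv\<^bsub>G\<^esub> a"
      using g(1) assms(2) by (simp add: m_assoc[symmetric])
    ultimately show ?case using inv by simp
  next
    case (eng h1 h2)
    have "h1 \<in> carrier G" "h2 \<in> carrier G"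
      using eng.hyps generate_in_carrier[of "{a}"] assms(2) by auto
    thus ?case using eng.IH g(1) by (metis m_assoc)
  qed
  thus ?thesis unfolding centralizer_def by (auto intro: generate.incl)
qed

text \<open>\<open>\<iota>\<close> is itself the pair of the identity matrix and
  \<open>z = 1\<close>, as \<open>1 ^ p - 1 = 0\<close>.\<close>

lemma iota_in_Aut: "iota p u \<in> carrier (Aut_curve p u)" for u :: "'k poly fract"
proof -
  have "moebius_subst (mat 1) u - u = 1 ^ p - 1" by (simp add: moebius_subst_one)
  hence "Phi (moebius_subst (mat 1)) 1 \<in> fun_field_iso p u u" by (intro Phi_moebius_subst_iso) simp_all
  moreover have "iota p u f = Phi (moebius_subst (mat 1)) 1 f" if "f \<in> Car" for f
    using that by (simp add: iota_eq Phi_def moebius_subst_one map_poly_idI)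
  ultimately have "iota p u \<in> fun_field_iso p u u" by (rule iso_cong)
  thus ?thesis by (simp add: carrier_Aut iota_def carrier_ff)
qed

lemma Cent_iota_eq:
  "Cent_iota p u = {\<phi> \<in> carrier (Aut_curve p u). \<forall>f\<in>Car. \<phi> (iota p u f) = iota p u (\<phi> f)}"
  for u :: "'k poly fract"
proof -
  have "\<phi> \<otimes>\<^bsub>Aut_curve p u\<^esub> iota p u = iota p u \<otimes>\<^bsub>Aut_curve p u\<^esub> \<phi> \<longleftrightarrow> (\<forall>f\<in>Car. \<phi> (iota p u f) = iota p u (\<phi> f))"
    if "\<phi> \<in> carrier (Aut_curve p u)" for \<phi>
    unfolding mult_Aut[OF that iota_in_Aut] mult_Aut[OF iota_in_Aut that] compose_def
    by (auto simp: fun_eq_iff restrict_def)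
  thus ?thesis
    unfolding Cent_iota_def centralizer_generate_singleton[OF group_Aut_curve iota_in_Aut] by blast
qed

text \<open>Different pairs may give one automorphism, namely for proportional matrices;
  \<open>card_Cent_iota\<close> divides this out.\<close>

lemma Cent_iota_image:
  "Cent_iota p u = (\<lambda>(A, z). restrict (Phi (moebius_subst A) z) Car) ` {(A, z). invertible A \<and> moebius_subst A u - u = z ^ p - z}"
  for u :: "'k poly fract"
proof (intro Set.set_eqI iffI)
  fix \<phi> assume "\<phi> \<in> Cent_iota p u"
  hence \<phi>: "\<phi> \<in> fun_field_iso p u u" "\<phi> \<in> extensional Car" "\<And>f. f \<in> Car \<Longrightarrow> \<phi> (iota p u f) = iota p u (\<phi> f)"
    by (auto simp: Cent_iota_eq carrier_Aut)
  obtain A z where A: "invertible A" "moebius_subst A u - u = z ^ p - z" "\<forall>f\<in>Car. \<phi> f = Phi (moebius_subst A) z f"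
    using iso_imp_Phi[OF \<phi>(1,3)] by blast
  have "\<phi> = restrict (Phi (moebius_subst A) z) Car"
    using A(3) \<phi>(2) by (intro extensionalityI[of _ Car]) auto
  thus "\<phi> \<in> (\<lambda>(A, z). restrict (Phi (moebius_subst A) z) Car) ` {(A, z). invertible A \<and> moebius_subst A u - u = z ^ p - z}"
    using A by (intro image_eqI[of _ _ "(A, z)"]) auto
next
  fix \<phi> assume "\<phi> \<in> (\<lambda>(A, z). restrict (Phi (moebius_subst A) z) Car) ` {(A, z). invertible A \<and> moebius_subst A u - u = z ^ p - z}"
  then obtain A z where A: "invertible A" "moebius_subst A u - u = z ^ p - z" and \<phi>: "\<phi> = restrict (Phi (moebius_subst A) z) Car"
    by auto
  have "\<phi> \<in> fun_field_iso p u u" by (rule iso_cong[OF Phi_moebius_subst_iso(1)[OF A]]) (simp add: \<phi>)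
  moreover have "iota p u f \<in> Car" if "f \<in> Car" for f
    using that by (simp add: iota_eq degree_pcompose)
  ultimately show "\<phi> \<in> Cent_iota p u"
    using Phi_moebius_subst_iso(2)[OF A] by (auto simp: Cent_iota_eq carrier_Aut \<phi>)
qed

lemma restrict_Phi_eq_iff:
  assumes "invertible (A :: 'k ^ 2 ^ 2)" "invertible B"
  shows "restrict (Phi (moebius_subst A) z) Car = restrict (Phi (moebius_subst B) w) Car \<longleftrightarrow> moebius_subst A = moebius_subst B \<and> z = w"
proof
  interpret A: field_hom "moebius_subst A" by (rule field_hom_moebius_subst) fact
  interpret B: field_hom "moebius_subst B" by (rule field_hom_moebius_subst) fact
  assume eq: "restrict (Phi (moebius_subst A) z) Car = restrict (Phi (moebius_subst B) w) Car"
  have eq: "Phi (moebius_subst A) z f = Phi (moebius_subst B) w f" if "f \<in> Car" for f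
    using fun_cong[OF eq, of f] that by simp
  have "moebius_subst A r = moebius_subst B r" for r using eq[OF const_in_Car, of r] by (simp add: A.Phi_const B.Phi_const)
  moreover have "z = w" using eq[OF Y_in_Car, of 0] by (simp add: A.Phi_Y B.Phi_Y)
  ultimately show "moebius_subst A = moebius_subst B \<and> z = w" by blast
qed simp

end

lemma card_scalar_multiples:
  fixes A :: "'k::{field, finite} ^ 2 ^ 2"
  assumes A: "invertible A"
  shows "card {B. invertible B \<and> (\<exists>c. c \<noteq> 0 \<and> B = mat c ** A)} = CARD('k) - 1"
proof -
  have mc: "(mat c ** A) $ i $ j = c * A $ i $ j" for c i j
    by (simp add: matrix_matrix_mult_def mat_def if_distrib if_distribR cong: if_cong)
  have inv: "invertible (mat c ** A)" if "c \<noteq> 0" for c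
    using that A by (intro invertible_mult) (simp_all add: invertible_2 mat_def)
  have "inj_on (\<lambda>c. mat c ** A) (UNIV - {0})"
  proof (rule inj_onI)
    fix c d assume eq: "mat c ** A = mat d ** A"
    have "c * A $ i $ j = d * A $ i $ j" for i j using eq mc by metis
    moreover have "\<exists>i j. A $ i $ j \<noteq> 0" 
    proof (rule ccontr)
      assume "\<not> ?thesis"
      hence "A $ i $ j = 0" for i j by blast
      thus False using A by (simp add: invertible_2)
    qed
    ultimately show "c = d" by auto
  qed
  moreover have "{B. invertible B \<and> (\<exists>c. c \<noteq> 0 \<and> B = mat c ** A)} = (\<lambda>c. mat c ** A) ` (UNIV - {0})"
    using inv by auto
  ultimately show ?thesis by (simp add: card_image card_Diff_singleton)
qed

context finite_char
begin

text \<open>Double count of the pairs \<open>(A, z)\<close>: a matrix fixing the class of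
  \<open>u\<close> admits a coset of the prime field as values of \<open>z\<close>, and an
  automorphism determines \<open>z\<close> and leaves \<open>q - 1\<close> proportional
  matrices.\<close>

lemma card_Cent_iota:
  fixes u :: "'k poly fract"
  shows "card (Cent_iota p u) * (CARD('k) - 1) = p * card {A. invertible A \<and> moebius_subst A u - u \<in> artin_schreier p}"
proof -
  let ?X = "{(A, z). invertible A \<and> moebius_subst A u - u = z ^ p - z}"
  let ?G = "{A. invertible A \<and> moebius_subst A u - u \<in> artin_schreier p}"
  let ?Z = "\<lambda>A. {z. z ^ p - z = moebius_subst A u - u}"
  have Z: "finite (?Z A) \<and> card (?Z A) = p" if A: "A \<in> ?G" for A
  proof -
    obtain w where w: "moebius_subst A u - u = w ^ p - w" using A by (auto simp: artin_schreier_def)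
    show ?thesis unfolding w using card_AS_solutions[OF prime_p CHAR_kx, of w] by blast
  qed
  have X: "?X = Sigma ?G ?Z" by (auto simp: artin_schreier_def)
  have finX: "finite ?X" unfolding X using Z by (intro finite_SigmaI) auto
  have "card ?X = card ?G * p" unfolding X using Z by (subst card_SigmaI) auto
  moreover have "card ?X = card ((\<lambda>(A, z). restrict (Phi (moebius_subst A) z) Car) ` ?X) * (CARD('k) - 1)"
  proof (rule card_eq_card_image_times[OF finX])
    fix a assume a: "a \<in> ?X"
    obtain A z where Az: "a = (A, z)" "invertible A" "moebius_subst A u - u = z ^ p - z" using a by auto
    have "{b \<in> ?X. (case b of (A, z) \<Rightarrow> restrict (Phi (moebius_subst A) z) Car) = (case a of (A, z) \<Rightarrow> restrict (Phi (moebius_subst A) z) Car)}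
        = {B. invertible B \<and> (\<exists>c. c \<noteq> 0 \<and> B = mat c ** A)} \<times> {z}" (is "?L = ?R")
    proof -
      have "(B, w) \<in> ?L \<longleftrightarrow> (B, w) \<in> ?R" for B w
      proof (cases "invertible B")
        case True
        have "(\<exists>c. c \<noteq> 0 \<and> B = mat c ** A) \<longleftrightarrow> moebius_subst B = moebius_subst A"
          using mobA_eq_iff[OF Az(2) True] moebius_subst_eq_iff[OF True Az(2)] by metis
        thus ?thesis using Az True by (auto simp: restrict_Phi_eq_iff)
      qed auto
      thus ?thesis by auto
    qed
    thus "card {b \<in> ?X. (case b of (A, z) \<Rightarrow> restrict (Phi (moebius_subst A) z) Car) = (case a of (A, z) \<Rightarrow> restrict (Phi (moebius_subst A) z) Car)} = CARD('k) - 1"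
      using card_scalar_multiples[OF Az(2)] by (simp add: card_cartesian_product)
  qed
  ultimately show ?thesis unfolding Cent_iota_image by (simp add: mult.commute)
qed

end

subsection \<open>Counting orbits\<close>

text \<open>Each summand is the size of one orbit divided by \<open>card G\<close>, and the orbits
  partition the set of classes. No group structure is assumed: \<open>stab\<close> replaces the
  cosets of a stabilizer, which admits the order-reversing substitution action, and
  \<open>cl\<close> lets the action be one on classes only.\<close>

lemma sum_inverse_stabilizers:
  fixes cl :: "'x \<Rightarrow> 'm" and act :: "'g \<Rightarrow> 'x \<Rightarrow> 'x"
  assumes fin: "finite G" "finite (cl ` V)"
    and e: "e \<in> G" "\<And>u. u \<in> V \<Longrightarrow> cl (act e u) = cl u"
    and closed: "\<And>u g. u \<in> V \<Longrightarrow> g \<in> G \<Longrightarrow> act g u \<in> V"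
    and rel: "\<And>u. u \<in> V \<Longrightarrow> rel `` {u} = {v \<in> V. \<exists>g\<in>G. cl v = cl (act g u)}"
    and rel_eq: "\<And>u v. u \<in> V \<Longrightarrow> v \<in> rel `` {u} \<Longrightarrow> rel `` {v} = rel `` {u}"
    and stab: "\<And>u h. u \<in> V \<Longrightarrow> h \<in> G \<Longrightarrow> card {g \<in> G. cl (act g u) = cl (act h u)} = card {g \<in> G. cl (act g u) = cl u}"
  shows "(\<Sum>c\<in>V // rel. 1 / real (card {g \<in> G. cl (act g (SOME u. u \<in> c)) = cl (SOME u. u \<in> c)}))
    = real (card (cl ` V)) / real (card G)"
proof -
  have G0: "card G > 0" using fin e(1) by (auto simp: card_gt_0_iff)
  have self: "u \<in> rel `` {u}" if "u \<in> V" for u unfolding rel[OF that] using that e(1) e(2)[OF that] by (intro CollectI conjI bexI[of _ e]) simp_all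
  have in_quotient: "c \<subseteq> V \<and> (\<forall>u\<in>c. rel `` {u} = c) \<and> c \<noteq> {}" if c: "c \<in> V // rel" for c
  proof -
    obtain u where u: "u \<in> V" "c = rel `` {u}" using c by (auto simp: quotient_def)
    have "c \<subseteq> V" unfolding u(2) rel[OF u(1)] by blast
    moreover have "u \<in> c" unfolding u(2) by (rule self[OF u(1)])
    ultimately show ?thesis using rel_eq[OF u(1)] u(2) by blast
  qed
  have summand: "1 / real (card {g \<in> G. cl (act g (SOME u. u \<in> c)) = cl (SOME u. u \<in> c)}) = real (card (cl ` c)) / real (card G)"
    if c: "c \<in> V // rel" for c
  proof -
    define s where "s = (SOME u. u \<in> c)"
    have "s \<in> c" using in_quotient[OF c] unfolding s_def by (metis some_in_eq)
    hence s: "s \<in> V" "c = rel `` {s}" using in_quotient[OF c] by auto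
    have "cl ` c = (\<lambda>g. cl (act g s)) ` G"
      unfolding s(2) rel[OF s(1)] using closed[OF s(1)] by (auto simp: image_iff)
    moreover have "card G = card ((\<lambda>g. cl (act g s)) ` G) * card {g \<in> G. cl (act g s) = cl s}"
      by (rule card_eq_card_image_times[OF fin(1) stab[OF s(1)]])
    ultimately have "card G = card (cl ` c) * card {g \<in> G. cl (act g s) = cl s}" by simp
    thus ?thesis unfolding s_def[symmetric] using G0 by (auto simp: field_simps)
  qed
  have disj: "c = c'" if c: "c \<in> V // rel" "c' \<in> V // rel" and ne: "cl ` c \<inter> cl ` c' \<noteq> {}" for c c'
  proof -
    obtain v w where vw: "v \<in> c" "w \<in> c'" "cl w = cl v" using ne by force
    have V: "v \<in> V" "w \<in> V" using vw in_quotient[OF c(1)] in_quotient[OF c(2)] by blast+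
    have "w \<in> rel `` {v}" unfolding rel[OF V(1)]
      using V vw(3) e(1) e(2)[OF V(1)] by (intro CollectI conjI bexI[of _ e]) simp_all
    hence "rel `` {w} = rel `` {v}" by (rule rel_eq[OF V(1)])
    thus ?thesis using vw in_quotient[OF c(1)] in_quotient[OF c(2)] by blast
  qed
  have U: "(\<Union>c\<in>V // rel. cl ` c) = cl ` V"
  proof
    show "cl ` V \<subseteq> (\<Union>c\<in>V // rel. cl ` c)" using self by (fastforce simp: quotient_def)
  qed (use in_quotient in blast)
  have finq: "finite (V // rel)"
  proof (rule finite_imageD)
    show "finite ((`) cl ` (V // rel))"
      by (rule finite_subset[of _ "Pow (cl ` V)"]) (use in_quotient fin(2) in blast)+
    show "inj_on ((`) cl) (V // rel)"
    proof (rule inj_onI)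
      fix c c' assume c: "c \<in> V // rel" "c' \<in> V // rel" "cl ` c = cl ` c'"
      hence "cl ` c \<inter> cl ` c' \<noteq> {}" using in_quotient by auto
      thus "c = c'" using disj c by blast
    qed
  qed
  have "card (cl ` V) = (\<Sum>c\<in>V // rel. card (cl ` c))"
    unfolding U[symmetric]
  proof (rule card_UN_disjoint[OF finq])
    show "\<forall>c\<in>V // rel. finite (cl ` c)"
      using in_quotient fin(2) by (meson finite_subset image_mono)
  qed (use disj in blast)
  moreover have "(\<Sum>c\<in>V // rel. 1 / real (card {g \<in> G. cl (act g (SOME u. u \<in> c)) = cl (SOME u. u \<in> c)}))
      = (\<Sum>c\<in>V // rel. real (card (cl ` c)) / real (card G))"
    by (rule sum.cong[OF refl summand])
  ultimately show ?thesis by (simp add: sum_divide_distrib)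
qed

lemma card_translate_eq:
  assumes "finite A" "finite B" "\<And>g. g \<in> A \<Longrightarrow> f g \<in> B" "\<And>g. g \<in> B \<Longrightarrow> f' g \<in> A"
    and "\<And>g. f' (f g) = g" "\<And>g. f (f' g) = g"
  shows "card A = card B"
  by (rule bij_betw_same_card[of f], rule bij_betwI[of _ _ _ f']) (use assms in auto)

section \<open>Invariance of types under matrices, and orbits on classes and on divisors\<close>

context finite_char
begin

text \<open>The entries of \<open>A\<close> lie in \<open>k\<close> and are fixed by Frobenius.
  Consequently matrices permute Frobenius orbits and preserve types.\<close>

lemma moebius_frobP:
  fixes A :: "'k ^ 2 ^ 2"
  assumes "invertible A"
  shows "moebius A (frobP Q) = frobP (moebius A Q)"
proof -
  interpret F: field_hom "frob :: 'k alg_closure \<Rightarrow> _" by (rule field_hom_frob)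
  have lin: "to_ac a * frob z + to_ac b = frob (to_ac a * z + to_ac b)" for a b :: 'k and z
    by (simp add: frob_to_ac)
  have map: "frobP (Affine z) = Affine (frob z)" "frobP Infinity = Infinity" for z :: "'k alg_closure"
    by (simp_all add: frob_def)
  show ?thesis
  proof (cases Q)
    case (Affine z)
    thus ?thesis unfolding Affine map moebius.simps lin
      by (simp del: F.hom_add F.hom_mult flip: frob_def)
  next
    case Infinity
    thus ?thesis unfolding Infinity map moebius.simps by (simp add: frob_to_ac flip: frob_def)
  qed
qed

lemma orbit_moebius:
  fixes A :: "'k ^ 2 ^ 2"
  assumes "invertible A"
  shows "frobenius_orbit (moebius A Q) = moebius A ` frobenius_orbit Q"
proof -
  have "(frobP ^^ i) (moebius A Q) = moebius A ((frobP ^^ i) Q)" for i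
    by (induction i) (simp_all add: moebius_frobP[OF assms])
  thus ?thesis by (simp add: frobenius_orbit_def image_image)
qed

lemma has_type_moebius:
  fixes A :: "'k ^ 2 ^ 2"
  assumes A: "invertible A"
  shows "has_type (image_mset (moebius A) W) R S \<longleftrightarrow> has_type W R S"
proof -
  let ?f = "moebius A"
  have inj: "inj ?f" using bij_moebius[OF A] by (rule bij_is_inj)
  have cnt: "count (image_mset ?f W) (?f Q) = count W Q" for Q
    by (rule count_image_mset_bij[OF bij_moebius[OF A]])
  have "mset_set (?f ` set_mset W) = image_mset ?f (mset_set (set_mset W))"
    using inj by (simp add: image_mset_mset_set inj_on_subset)
  hence "ramification_data (image_mset ?f W) = ramification_data W"
    by (simp add: ramification_data_def image_mset.compositionality o_def cnt)
  moreover have "splitting_behavior (image_mset ?f W) = splitting_behavior W"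
  proof -
    have orb: "frobenius_orbit ` set_mset (image_mset ?f W) = (`) ?f ` frobenius_orbit ` set_mset W"
      by (simp add: image_image orbit_moebius[OF A])
    have "inj ((`) ?f)" by (simp add: inj_def inj_image_eq_iff[OF inj])
    hence "mset_set ((`) ?f ` frobenius_orbit ` set_mset W) = image_mset ((`) ?f) (mset_set (frobenius_orbit ` set_mset W))"
      by (simp add: image_mset_mset_set inj_on_subset)
    moreover have "card (?f ` P) = card P" for P using inj by (simp add: card_image inj_on_subset)
    moreover have "count (image_mset ?f W) ` ?f ` P = count W ` P" for P by (simp add: image_image cnt)
    ultimately show ?thesis
      unfolding splitting_behavior_def orb by (simp add: image_mset.compositionality o_def)
  qed
  ultimately show ?thesis by (simp add: has_type_def)
qed

lemma exact_moebius_subst: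
  fixes A :: "'k ^ 2 ^ 2"
  assumes A: "invertible A" and AB: "B ** A = mat 1" "invertible B" and v: "v \<in> exact W"
  shows "moebius_subst A v \<in> exact (image_mset (moebius B) W)"
proof -
  have W: "W = image_mset (moebius A) (div_infinity (moebius_subst A v))"
    using v div_infinity_moebius_subst[OF A] by (simp add: exact_def)
  have "image_mset (moebius B) W = div_infinity (moebius_subst A v)"
    unfolding W using AB A by (simp add: image_mset.compositionality o_def moebius_mult)
  thus ?thesis by (simp add: exact_def)
qed

lemma coprime_divisor_moebius:
  fixes A :: "'k ^ 2 ^ 2"
  assumes A: "invertible A" and W: "coprime_divisor W"
  shows "coprime_divisor (image_mset (moebius A) W)"
  unfolding coprime_divisor_def
proof
  fix Q
  obtain Q' where "Q = moebius A Q'" using bij_is_surj[OF bij_moebius[OF A]] by (metis surjD)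
  thus "count (image_mset (moebius A) W) Q > 0 \<longrightarrow> coprime (count (image_mset (moebius A) W) Q) p"
    using W by (simp add: count_image_mset_bij[OF bij_moebius[OF A]] coprime_divisor_def del: count_greater_zero_iff)
qed

lemma curves_of_type_moebius_subst:
  fixes A :: "'k ^ 2 ^ 2"
  assumes A: "invertible A" and u: "u \<in> curves_of_type p R S"
  shows "moebius_subst A u \<in> curves_of_type p R S"
proof -
  obtain v W where v: "v - u \<in> artin_schreier p" "v \<in> exact W" "coprime_divisor W" "W \<noteq> {#}" "has_type W R S"
    using u unfolding curves_of_type_iff by blast
  obtain B where B: "invertible B" "B ** A = mat 1" using GL2_inverse[OF A] by metis
  have "moebius_subst A v - moebius_subst A u \<in> artin_schreier p"
    using hom_artin_schreier[OF field_hom_moebius_subst[OF A] v(1)] by (simp add: field_hom.hom_diff[OF field_hom_moebius_subst[OF A]])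
  thus ?thesis
    unfolding curves_of_type_iff
    using exact_moebius_subst[OF A B(2,1) v(2)] coprime_divisor_moebius[OF B(1) v(3)] v(4,5) has_type_moebius[OF B(1)]
    by (intro exI[of _ "moebius_subst A v"] exI[of _ "image_mset (moebius B) W"]) simp
qed

lemma divisors_of_type_moebius:
  fixes A :: "'k ^ 2 ^ 2"
  assumes A: "invertible A" and W: "W \<in> divisors_of_type p R S"
  shows "image_mset (moebius A) W \<in> divisors_of_type p R S"
proof -
  obtain v where v: "v \<in> exact W" using W by (auto simp: divisors_of_type_def weighted_branch_divisor_iff)
  obtain B where B: "invertible B" "A ** B = mat 1" using GL2_inverse[OF A] by metis
  have "moebius_subst B v \<in> exact (image_mset (moebius A) W)" by (rule exact_moebius_subst[OF B(1,2) A v])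
  thus ?thesis
    using W coprime_divisor_moebius[OF A, of W] has_type_moebius[OF A]
    by (auto simp: divisors_of_type_def weighted_branch_divisor_iff)
qed

lemma curves_of_type_cong:
  "u \<in> curves_of_type p R S \<Longrightarrow> AS_class u = AS_class v \<Longrightarrow> v \<in> curves_of_type p R S" for u v :: "'k poly fract"
  unfolding curves_of_type_iff AS_class_eq_iff using AS_cong AS_sym by meson

lemma curves_of_type_AS_curve: "u \<in> curves_of_type p R S \<Longrightarrow> AS_curve p u"
  by (simp add: curves_of_type_def)

lemma AS_class_moebius_subst_cong:
  fixes A :: "'k ^ 2 ^ 2"
  assumes A: "invertible A" and "AS_class u = AS_class v"
  shows "AS_class (moebius_subst A u) = AS_class (moebius_subst A v)"
  using hom_artin_schreier[OF field_hom_moebius_subst[OF A], of "v - u" p] assms(2)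
  by (simp add: AS_class_eq_iff field_hom.hom_diff[OF field_hom_moebius_subst[OF A]])

lemma AS_class_moebius_subst_inverse:
  fixes A B :: "'k ^ 2 ^ 2"
  assumes AB: "invertible A" "invertible B" "A ** B = mat 1" "B ** A = mat 1"
  shows "AS_class (moebius_subst A u) = AS_class v \<longleftrightarrow> AS_class u = AS_class (moebius_subst B v)"
proof -
  have "moebius_subst B (moebius_subst A w) = w" "moebius_subst A (moebius_subst B w) = w" for w
    using AB by (simp_all add: moebius_subst_comp moebius_subst_one)
  thus ?thesis using AS_class_moebius_subst_cong[OF AB(1), of u "moebius_subst B v"] AS_class_moebius_subst_cong[OF AB(2), of "moebius_subst A u" v] by auto
qed

text \<open>In \<open>AS_isomorphic_iff\<close> the matrix acts on the target \<open>v\<close>;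
  inverting it exhibits the class of \<open>v\<close> in the orbit of that of \<open>u\<close>,
  which also shows that isomorphic curves share their type.\<close>

lemma AS_iso_rel_Image:
  assumes u: "(u :: 'k poly fract) \<in> curves_of_type p R S"
  shows "AS_iso_rel p `` {u} = {v \<in> curves_of_type p R S. \<exists>A\<in>GL2. AS_class v = AS_class (moebius_subst A u)}"
proof (intro Set.set_eqI iffI)
  fix v assume "v \<in> AS_iso_rel p `` {u}"
  then obtain A where A: "invertible A" "moebius_subst A v - u \<in> artin_schreier p"
    by (auto simp: AS_iso_rel_def AS_isomorphic_iff)
  obtain B where B: "invertible B" "A ** B = mat 1" "B ** A = mat 1" using GL2_inverse[OF A(1)] by metis
  have "AS_class (moebius_subst A v) = AS_class u" using A(2) AS_class_eq_iff[of u "moebius_subst A v"] by simp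
  hence "AS_class v = AS_class (moebius_subst B u)" using AS_class_moebius_subst_inverse[OF A(1) B] by simp
  moreover have "v \<in> curves_of_type p R S"
    using curves_of_type_cong[OF curves_of_type_moebius_subst[OF B(1) u]] calculation by simp
  ultimately show "v \<in> {v \<in> curves_of_type p R S. \<exists>A\<in>GL2. AS_class v = AS_class (moebius_subst A u)}" using B(1) by blast
next
  fix v assume "v \<in> {v \<in> curves_of_type p R S. \<exists>A\<in>GL2. AS_class v = AS_class (moebius_subst A u)}"
  then obtain A where v: "v \<in> curves_of_type p R S" and A: "invertible A" "AS_class v = AS_class (moebius_subst A u)" by blast
  obtain B where B: "invertible B" "A ** B = mat 1" "B ** A = mat 1" using GL2_inverse[OF A(1)] by metis
  have "AS_class u = AS_class (moebius_subst B v)" using AS_class_moebius_subst_inverse[OF A(1) B, of u v] A(2) by simp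
  hence "moebius_subst B v - u \<in> artin_schreier p" using AS_class_eq_iff by simp
  thus "v \<in> AS_iso_rel p `` {u}"
    using B(1) u v curves_of_type_AS_curve by (auto simp: AS_iso_rel_def AS_isomorphic_iff)
qed

text \<open>Substitution reverses products, so the fibre is translated to the stabilizer from the
  right; for divisors, in \<open>card_stab_moebius\<close>, the translation is from the
  left.\<close>

lemma card_stab_moebius_subst:
  fixes h :: "'k ^ 2 ^ 2"
  assumes h: "h \<in> GL2"
  shows "card {g \<in> GL2. AS_class (moebius_subst g u) = AS_class (moebius_subst h u)} = card {g \<in> GL2. AS_class (moebius_subst g u) = AS_class u}"
proof -
  obtain h' where h': "invertible h'" "h ** h' = mat 1" "h' ** h = mat 1" using GL2_inverse h by blast
  have inv: "invertible h" using h by simp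
  show ?thesis
  proof (rule card_translate_eq[where f = "\<lambda>g. g ** h'" and f' = "\<lambda>g. g ** h"])
    fix g assume "g \<in> {g \<in> GL2. AS_class (moebius_subst g u) = AS_class (moebius_subst h u)}"
    hence g: "invertible g" "AS_class (moebius_subst h' (moebius_subst g u)) = AS_class u"
      using AS_class_moebius_subst_inverse[OF h'(1) inv h'(3,2), of "moebius_subst g u" u] by auto
    thus "g ** h' \<in> {g \<in> GL2. AS_class (moebius_subst g u) = AS_class u}" using h' by (simp add: moebius_subst_comp invertible_mult)
  next
    fix g assume "g \<in> {g \<in> GL2. AS_class (moebius_subst g u) = AS_class u}"
    hence g: "invertible g" "AS_class (moebius_subst h (moebius_subst g u)) = AS_class (moebius_subst h u)"
      using AS_class_moebius_subst_cong[OF inv, of "moebius_subst g u" u] by auto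
    thus "g ** h \<in> {g \<in> GL2. AS_class (moebius_subst g u) = AS_class (moebius_subst h u)}" using inv by (simp add: moebius_subst_comp invertible_mult)
  qed (simp_all add: h' flip: matrix_mul_assoc)
qed

lemma image_moebius_one: "image_mset (moebius (mat 1)) W = W"
  by (rule multiset.map_ident_strong) simp

lemma card_stab_moebius:
  fixes h :: "'k ^ 2 ^ 2"
  assumes h: "h \<in> GL2"
  shows "card {g \<in> GL2. image_mset (moebius g) W = image_mset (moebius h) W} = card {g \<in> GL2. image_mset (moebius g) W = W}"
proof -
  obtain h' where h': "invertible h'" "h ** h' = mat 1" "h' ** h = mat 1" using GL2_inverse h by blast
  have inv: "invertible h" using h by simp
  have comp: "image_mset (moebius A) (image_mset (moebius B) W) = image_mset (moebius (A ** B)) W"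
    if "invertible A" "invertible B" for A B :: "'k ^ 2 ^ 2" and W
    using that by (simp add: image_mset.compositionality o_def moebius_mult)
  show ?thesis
  proof (rule card_translate_eq[where f = "\<lambda>g. h' ** g" and f' = "\<lambda>g. h ** g"])
    fix g assume "g \<in> {g \<in> GL2. image_mset (moebius g) W = image_mset (moebius h) W}"
    hence g: "invertible g" "image_mset (moebius h') (image_mset (moebius g) W) = image_mset (moebius h') (image_mset (moebius h) W)"
      by auto
    have "image_mset (moebius (h' ** g)) W = W"
      using g(2) unfolding comp[OF h'(1) g(1)] comp[OF h'(1) inv] h'(3) image_moebius_one .
    thus "h' ** g \<in> {g \<in> GL2. image_mset (moebius g) W = W}" using h' g by (simp add: invertible_mult)
  next
    fix g assume "g \<in> {g \<in> GL2. image_mset (moebius g) W = W}"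
    hence g: "invertible g" "image_mset (moebius h) (image_mset (moebius g) W) = image_mset (moebius h) W"
      by auto
    thus "h ** g \<in> {g \<in> GL2. image_mset (moebius g) W = image_mset (moebius h) W}"
      using inv unfolding comp[OF inv g(1)] by (simp add: invertible_mult)
  qed (simp_all add: h' matrix_mul_assoc)
qed

section \<open>From matrices to projective classes\<close>

lemma moebius_scale:
  fixes A :: "'k ^ 2 ^ 2"
  assumes "invertible A" "c \<noteq> 0"
  shows "moebius (mat c ** A) Q = moebius A Q"
proof -
  have "invertible (mat c :: 'k ^ 2 ^ 2)" using assms(2) by (simp add: invertible_2 mat_def)
  hence "moebius (mat c ** A) Q = moebius (mat c) (moebius A Q)" using assms(1) by (simp add: moebius_mult)
  also have "\<dots> = moebius A Q" using assms(2) by (cases "moebius A Q") (simp_all add: mat_def)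
  finally show ?thesis .
qed

definition scale_class :: "'k ^ 2 ^ 2 \<Rightarrow> ('k ^ 2 ^ 2) set" where
  "scale_class A = {B. \<exists>c. c \<noteq> 0 \<and> B = mat c ** A}"

lemma scale_class_self: "A \<in> scale_class A"
  unfolding scale_class_def using matrix_mul_lid[of A] by (intro CollectI exI[of _ 1]) simp

lemma mat_mult_mat: "mat c ** mat d = (mat (c * d) :: 'k ^ 2 ^ 2)"
  by (simp add: vec_eq_iff forall_2 matrix_mult_2) (simp add: mat_def)

lemma scale_class_eq_iff: "scale_class B = scale_class A \<longleftrightarrow> (\<exists>c. c \<noteq> 0 \<and> B = mat c ** A)"
proof
  assume "scale_class B = scale_class A"
  thus "\<exists>c. c \<noteq> 0 \<and> B = mat c ** A" using scale_class_self[of B] by (simp add: scale_class_def)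
next
  assume "\<exists>c. c \<noteq> 0 \<and> B = mat c ** A"
  then obtain c where c: "c \<noteq> 0" "B = mat c ** A" by blast
  have "\<exists>e. e \<noteq> 0 \<and> mat d ** B = mat e ** A" if "d \<noteq> 0" for d
    using that c by (intro exI[of _ "d * c"]) (simp add: matrix_mul_assoc mat_mult_mat)
  moreover have "\<exists>e. e \<noteq> 0 \<and> mat d ** A = mat e ** B" if "d \<noteq> 0" for d
    using that c by (intro exI[of _ "d / c"]) (simp add: matrix_mul_assoc mat_mult_mat)
  ultimately show "scale_class B = scale_class A" unfolding scale_class_def by blast
qed

lemma PGL2_divisor_class:
  fixes A :: "'k ^ 2 ^ 2"
  assumes "invertible A"
  shows "PGL2_divisor (scale_class A) W = image_mset (moebius A) W"
proof -
  have "(SOME B. B \<in> scale_class A) \<in> scale_class A"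
    using scale_class_self by (rule someI)
  then obtain c where "c \<noteq> 0" "(SOME B. B \<in> scale_class A) = mat c ** A"
    by (auto simp: scale_class_def)
  hence "moebius (SOME B. B \<in> scale_class A) = moebius A"
    using moebius_scale[OF assms] by (simp add: fun_eq_iff)
  thus ?thesis by (simp add: PGL2_divisor_def)
qed

lemma PGL2_eq: "PGL2 = (\<lambda>A. scale_class A) ` GL2"
  unfolding PGL2_def quotient_def scale_class_def by auto

lemma PGL2_orbit_rel_Image:
  "PGL2_orbit_rel `` {W} = {W'. \<exists>A\<in>GL2. W' = image_mset (moebius A) W}" for W :: "'k alg_closure proj_line multiset"
  unfolding PGL2_orbit_rel_def PGL2_eq by (auto simp: PGL2_divisor_class)

text \<open>Proportional matrices act alike, so the stabilizer among matrices is the full preimage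
  of \<open>Gamma_of W\<close>.\<close>

lemma card_Gamma_of:
  fixes W :: "'k alg_closure proj_line multiset"
  shows "card {A \<in> GL2. image_mset (moebius A) W = W} = card (Gamma_of W) * (CARD('k) - 1)"
proof -
  let ?S = "{A \<in> GL2. image_mset (moebius A) W = W}" and ?f = "\<lambda>A. scale_class A"
  have "Gamma_of W = ?f ` ?S"
    unfolding Gamma_of_def PGL2_eq by (auto simp: PGL2_divisor_class)
  moreover have "card ?S = card (?f ` ?S) * (CARD('k) - 1)"
  proof (rule card_eq_card_image_times)
    fix A assume A: "A \<in> ?S"
    have "{B \<in> ?S. ?f B = ?f A} = {B. invertible B \<and> (\<exists>c. c \<noteq> 0 \<and> B = mat c ** A)}"
      unfolding scale_class_eq_iff using A moebius_scale[of A] by (auto simp: fun_eq_iff[symmetric] cong: image_mset_cong)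
    thus "card {B \<in> ?S. ?f B = ?f A} = CARD('k) - 1" using card_scalar_multiples[of A] A by simp
  qed simp
  ultimately show ?thesis by simp
qed

section \<open>Assembling the count from divisors, fibres and orbits\<close>

lemma finite_divisors_of_type: "finite (divisors_of_type p R S :: 'k alg_closure proj_line multiset set)"
proof -
  \<comment> \<open>The common size of the divisors of this type. Each of them is the polar divisor
    of a fraction whose numerator and denominator have degree at most \<open>m\<close>, and there
    are finitely many such fractions.\<close>
  define m where "m = (\<Sum>(m, e)\<in>#S. m * e)"
  let ?D = "{f :: 'k poly. Polynomial.degree f \<le> m}"
  have "divisors_of_type p R S \<subseteq> (\<lambda>(f, g). div_infinity (Fract f g)) ` (?D \<times> ?D)"
  proof
    fix W :: "'k alg_closure proj_line multiset"
    assume W: "W \<in> divisors_of_type p R S"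
    then obtain v where v: "v \<in> exact W" by (auto simp: divisors_of_type_def weighted_branch_divisor_iff)
    have st: "stable W" by (rule stable_if_exact[OF v])
    have "size W = m" unfolding m_def using size_stable[OF st] W by (simp add: divisors_of_type_def has_type_def)
    obtain g :: "'k poly" where g: "lead_coeff g = 1" "\<And>z. Polynomial.order z (map_poly to_ac g) = count W (Affine z)"
      "size W = Polynomial.degree g + count W Infinity" using divisor_poly[OF st] by blast
    have "v \<in> L W" using v by (simp add: exact_iff L_def)
    then obtain f where "v = Fract f g" "Polynomial.degree f \<le> m"
      unfolding L_eq[OF g] \<open>size W = m\<close> by blast
    moreover have "Polynomial.degree g \<le> m" using g(3) \<open>size W = m\<close> by simp
    moreover have "W = div_infinity v" using v by (simp add: exact_def)
    ultimately show "W \<in> (\<lambda>(f, g). div_infinity (Fract f g)) ` (?D \<times> ?D)" by force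
  qed
  moreover have "finite (?D \<times> ?D)" using card_poly_degree[of m] by simp
  ultimately show ?thesis using finite_subset by blast
qed

lemma AS_class_curves_of_type:
  "AS_class ` (curves_of_type p R S :: 'k poly fract set) = (\<Union>W\<in>divisors_of_type p R S. N_of p W)"
proof
  show "AS_class ` curves_of_type p R S \<subseteq> (\<Union>W\<in>divisors_of_type p R S. N_of p W)"
  proof
    fix c :: "'k poly fract set" assume "c \<in> AS_class ` curves_of_type p R S"
    then obtain u where u: "u \<in> curves_of_type p R S" "c = AS_class u" by blast
    then obtain v W where v: "v - u \<in> artin_schreier p" "v \<in> exact W" "coprime_divisor W" "W \<noteq> {#}" "has_type W R S"
      unfolding curves_of_type_iff by blast
    have "W \<in> divisors_of_type p R S"
      using v by (auto simp: divisors_of_type_def weighted_branch_divisor_iff)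
    moreover have "c \<in> N_of p W" using v u AS_class_eq_iff[of u v] by (simp add: N_of_eq)
    ultimately show "c \<in> (\<Union>W\<in>divisors_of_type p R S. N_of p W)" by blast
  qed
  show "(\<Union>W\<in>divisors_of_type p R S. N_of p W) \<subseteq> AS_class ` curves_of_type p R S"
  proof
    fix c :: "'k poly fract set" assume "c \<in> (\<Union>W\<in>divisors_of_type p R S. N_of p W)"
    then obtain W v where W: "W \<in> divisors_of_type p R S" "v \<in> exact W" "c = AS_class v" by (auto simp: N_of_eq)
    have "v \<in> curves_of_type p R S"
      unfolding curves_of_type_iff using W AS_kx(1)
      by (intro exI[of _ v] exI[of _ W]) (simp add: divisors_of_type_def weighted_branch_divisor_iff)
    thus "c \<in> AS_class ` curves_of_type p R S" using W by blast
  qed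
qed

text \<open>By \<open>standard_unique\<close> a class determines its branch divisor, so the union in
  \<open>AS_class_curves_of_type\<close> is disjoint.\<close>

lemma N_of_disjoint:
  assumes "W \<in> divisors_of_type p R S" "W' \<in> divisors_of_type p R S" "N_of p W \<inter> N_of p W' \<noteq> {}"
  shows "W = (W' :: 'k alg_closure proj_line multiset)"
proof -
  obtain v v' where v: "v \<in> exact W" "v' \<in> exact W'" "AS_class v = AS_class v'" using assms(3) unfolding N_of_eq by auto
  have "standard p v" "standard p v'"
    using v assms by (auto simp: standard_iff exact_def divisors_of_type_def weighted_branch_divisor_iff)
  hence "div_infinity v = div_infinity v'" using standard_unique v(3) AS_class_eq_iff by blast
  thus ?thesis using v by (simp add: exact_def)
qed

lemma card_AS_class_curves_of_type:
  fixes W0 :: "'k alg_closure proj_line multiset"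
  assumes W0: "W0 \<in> divisors_of_type p R S"
  shows "finite (AS_class ` (curves_of_type p R S :: 'k poly fract set))"
    and "card (AS_class ` (curves_of_type p R S :: 'k poly fract set))
      = card (divisors_of_type p R S :: 'k alg_closure proj_line multiset set) * card (N_of p W0)"
proof -
  let ?D = "divisors_of_type p R S :: 'k alg_closure proj_line multiset set"
  have D: "stable W \<and> coprime_divisor W \<and> splitting_behavior W = S" if "W \<in> ?D" for W
    using that stable_if_exact by (auto simp: divisors_of_type_def weighted_branch_divisor_iff has_type_def)
  have fin: "finite (N_of p W)" if "W \<in> ?D" for W using D[OF that] finite_N_of by blast
  show "finite (AS_class ` (curves_of_type p R S :: 'k poly fract set))"
    unfolding AS_class_curves_of_type using fin finite_divisors_of_type by blast
  have "card (\<Union>W\<in>?D. N_of p W) = (\<Sum>W\<in>?D. card (N_of p W))"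
    by (rule card_UN_disjoint[OF finite_divisors_of_type]) (use fin N_of_disjoint in blast)+
  also have "\<dots> = (\<Sum>W\<in>?D. card (N_of p W0))"
    by (rule sum.cong[OF refl], rule card_N_of_eq) (use D W0 in blast)+
  finally show "card (AS_class ` (curves_of_type p R S :: 'k poly fract set)) = card ?D * card (N_of p W0)"
    unfolding AS_class_curves_of_type by simp
qed

text \<open>By \<open>card_Cent_iota\<close> the weights are \<open>(q - 1) / p\<close> times
  inverse sizes of stabilizers among matrices, to which orbit counting on classes applies.\<close>

lemma sum_curves_of_type:
  assumes "finite (AS_class ` (curves_of_type p R S :: 'k poly fract set))"
  shows "(\<Sum>c\<in>(curves_of_type p R S :: 'k poly fract set) // AS_iso_rel p. 1 / real (card (Cent_iota p (SOME u. u \<in> c))))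
    = real (CARD('k) - 1) / real p * (real (card (AS_class ` (curves_of_type p R S :: 'k poly fract set))) / real (card (GL2 :: ('k ^ 2 ^ 2) set)))"
proof -
  let ?X = "curves_of_type p R S :: 'k poly fract set"
  have q: "CARD('k) > 1" using card_mono[of "UNIV" "{0, 1 :: 'k}"] by simp
  have summand: "1 / real (card (Cent_iota p u)) = real (CARD('k) - 1) / real p * (1 / real (card {A \<in> GL2. AS_class (moebius_subst A u) = AS_class u}))"
    for u :: "'k poly fract"
  proof -
    have "{A \<in> GL2. AS_class (moebius_subst A u) = AS_class u} = {A. invertible A \<and> moebius_subst A u - u \<in> artin_schreier p}"
      using AS_class_eq_iff[of u] by auto
    hence "card (Cent_iota p u) * (CARD('k) - 1) = p * card {A \<in> GL2. AS_class (moebius_subst A u) = AS_class u}"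
      using card_Cent_iota[of u] by simp
    moreover have "card {A \<in> GL2. AS_class (moebius_subst A u) = AS_class u} > 0"
      by (auto simp: card_gt_0_iff moebius_subst_one intro!: exI[of _ "mat 1"])
    moreover have "1 / real a = real b / real p * (1 / real s)" if "a * b = p * s" "b > 0" "s > 0" for a b s
    proof -
      have "real a * real b = real p * real s" using arg_cong[OF that(1), of real] by simp
      moreover have "a > 0" using that p_ge_2 by (cases a) auto
      ultimately show ?thesis using that p_ge_2 by (simp add: field_simps)
    qed
    ultimately show ?thesis using q by simp
  qed
  have "(\<Sum>c\<in>?X // AS_iso_rel p. 1 / real (card {A \<in> GL2. AS_class (moebius_subst A (SOME u. u \<in> c)) = AS_class (SOME u. u \<in> c)}))
      = real (card (AS_class ` ?X)) / real (card (GL2 :: ('k ^ 2 ^ 2) set))"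
  proof (rule sum_inverse_stabilizers[where e = "mat 1"])
    fix u v assume u: "u \<in> ?X" and v: "v \<in> AS_iso_rel p `` {u}"
    obtain A where A: "invertible A" "AS_class v = AS_class (moebius_subst A u)" and vX: "v \<in> ?X"
      using v unfolding AS_iso_rel_Image[OF u] by blast
    obtain B where B: "invertible B" "A ** B = mat 1" "B ** A = mat 1" using GL2_inverse[OF A(1)] by metis
    have u_eq: "AS_class u = AS_class (moebius_subst B v)" using AS_class_moebius_subst_inverse[OF A(1) B, of u v] A(2) by simp
    have "\<exists>D\<in>GL2. AS_class (moebius_subst C v) = AS_class (moebius_subst D u)" if "C \<in> GL2" for C
      using AS_class_moebius_subst_cong[of C, OF _ A(2)] that A(1)
      by (intro bexI[of _ "A ** C"]) (simp_all add: moebius_subst_comp invertible_mult)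
    moreover have "\<exists>D\<in>GL2. AS_class (moebius_subst C u) = AS_class (moebius_subst D v)" if "C \<in> GL2" for C
      using AS_class_moebius_subst_cong[of C, OF _ u_eq] that B(1)
      by (intro bexI[of _ "B ** C"]) (simp_all add: moebius_subst_comp invertible_mult)
    ultimately have "(\<exists>C\<in>GL2. w = AS_class (moebius_subst C v)) \<longleftrightarrow> (\<exists>C\<in>GL2. w = AS_class (moebius_subst C u))" for w
      by metis
    thus "AS_iso_rel p `` {v} = AS_iso_rel p `` {u}"
      unfolding AS_iso_rel_Image[OF u] AS_iso_rel_Image[OF vX] by simp
  next
    fix u and h :: "'k ^ 2 ^ 2" assume "h \<in> GL2"
    thus "card {g \<in> GL2. AS_class (moebius_subst g u) = AS_class (moebius_subst h u)} = card {g \<in> GL2. AS_class (moebius_subst g u) = AS_class u}"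
      by (rule card_stab_moebius_subst)
  qed (use assms in \<open>simp_all add: moebius_subst_one curves_of_type_moebius_subst AS_iso_rel_Image\<close>)
  thus ?thesis by (simp only: summand sum_distrib_left[symmetric] image_ident)
qed

text \<open>Orbit counting with the identity for \<open>cl\<close>. The factor \<open>q - 1\<close>
  and the number of matrices are the same as in \<open>sum_curves_of_type\<close> and cancel in the
  comparison.\<close>

lemma sum_divisors_of_type:
  "(\<Sum>\<O>\<in>(divisors_of_type p R S :: 'k alg_closure proj_line multiset set) // PGL2_orbit_rel.
      1 / real (card (Gamma_of (SOME W. W \<in> \<O>))))
    = real (CARD('k) - 1) * (real (card (divisors_of_type p R S :: 'k alg_closure proj_line multiset set)) / real (card (GL2 :: ('k ^ 2 ^ 2) set)))"
proof -
  let ?D = "divisors_of_type p R S :: 'k alg_closure proj_line multiset set"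
  let ?act = "\<lambda>A. image_mset (moebius A)"
  have q: "CARD('k) > 1" using card_mono[of "UNIV" "{0, 1 :: 'k}"] by simp
  have summand: "1 / real (card (Gamma_of W)) = real (CARD('k) - 1) * (1 / real (card {A \<in> GL2. ?act A W = W}))"
    for W :: "'k alg_closure proj_line multiset"
    unfolding card_Gamma_of using q by simp
  have comp: "?act A (?act B W) = ?act (A ** B) W"
    if "invertible A" "invertible B" for A B :: "'k ^ 2 ^ 2" and W
    using that by (simp add: image_mset.compositionality o_def moebius_mult)
  have "(\<Sum>\<O>\<in>?D // PGL2_orbit_rel. 1 / real (card {A \<in> GL2. (\<lambda>W. W) (?act A (SOME W. W \<in> \<O>)) = (\<lambda>W. W) (SOME W. W \<in> \<O>)}))
      = real (card ((\<lambda>W. W) ` ?D)) / real (card (GL2 :: ('k ^ 2 ^ 2) set))"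
  proof (rule sum_inverse_stabilizers[where e = "mat 1" and cl = "\<lambda>W. W" and act = ?act])
    fix W assume "W \<in> ?D"
    thus "PGL2_orbit_rel `` {W} = {W' \<in> ?D. \<exists>A\<in>GL2. W' = ?act A W}"
      using divisors_of_type_moebius unfolding PGL2_orbit_rel_Image by blast
  next
    fix W W' :: "'k alg_closure proj_line multiset" assume "W' \<in> PGL2_orbit_rel `` {W}"
    then obtain A :: "'k ^ 2 ^ 2" where A: "invertible A" "W' = ?act A W" unfolding PGL2_orbit_rel_Image by blast
    obtain B where B: "invertible B" "A ** B = mat 1" "B ** A = mat 1" using GL2_inverse[OF A(1)] by metis
    have W: "W = ?act B W'" using A B comp[OF B(1) A(1), of W] by (simp add: image_moebius_one)
    have "\<exists>D\<in>GL2. ?act C W' = ?act D W" if "C \<in> GL2" for C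
      using comp[of C A W] that A by (intro bexI[of _ "C ** A"]) (simp_all add: invertible_mult)
    moreover have "\<exists>D\<in>GL2. ?act C W = ?act D W'" if "C \<in> GL2" for C
      using comp[of C B W'] that B(1) W by (intro bexI[of _ "C ** B"]) (simp_all add: invertible_mult)
    ultimately have "(\<exists>C\<in>GL2. V = ?act C W') \<longleftrightarrow> (\<exists>C\<in>GL2. V = ?act C W)" for V
      by metis
    thus "PGL2_orbit_rel `` {W'} = PGL2_orbit_rel `` {W}"
      unfolding PGL2_orbit_rel_Image by simp
  next
    fix W :: "'k alg_closure proj_line multiset" and h :: "'k ^ 2 ^ 2" assume "h \<in> GL2"
    thus "card {g \<in> GL2. ?act g W = ?act h W} = card {g \<in> GL2. ?act g W = W}"
      by (rule card_stab_moebius)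
  qed (use divisors_of_type_moebius in \<open>simp_all add: image_moebius_one finite_divisors_of_type\<close>)
  thus ?thesis by (simp only: summand sum_distrib_left[symmetric] image_ident)
qed

lemma sum_inverse_centralizers:
  fixes W0 :: "'k alg_closure proj_line multiset"
  assumes "weighted_branch_divisor p W0" "has_type W0 R S"
  shows "(\<Sum>c\<in>(curves_of_type p R S :: 'k poly fract set) // AS_iso_rel p. 1 / real (card (Cent_iota p (SOME u. u \<in> c))))
    = inverse (real p) * real (card (N_of p W0)) *
      (\<Sum>\<O>\<in>(divisors_of_type p R S :: 'k alg_closure proj_line multiset set) // PGL2_orbit_rel.
        1 / real (card (Gamma_of (SOME W. W \<in> \<O>))))"
proof -
  have "W0 \<in> divisors_of_type p R S" using assms by (simp add: divisors_of_type_def)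
  note M = card_AS_class_curves_of_type[OF this]
  show ?thesis
    unfolding sum_curves_of_type[OF M(1)] sum_divisors_of_type M(2) by (simp add: divide_simps)
qed

end

theorem theorem4p7:
  fixes p q n r :: nat
    and R :: "nat multiset" and S :: "(nat \<times> nat) multiset"
    and W\<^sub>0 :: "'k::{field, finite} alg_closure proj_line multiset"
  assumes "prime p" and "CARD('k) = q" and "q = p ^ n"
    and "size R = r"
    and "weighted_branch_divisor p W\<^sub>0" and "has_type W\<^sub>0 R S"
  shows "(\<Sum>c \<in> (curves_of_type p R S :: 'k poly fract set) // AS_iso_rel p.
            1 / real (card (Cent_iota p (SOME u. u \<in> c))))
       = inverse (real p) * real (card (N_of p W\<^sub>0)) *
         (\<Sum>\<O> \<in> (divisors_of_type p R S :: 'k alg_closure proj_line multiset set) // PGL2_orbit_rel.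
            1 / real (card (Gamma_of (SOME W. W \<in> \<O>))))"
proof -
  interpret finite_char "TYPE('k)" p n
    using assms(1-3) by unfold_locales simp_all
  show ?thesis by (rule sum_inverse_centralizers[OF assms(5,6)])
qed

end
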